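(* Let $G$ be an algebraic supergroup with Lie superalgebra $\mathfrak{g}$. For any non-zero projective module $P$ in $\mathrm{Rep}(G)$, we have $\mathrm{supp}(P)=\mathfrak{g}_{neat}$.
   Context: Base field: $\mathbf{k}$, algebraically closed of characteristic $0$. The superdimension of a vector superspace $V$ is $\dim V_{\bar 0}-\dim V_{\bar 1}$. "Algebraic supergroup" means affine algebraic group superscheme over $\mathbf{k}$. $\mathrm{Rep}(G)$ is the category of finite-dimensional representations of $G$ in vector superspaces, with even equivariant maps; it is rigid symmetric monoidal (SM) with the super braiding. Let $\mathfrak{m}$ be the $(1|1)$-dimensional Lie superalgebra with basis $\bar x,[\bar x,\bar x]$, $\bar x$ odd; an object of $\mathrm{Rep}(\mathfrak{m})$ is a finite-dimensional superspace with an arbitrary odd operator. (The category $\mathrm{Rep}(\mathfrak{m})$ is $\mathrm{Rep}(\mathbb{M})$ for the "minuscule" pro-supergroup $\mathbb{M}$.) For $x\in\mathfrak{g}_{\bar 1}$ let $R_x:\mathrm{Rep}(G)\to\mathrm{Rep}(\mathfrak{m})$ be the restriction functor along $\bar x\mapsto x$. Let $S:\mathrm{Rep}(\mathfrak{m})\to\overline{\mathrm{Rep}(\mathfrak{m})}\simeq\mathrm{Rep}(OSp(1|2))$ be the semisimplification functor, i.e. the quotient by the tensor ideal of negligible morphisms ($f:C_1\to C_2$ is negligible if $\mathrm{tr}(g\circ f)=0$ for all $g:C_2\to C_1$); in particular $S$ kills exactly the indecomposables of superdimension $0$. Here $OSp(1|2)$ is the connected group of automorphisms of $\mathbf{k}^{1|2}$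 preserving a non-degenerate (super)symmetric form and of Berezinian $1$. Define $\Phi_x=S\circ R_x:\mathrm{Rep}(G)\to\mathrm{Rep}(OSp(1|2))$ and, for $M\in\mathrm{Rep}(G)$, $$\mathrm{supp}(M)=\{x\in\mathfrak{g}_{\bar 1}\mid\Phi_x(M)\neq 0\}.$$ An odd nilpotent operator on a finite-dimensional superspace $V$ makes $V$ a representation of the supergroup $\mathbb{G}_a^{(1|1)}$ (the $(1|1)$-dimensional supergroup with even part $\mathbb{G}_a$ and Lie superalgebra with basis $x,[x,x]$, $x$ odd, $[x,[x,x]]=0$); it acts neatly if all indecomposable direct summands of this module have non-zero superdimension. An element $x\in\mathfrak{g}_{\bar 1}$ is nilpotent if it acts nilpotently on every finite-dimensional representation of $G$; $\mathfrak{g}_{neat}$ is the set of nilpotent $x\in\mathfrak{g}_{\bar 1}$ acting neatly on every finite-dimensional representation of $G$. *)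

theory Defs
  imports
    "HOL-Library.Poly_Mapping"
    "HOL-Computational_Algebra.Polynomial"
    "Jordan_Normal_Form.Matrix"
begin

text \<open>
  Vector superspaces are presented by a homogeneous basis. The superspace with basis the type
  \<open>'i\<close> and parity function \<open>'i \<Rightarrow> bool\<close> (\<open>True\<close> meaning odd) has the underlying vector space
  \<open>'i \<Rightarrow>\<^sub>0 'k\<close>; the tensor product of two such spaces has basis \<open>'i \<times> 'j\<close>, and a linear map is
  given by the images of the basis vectors. As every superspace has a homogeneous basis and the
  type \<open>'i\<close> is arbitrary, nothing is lost.
\<close>

definition ksign :: "bool \<Rightarrow> 'k::comm_ring_1" where
  "ksign b = (if b then - 1 else 1)"

definition bvec :: "'i \<Rightarrow> ('i \<Rightarrow>\<^sub>0 'k::comm_ring_1)" where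
  "bvec i = Poly_Mapping.single i 1"

definition smul :: "'k::comm_ring_1 \<Rightarrow> ('i \<Rightarrow>\<^sub>0 'k) \<Rightarrow> ('i \<Rightarrow>\<^sub>0 'k)" where
  "smul c u = Poly_Mapping.map (\<lambda>a. c * a) u"

definition lin :: "('i \<Rightarrow> ('j \<Rightarrow>\<^sub>0 'k)) \<Rightarrow> ('i \<Rightarrow>\<^sub>0 'k::comm_ring_1) \<Rightarrow> ('j \<Rightarrow>\<^sub>0 'k)" where
  "lin f u = (\<Sum>i\<in>Poly_Mapping.keys u. smul (Poly_Mapping.lookup u i) (f i))"

definition linform :: "('i \<Rightarrow> 'k) \<Rightarrow> ('i \<Rightarrow>\<^sub>0 'k::comm_ring_1) \<Rightarrow> 'k" where
  "linform f u = (\<Sum>i\<in>Poly_Mapping.keys u. Poly_Mapping.lookup u i * f i)"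

definition tens :: "('i \<Rightarrow>\<^sub>0 'k) \<Rightarrow> ('j \<Rightarrow>\<^sub>0 'k::comm_ring_1) \<Rightarrow> ('i \<times> 'j \<Rightarrow>\<^sub>0 'k)" where
  "tens u v = (\<Sum>i\<in>Poly_Mapping.keys u. \<Sum>j\<in>Poly_Mapping.keys v.
     Poly_Mapping.single (i, j) (Poly_Mapping.lookup u i * Poly_Mapping.lookup v j))"

text \<open>
  An affine algebraic supergroup \<open>G\<close> is given by its coordinate Hopf superalgebra \<open>k[G]\<close>,
  a finitely generated supercommutative Hopf superalgebra.
\<close>

record (overloaded) ('i, 'k) hopf_super =
  hodd :: "'i \<Rightarrow> bool"
  hmul :: "'i \<times> 'i \<Rightarrow> ('i \<Rightarrow>\<^sub>0 'k)"
  hone :: "'i \<Rightarrow>\<^sub>0 'k"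
  hcomul :: "'i \<Rightarrow> ('i \<times> 'i \<Rightarrow>\<^sub>0 'k)"
  hcounit :: "'i \<Rightarrow> 'k"
  hantip :: "'i \<Rightarrow> ('i \<Rightarrow>\<^sub>0 'k)"

definition hprod :: "('i, 'k::comm_ring_1) hopf_super \<Rightarrow> ('i \<Rightarrow>\<^sub>0 'k) \<Rightarrow> ('i \<Rightarrow>\<^sub>0 'k) \<Rightarrow> ('i \<Rightarrow>\<^sub>0 'k)" where
  "hprod G u v = lin (hmul G) (tens u v)"

text \<open>The product of \<open>k[G] \<otimes> k[G]\<close>, on basis vectors: \<open>(a \<otimes> b)(c \<otimes> d) = (-1)\<^bsup>|b||c|\<^esup> ac \<otimes> bd\<close>.\<close>

definition hprod2 :: "('i, 'k::comm_ring_1) hopf_super \<Rightarrow>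
    ('i \<times> 'i \<Rightarrow>\<^sub>0 'k) \<Rightarrow> ('i \<times> 'i \<Rightarrow>\<^sub>0 'k) \<Rightarrow> ('i \<times> 'i \<Rightarrow>\<^sub>0 'k)" where
  "hprod2 G u v = lin (\<lambda>((a, b), (c, d)).
     smul (ksign (hodd G b \<and> hodd G c)) (tens (hmul G (a, c)) (hmul G (b, d)))) (tens u v)"

definition even_structure :: "('i, 'k::comm_ring_1) hopf_super \<Rightarrow> bool" where
  "even_structure G \<longleftrightarrow>
     (\<forall>i j. \<forall>l\<in>Poly_Mapping.keys (hmul G (i, j)). hodd G l \<longleftrightarrow> hodd G i \<noteq> hodd G j) \<and>
     (\<forall>l\<in>Poly_Mapping.keys (hone G). \<not> hodd G l) \<and>
     (\<forall>i. \<forall>(j, l)\<in>Poly_Mapping.keys (hcomul G i). hodd G i \<longleftrightarrow> hodd G j \<noteq> hodd G l) \<and>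
     (\<forall>i. hcounit G i \<noteq> 0 \<longrightarrow> \<not> hodd G i) \<and>
     (\<forall>i. \<forall>l\<in>Poly_Mapping.keys (hantip G i). hodd G l \<longleftrightarrow> hodd G i)"

definition supercomm_algebra :: "('i, 'k::comm_ring_1) hopf_super \<Rightarrow> bool" where
  "supercomm_algebra G \<longleftrightarrow>
     (\<forall>i j l. hprod G (hmul G (i, j)) (bvec l) = hprod G (bvec i) (hmul G (j, l))) \<and>
     (\<forall>i. hprod G (hone G) (bvec i) = bvec i \<and> hprod G (bvec i) (hone G) = bvec i) \<and>
     (\<forall>i j. hmul G (i, j) = smul (ksign (hodd G i \<and> hodd G j)) (hmul G (j, i)))"

definition coalgebra :: "('i, 'k::comm_ring_1) hopf_super \<Rightarrow> bool" where
  "coalgebra G \<longleftrightarrow>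
     (\<forall>i. lin (\<lambda>((a, b), c). bvec (a, (b, c)))
            (lin (\<lambda>(j, l). tens (hcomul G j) (bvec l)) (hcomul G i))
          = lin (\<lambda>(j, l). tens (bvec j) (hcomul G l)) (hcomul G i)) \<and>
     (\<forall>i. lin (\<lambda>(j, l). smul (hcounit G j) (bvec l)) (hcomul G i) = bvec i) \<and>
     (\<forall>i. lin (\<lambda>(j, l). smul (hcounit G l) (bvec j)) (hcomul G i) = bvec i)"

definition bialgebra_compat :: "('i, 'k::comm_ring_1) hopf_super \<Rightarrow> bool" where
  "bialgebra_compat G \<longleftrightarrow>
     lin (hcomul G) (hone G) = tens (hone G) (hone G) \<and>
     linform (hcounit G) (hone G) = 1 \<and>
     (\<forall>i j. lin (hcomul G) (hmul G (i, j)) = hprod2 G (hcomul G i) (hcomul G j)) \<and>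
     (\<forall>i j. linform (hcounit G) (hmul G (i, j)) = hcounit G i * hcounit G j)"

definition antipode_axiom :: "('i, 'k::comm_ring_1) hopf_super \<Rightarrow> bool" where
  "antipode_axiom G \<longleftrightarrow>
     (\<forall>i. lin (\<lambda>(j, l). hprod G (hantip G j) (bvec l)) (hcomul G i) = smul (hcounit G i) (hone G)) \<and>
     (\<forall>i. lin (\<lambda>(j, l). hprod G (bvec j) (hantip G l)) (hcomul G i) = smul (hcounit G i) (hone G))"

inductive_set subalgebra_gen ::
    "('i, 'k::comm_ring_1) hopf_super \<Rightarrow> ('i \<Rightarrow>\<^sub>0 'k) set \<Rightarrow> ('i \<Rightarrow>\<^sub>0 'k) set"
  for G F where
    gen: "u \<in> F \<Longrightarrow> u \<in> subalgebra_gen G F"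
  | one: "hone G \<in> subalgebra_gen G F"
  | add: "u \<in> subalgebra_gen G F \<Longrightarrow> v \<in> subalgebra_gen G F \<Longrightarrow> u + v \<in> subalgebra_gen G F"
  | scale: "u \<in> subalgebra_gen G F \<Longrightarrow> smul c u \<in> subalgebra_gen G F"
  | mul: "u \<in> subalgebra_gen G F \<Longrightarrow> v \<in> subalgebra_gen G F \<Longrightarrow> hprod G u v \<in> subalgebra_gen G F"

definition algebraic_supergroup :: "('i, 'k::field) hopf_super \<Rightarrow> bool" where
  "algebraic_supergroup G \<longleftrightarrow>
     even_structure G \<and> supercomm_algebra G \<and> coalgebra G \<and> bialgebra_compat G \<and>
     antipode_axiom G \<and> (\<exists>F. finite F \<and> subalgebra_gen G F = UNIV)"

text \<open>
  The odd part of the Lie superalgebra \<open>\<gg> = T\<^sub>1 G\<close>: odd linear forms \<open>x\<close> on \<open>k[G]\<close> with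
  \<open>x(ab) = x(a)\<epsilon>(b) + (-1)\<^bsup>|a|\<^esup> \<epsilon>(a)x(b)\<close>.
\<close>

definition lie_odd :: "('i, 'k::field) hopf_super \<Rightarrow> ('i \<Rightarrow> 'k) set" where
  "lie_odd G = {x. (\<forall>i. x i \<noteq> 0 \<longrightarrow> hodd G i) \<and>
     (\<forall>i j. linform x (hmul G (i, j)) =
        x i * hcounit G j + ksign (hodd G i) * hcounit G i * x j)}"

text \<open>
  A finite-dimensional superspace has basis \<open>{..<vdim V}\<close>; the values of \<open>vodd V\<close> outside this
  set are irrelevant.
\<close>

record sspace =
  vdim :: nat
  vodd :: "nat \<Rightarrow> bool"

definition superdim :: "'b sspace_scheme \<Rightarrow> int" where
  "superdim V = int (card {i. i < vdim V \<and> \<not> vodd V i}) - int (card {i. i < vdim V \<and> vodd V i})"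

definition even_maps :: "'b sspace_scheme \<Rightarrow> 'c sspace_scheme \<Rightarrow> 'k::field mat set" where
  "even_maps V W = {T \<in> carrier_mat (vdim W) (vdim V).
     \<forall>i < vdim W. \<forall>j < vdim V. T $$ (i, j) \<noteq> 0 \<longrightarrow> vodd W i = vodd V j}"

definition odd_ops :: "'b sspace_scheme \<Rightarrow> 'k::field mat set" where
  "odd_ops V = {T \<in> carrier_mat (vdim V) (vdim V).
     \<forall>i < vdim V. \<forall>j < vdim V. T $$ (i, j) \<noteq> 0 \<longrightarrow> vodd V i \<noteq> vodd V j}"

definition supertrace :: "'b sspace_scheme \<Rightarrow> 'k::field mat \<Rightarrow> 'k" where
  "supertrace V T = (\<Sum>i<vdim V. ksign (vodd V i) * T $$ (i, i))"

text \<open>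
  A representation is a right comodule, with coaction
  \<open>v\<^sub>j \<mapsto> \<Sum>\<^sub>i v\<^sub>i \<otimes> vcoef M i j\<close> on basis vectors.
\<close>

record (overloaded) ('i, 'k) grep = sspace +
  vcoef :: "nat \<Rightarrow> nat \<Rightarrow> ('i \<Rightarrow>\<^sub>0 'k)"

definition Rep :: "('i, 'k::field) hopf_super \<Rightarrow> ('i, 'k) grep set" where
  "Rep G = {M.
     (\<forall>i < vdim M. \<forall>j < vdim M. \<forall>l\<in>Poly_Mapping.keys (vcoef M i j).
        hodd G l \<longleftrightarrow> vodd M i \<noteq> vodd M j) \<and>
     (\<forall>i < vdim M. \<forall>j < vdim M.
        lin (hcomul G) (vcoef M i j) = (\<Sum>l<vdim M. tens (vcoef M i l) (vcoef M l j))) \<and>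
     (\<forall>i < vdim M. \<forall>j < vdim M. linform (hcounit G) (vcoef M i j) = (if i = j then 1 else 0))}"

definition ghom :: "('i, 'k::field) grep \<Rightarrow> ('i, 'k) grep \<Rightarrow> 'k mat set" where
  "ghom M N = {T \<in> even_maps M N. \<forall>l < vdim N. \<forall>j < vdim M.
     (\<Sum>i<vdim M. smul (T $$ (l, i)) (vcoef M i j)) = (\<Sum>i<vdim N. smul (T $$ (i, j)) (vcoef N l i))}"

definition surj_mat :: "'k::field mat \<Rightarrow> bool" where
  "surj_mat T \<longleftrightarrow> (\<lambda>v. T *\<^sub>v v) ` carrier_vec (dim_col T) = carrier_vec (dim_row T)"

definition projective_rep :: "('i, 'k::field) hopf_super \<Rightarrow> ('i, 'k) grep \<Rightarrow> bool" where
  "projective_rep G P \<longleftrightarrow> P \<in> Rep G \<and>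
     (\<forall>M\<in>Rep G. \<forall>N\<in>Rep G. \<forall>e\<in>ghom M N. \<forall>f\<in>ghom P N.
        surj_mat e \<longrightarrow> (\<exists>h\<in>ghom P M. e * h = f))"

record 'k mrep = sspace +
  vop :: "'k mat"

definition Rep_m :: "'k::field mrep set" where
  "Rep_m = {C. vop C \<in> odd_ops C}"

definition mhom :: "'k::field mrep \<Rightarrow> 'k mrep \<Rightarrow> 'k mat set" where
  "mhom C D = {T \<in> even_maps C D. T * vop C = vop D * T}"

definition negligible :: "'k::field mrep \<Rightarrow> 'k mrep \<Rightarrow> 'k mat \<Rightarrow> bool" where
  "negligible C D f \<longleftrightarrow> f \<in> mhom C D \<and> (\<forall>g\<in>mhom D C. supertrace C (g * f) = 0)"

text \<open>
  The semisimplification has the objects of Rep(m), and its morphisms are the morphisms of Rep(m)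
  modulo the negligible ones; the functor \<open>S\<close> is the identity on objects.
\<close>

definition ss_hom :: "'k::field mrep \<Rightarrow> 'k mrep \<Rightarrow> 'k mat set set" where
  "ss_hom C D = mhom C D //
     {(f, g). f \<in> mhom C D \<and> g \<in> mhom C D \<and> negligible C D (f - g)}"

definition ss_zero_object :: "'k::field mrep \<Rightarrow> bool" where
  "ss_zero_object C \<longleftrightarrow>
     (\<forall>D\<in>Rep_m. (\<exists>!h. h \<in> ss_hom C D) \<and> (\<exists>!h. h \<in> ss_hom D C))"

text \<open>
  An odd \<open>x \<in> \<gg>\<close> acts on a representation by \<open>(id \<otimes> x)\<close> after the coaction; the sign is the
  Koszul sign of moving \<open>x\<close> past \<open>v\<^sub>i\<close>.
\<close>

definition restrict_m :: "('i \<Rightarrow> 'k::field) \<Rightarrow> ('i, 'k) grep \<Rightarrow> 'k mrep" where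
  "restrict_m x M = \<lparr>vdim = vdim M, vodd = vodd M,
     vop = mat (vdim M) (vdim M) (\<lambda>(i, j). ksign (vodd M i) * linform x (vcoef M i j))\<rparr>"

definition supp :: "('i, 'k::field) hopf_super \<Rightarrow> ('i, 'k) grep \<Rightarrow> ('i \<Rightarrow> 'k) set" where
  "supp G M = {x \<in> lie_odd G. \<not> ss_zero_object (restrict_m x M)}"

definition msum :: "'k::field mrep \<Rightarrow> 'k mrep \<Rightarrow> 'k mrep" where
  "msum C D = \<lparr>vdim = vdim C + vdim D,
     vodd = (\<lambda>i. if i < vdim C then vodd C i else vodd D (i - vdim C)),
     vop = four_block_mat (vop C) (0\<^sub>m (vdim C) (vdim D)) (0\<^sub>m (vdim D) (vdim C)) (vop D)\<rparr>"

definition miso :: "'k::field mrep \<Rightarrow> 'k mrep \<Rightarrow> bool" where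
  "miso C D \<longleftrightarrow> (\<exists>f\<in>mhom C D. \<exists>g\<in>mhom D C. g * f = 1\<^sub>m (vdim C) \<and> f * g = 1\<^sub>m (vdim D))"

definition indecomposable :: "'k::field mrep \<Rightarrow> bool" where
  "indecomposable C \<longleftrightarrow> vdim C \<noteq> 0 \<and>
     (\<forall>D\<in>Rep_m. \<forall>E\<in>Rep_m. miso C (msum D E) \<longrightarrow> vdim D = 0 \<or> vdim E = 0)"

definition nilpotent_op :: "'k::field mrep \<Rightarrow> bool" where
  "nilpotent_op C \<longleftrightarrow> (\<exists>n. vop C ^\<^sub>m n = 0\<^sub>m (vdim C) (vdim C))"

text \<open>
  Representations of the supergroup \<open>\<bbbG>\<^sub>a\<^bsup>(1|1)\<^esup>\<close> are the objects of Rep(m) with nilpotent operator.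
  This subcategory is closed under direct summands, so decompositions may be taken in Rep(m).
\<close>

definition acts_neatly :: "'k::field mrep \<Rightarrow> bool" where
  "acts_neatly C \<longleftrightarrow> nilpotent_op C \<and>
     (\<forall>D\<in>Rep_m. \<forall>E\<in>Rep_m. miso C (msum D E) \<and> indecomposable D \<longrightarrow> superdim D \<noteq> 0)"

definition nilpotent_elem :: "('i, 'k::field) hopf_super \<Rightarrow> ('i \<Rightarrow> 'k) \<Rightarrow> bool" where
  "nilpotent_elem G x \<longleftrightarrow> (\<forall>M\<in>Rep G. nilpotent_op (restrict_m x M))"

definition lie_neat :: "('i, 'k::field) hopf_super \<Rightarrow> ('i \<Rightarrow> 'k) set" where
  "lie_neat G = {x \<in> lie_odd G. nilpotent_elem G x \<and> (\<forall>M\<in>Rep G. acts_neatly (restrict_m x M))}"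

end

theory Submission
  imports Defs "HOL-Combinatorics.Permutations" "Jordan_Normal_Form.Char_Poly"
    "Jordan_Normal_Form.Determinant"
begin

text \<open>An object of Rep(m) becomes zero in the semisimplification exactly when all its endomorphisms
have supertrace zero (\<open>ss_zero_object_iff\<close>). So the claim is that \<open>P\<close>, as an object
of Rep(m), has an endomorphism of nonzero supertrace if and only if \<open>x\<close> is neat.

If \<open>x\<close> is neat, take a nonzero summand of \<open>P\<close> of least dimension. It is indecomposable, hence of
nonzero superdimension, and this superdimension is the supertrace of the projection to it
(\<open>neat_supertrace\<close>).

Conversely, suppose that \<open>x\<close> does not act neatly on some representation \<open>M\<close>. Then \<open>M\<close> has, as an
object of Rep(m), a nonzero summand on which all supertraces vanish
(\<open>not_neat_negligible_summand\<close>): if \<open>x\<close> is not nilpotent on \<open>M\<close>, the part where \<open>x\<close> is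
invertible, because cyclicity of the supertrace picks up a sign for odd operators; otherwise an
indecomposable summand of superdimension zero, because its endomorphisms are scalars plus
nilpotents. For the purpose of supertraces \<open>M\<close> may be replaced by the complement \<open>N\<close> of that
summand, whose dimension \<open>d\<close> is smaller, and \<open>M\<^bsup>\<otimes>k\<^esup>\<close> by \<open>N\<^bsup>\<otimes>k\<^esup>\<close> (\<open>carries_strace_tensor\<close>).
For large \<open>k\<close> the dimension of \<open>T = M\<^bsup>\<otimes>k\<^esup>\<close> exceeds \<open>2 d\<^sup>k\<close>, so at least \<open>s = d\<^sup>k + 1\<close> basis vectors of
\<open>T\<close> have the same parity. Now let the Young symmetrizer of the square of side \<open>s\<close> act on
\<open>W = T\<^bsup>\<otimes>s\<^sup>2\<^esup>\<close>. It is equivariant. It is not zero, as the square can be filled with \<open>s\<close> letters of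
equal parity, one for each row (\<open>young_nonzero\<close>). But it vanishes on the corresponding power of
\<open>N\<^bsup>\<otimes>k\<^esup>\<close>: whenever fewer than \<open>s\<close> letters fill the square, some letter occurs twice in a row and
twice in a column (\<open>young_eq_0\<close>), and one of these repetitions meets an antisymmetrization.
Hence this nonzero equivariant endomorphism \<open>E\<close> of \<open>W\<close> is negligible over Rep(m)
(\<open>exists_negligible_endo\<close>).

The pairing of \<open>W\<^sup>*\<close> with \<open>W\<close> defined by \<open>E\<close> is an equivariant map onto the trivial representation.
Tensored with \<open>P\<close> it becomes a surjection onto \<open>P\<close>, which splits since \<open>P\<close> is projective. So every
endomorphism of \<open>P\<close> over Rep(m) factors through a negligible map, and its supertrace, rewritten
as a supertrace of \<open>E\<close> composed with an endomorphism of \<open>W\<close>, is zero (\<open>projective_strace_zero\<close>).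

The bases of tensor products, duals and tensor powers are pairs and words. The part of the proof
that deals with them therefore treats matrices as functions on arbitrary finite index sets; matrices
in the sense of \<open>'k mat\<close> appear where decompositions in Rep(m) are discussed.\<close>

section \<open>Linear algebra over a homogeneous basis\<close>

lemma ksign_simps [simp]: "ksign True = (- 1 :: 'k::comm_ring_1)" "ksign False = (1 :: 'k::comm_ring_1)"
  by (simp_all add: ksign_def)

lemma ksign_sq [simp]: "ksign b * ksign b = (1 :: 'k::comm_ring_1)"
  "ksign b * (ksign b * y) = (y :: 'k::comm_ring_1)"
  by (cases b; simp)+

lemma lookup_smul [simp]: "Poly_Mapping.lookup (smul c u) i = c * Poly_Mapping.lookup u i"
  unfolding smul_def by (simp add: Poly_Mapping.map.rep_eq when_def)

lemma lookup_bvec: "Poly_Mapping.lookup (bvec i) j = (if i = j then 1 else 0)"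
  unfolding bvec_def by (simp add: lookup_single when_def)

lemma smul_simps [simp]:
  "smul 1 u = u" "smul 0 u = 0" "smul c 0 = 0"
  "smul c (smul d u) = smul (c * d) u"
  "smul c (u + v) = smul c u + smul c v"
  by (rule poly_mapping_eqI; simp add: lookup_add algebra_simps)+

lemma smul_add_left: "smul (c + d) u = smul c u + smul d u"
  by (rule poly_mapping_eqI; simp add: lookup_add algebra_simps)

lemma lookup_sum': "Poly_Mapping.lookup (\<Sum>a\<in>A. f a) i = (\<Sum>a\<in>A. Poly_Mapping.lookup (f a) i)"
  by (induction A rule: infinite_finite_induct) (auto simp: lookup_add)

lemma smul_sum: "smul c (\<Sum>a\<in>A. f a) = (\<Sum>a\<in>A. smul c (f a))"
  by (induction A rule: infinite_finite_induct) auto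

lemma smul_sum_left: "smul (\<Sum>a\<in>A. f a) u = (\<Sum>a\<in>A. smul (f a) u)"
  by (induction A rule: infinite_finite_induct) (auto simp: smul_add_left)

lemma expand_bvec:
  assumes "finite S" "Poly_Mapping.keys u \<subseteq> S"
  shows "u = (\<Sum>i\<in>S. smul (Poly_Mapping.lookup u i) (bvec i))"
proof (rule poly_mapping_eqI)
  fix j
  have "(\<Sum>i\<in>S. Poly_Mapping.lookup u i * Poly_Mapping.lookup (bvec i) j) =
        (\<Sum>i\<in>S. if i = j then Poly_Mapping.lookup u j else 0)"
    by (rule sum.cong) (auto simp: lookup_bvec)
  also have "\<dots> = Poly_Mapping.lookup u j"
    using assms by (auto simp: in_keys_iff)
  finally show "Poly_Mapping.lookup u j =
      Poly_Mapping.lookup (\<Sum>i\<in>S. smul (Poly_Mapping.lookup u i) (bvec i)) j"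
    by (simp add: lookup_sum')
qed

definition klin :: "(('i \<Rightarrow>\<^sub>0 'k::comm_ring_1) \<Rightarrow> ('j \<Rightarrow>\<^sub>0 'k)) \<Rightarrow> bool" where
  "klin f \<longleftrightarrow> (\<forall>u v. f (u + v) = f u + f v) \<and> (\<forall>c u. f (smul c u) = smul c (f u))"

lemma klinI:
  assumes "\<And>u v. f (u + v) = f u + f v" "\<And>c u. f (smul c u) = smul c (f u)"
  shows "klin f"
  using assms unfolding klin_def by blast

lemma klin_add: "klin f \<Longrightarrow> f (u + v) = f u + f v"
  and klin_smul: "klin f \<Longrightarrow> f (smul c u) = smul c (f u)"
  unfolding klin_def by blast+

lemma klin_zero: "klin f \<Longrightarrow> f 0 = 0"
  using klin_smul[of f 0 0] by simp

lemma klin_sum: "klin f \<Longrightarrow> f (\<Sum>a\<in>A. g a) = (\<Sum>a\<in>A. f (g a))"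
  by (induction A rule: infinite_finite_induct) (auto simp: klin_add klin_zero)

lemma klin_comp: "klin f \<Longrightarrow> klin g \<Longrightarrow> klin (\<lambda>u. f (g u))"
  by (rule klinI) (simp_all add: klin_add klin_smul)

lemma klin_smul_fun: "klin f \<Longrightarrow> klin (\<lambda>u. smul c (f u))"
  by (rule klinI) (simp_all add: klin_add klin_smul mult.commute)

text \<open>Identities between multilinear expressions are proved on basis vectors
throughout; this lemma and its variants below for several arguments, for scalar values and for
homogeneous arguments carry out the extension.\<close>

lemma klin_eq_on_keys:
  assumes "klin f" "klin g" "\<And>i. i \<in> Poly_Mapping.keys u \<Longrightarrow> f (bvec i) = g (bvec i)"
  shows "f u = g u"
proof -
  have e: "u = (\<Sum>i\<in>Poly_Mapping.keys u. smul (Poly_Mapping.lookup u i) (bvec i))"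
    by (rule expand_bvec) auto
  have "f (\<Sum>i\<in>Poly_Mapping.keys u. smul (Poly_Mapping.lookup u i) (bvec i)) =
        g (\<Sum>i\<in>Poly_Mapping.keys u. smul (Poly_Mapping.lookup u i) (bvec i))"
    by (simp add: klin_sum[OF assms(1)] klin_sum[OF assms(2)] klin_smul[OF assms(1)]
        klin_smul[OF assms(2)] assms(3) cong: sum.cong)
  with e show ?thesis by simp
qed

lemma bilinear_eqI:
  assumes "\<And>v. klin (\<lambda>u. f u v)" "\<And>u. klin (f u)" "\<And>v. klin (\<lambda>u. g u v)" "\<And>u. klin (g u)"
    and "\<And>i j. f (bvec i) (bvec j) = g (bvec i) (bvec j)"
  shows "f u v = g u v"
proof -
  have "f (bvec i) v = g (bvec i) v" for i by (rule klin_eq_on_keys[OF assms(2,4,5)])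
  thus ?thesis by (rule klin_eq_on_keys[OF assms(1,3)])
qed

lemma trilinear_eqI:
  assumes "\<And>v w. klin (\<lambda>u. f u v w)" "\<And>u w. klin (\<lambda>v. f u v w)" "\<And>u v. klin (f u v)"
    and "\<And>v w. klin (\<lambda>u. g u v w)" "\<And>u w. klin (\<lambda>v. g u v w)" "\<And>u v. klin (g u v)"
    and "\<And>i j l. f (bvec i) (bvec j) (bvec l) = g (bvec i) (bvec j) (bvec l)"
  shows "f u v w = g u v w"
proof -
  have "f (bvec i) v w = g (bvec i) v w" for i
    by (rule bilinear_eqI[of "f (bvec i)" "g (bvec i)"]) (rule assms)+
  thus ?thesis by (rule klin_eq_on_keys[OF assms(1,4)])
qed

lemma lin_superset:
  assumes "finite S" "Poly_Mapping.keys u \<subseteq> S"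
  shows "lin f u = (\<Sum>i\<in>S. smul (Poly_Mapping.lookup u i) (f i))"
  unfolding lin_def
  by (rule sum.mono_neutral_left) (use assms in \<open>auto simp: in_keys_iff\<close>)

lemma klin_lin: "klin (lin f)"
proof (rule klinI)
  fix u v :: "'a \<Rightarrow>\<^sub>0 'b"
  let ?S = "Poly_Mapping.keys u \<union> Poly_Mapping.keys v"
  show "lin f (u + v) = lin f u + lin f v"
    using keys_add[of u v]
    by (simp add: lin_superset[of ?S] lookup_add smul_add_left sum.distrib)
next
  fix c and u :: "'a \<Rightarrow>\<^sub>0 'b"
  have "Poly_Mapping.keys (smul c u) \<subseteq> Poly_Mapping.keys u" by (auto simp: in_keys_iff)
  thus "lin f (smul c u) = smul c (lin f u)"
    by (simp add: lin_superset[of "Poly_Mapping.keys u"] smul_sum)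
qed

lemma keys_bvec: "Poly_Mapping.keys (bvec i :: 'i \<Rightarrow>\<^sub>0 'k::field) = {i}"
  unfolding bvec_def by simp

lemma lin_bvec [simp]: "lin f (bvec i :: 'i \<Rightarrow>\<^sub>0 'k::field) = f i"
  unfolding lin_def by (simp add: keys_bvec lookup_bvec)

lemmas lin_simps = klin_add[OF klin_lin] klin_smul[OF klin_lin] klin_sum[OF klin_lin]
  klin_zero[OF klin_lin]

lemma linform_superset:
  assumes "finite S" "Poly_Mapping.keys u \<subseteq> S"
  shows "linform f u = (\<Sum>i\<in>S. Poly_Mapping.lookup u i * f i)"
  unfolding linform_def
  by (rule sum.mono_neutral_left) (use assms in \<open>auto simp: in_keys_iff\<close>)

lemma linform_add: "linform f (u + v) = linform f u + linform f v"
proof -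
  let ?S = "Poly_Mapping.keys u \<union> Poly_Mapping.keys v"
  show ?thesis using keys_add[of u v]
    by (simp add: linform_superset[of ?S] lookup_add distrib_right sum.distrib)
qed

lemma linform_smul: "linform f (smul c u) = c * linform f u"
proof -
  have "Poly_Mapping.keys (smul c u) \<subseteq> Poly_Mapping.keys u" by (auto simp: in_keys_iff)
  thus ?thesis
    by (simp add: linform_superset[of "Poly_Mapping.keys u"] sum_distrib_left mult.assoc)
qed

lemma linform_bvec [simp]: "linform f (bvec i :: 'i \<Rightarrow>\<^sub>0 'k::field) = f i"
  unfolding linform_def by (simp add: keys_bvec lookup_bvec)

lemma linform_0 [simp]: "linform f 0 = 0"
  unfolding linform_def by simp

lemma linform_sum: "linform f (\<Sum>a\<in>A. g a) = (\<Sum>a\<in>A. linform f (g a))"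
  by (induction A rule: infinite_finite_induct) (auto simp: linform_add)

text \<open>Scalar-valued forms are linear maps to the one-dimensional space, so that the extension
  principle for \<open>klin\<close> applies to them too.\<close>

lemma klin_single: "klin (\<lambda>u. Poly_Mapping.single () (f u))"
  if "\<And>u v. f (u + v) = f u + f v" "\<And>c u. f (smul c u) = c * f u"
  by (rule klinI; rule poly_mapping_eqI) (simp_all add: that lookup_add)

lemma form_eq_on_keys:
  assumes "\<And>u v. f (u + v) = f u + f v" "\<And>c u. f (smul c u) = c * f u"
    and "\<And>u v. g (u + v) = g u + g v" "\<And>c u. g (smul c u) = c * g u"
    and "\<And>i. i \<in> Poly_Mapping.keys u \<Longrightarrow> f (bvec i) = g (bvec i)"
  shows "f u = g u"
proof -
  have "Poly_Mapping.single () (f u) = Poly_Mapping.single () (g u)"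
    by (rule klin_eq_on_keys[OF klin_single klin_single]) (simp_all add: assms)
  thus ?thesis by (metis lookup_single_eq)
qed

lemma bilinear_form_eqI:
  assumes "\<And>u u' v. f (u + u') v = f u v + f u' v" "\<And>c u v. f (smul c u) v = c * f u v"
    and "\<And>u v v'. f u (v + v') = f u v + f u v'" "\<And>c u v. f u (smul c v) = c * f u v"
    and "\<And>u u' v. g (u + u') v = g u v + g u' v" "\<And>c u v. g (smul c u) v = c * g u v"
    and "\<And>u v v'. g u (v + v') = g u v + g u v'" "\<And>c u v. g u (smul c v) = c * g u v"
    and "\<And>i j. f (bvec i) (bvec j) = g (bvec i) (bvec j)"
  shows "f u v = g u v"
proof -
  have "f (bvec i) v = g (bvec i) v" for i
    by (rule form_eq_on_keys[of "f (bvec i)" "g (bvec i)"]) (rule assms)+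
  thus ?thesis by (rule form_eq_on_keys[OF assms(1,2,5,6)])
qed

lemma lookup_tens [simp]:
  "Poly_Mapping.lookup (tens u v) (i, j) = Poly_Mapping.lookup u i * Poly_Mapping.lookup v j"
proof -
  have "Poly_Mapping.lookup (tens u v) (i, j) =
    (\<Sum>a\<in>Poly_Mapping.keys u. \<Sum>b\<in>Poly_Mapping.keys v.
       (if a = i then if b = j then Poly_Mapping.lookup u i * Poly_Mapping.lookup v j else 0 else 0))"
    unfolding tens_def lookup_sum'
    by (intro sum.cong refl) (auto simp: lookup_single when_def)
  also have "\<dots> = (\<Sum>a\<in>Poly_Mapping.keys u. if a = i then
      (\<Sum>b\<in>Poly_Mapping.keys v. if b = j then Poly_Mapping.lookup u i * Poly_Mapping.lookup v j else 0) else 0)"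
    by (intro sum.cong refl) auto
  also have "\<dots> = Poly_Mapping.lookup u i * Poly_Mapping.lookup v j"
    by (auto simp: in_keys_iff)
  finally show ?thesis .
qed

lemma klin_tens_left: "klin (\<lambda>u. tens u v)" and klin_tens_right: "klin (\<lambda>v. tens u v)"
  by (rule klinI; rule poly_mapping_eqI; force simp: lookup_add algebra_simps)+

lemmas tens_simps =
  klin_add[OF klin_tens_left] klin_smul[OF klin_tens_left] klin_sum[OF klin_tens_left]
  klin_zero[OF klin_tens_left]
  klin_add[OF klin_tens_right] klin_smul[OF klin_tens_right] klin_sum[OF klin_tens_right]
  klin_zero[OF klin_tens_right]

lemma tens_bvec: "tens (bvec i) (bvec j) = (bvec (i, j) :: _ \<Rightarrow>\<^sub>0 'k::field)"
  by (rule poly_mapping_eqI) (auto simp: lookup_bvec split: prod.split if_splits)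

lemma lin_tens_bvec [simp]: "lin f (tens (bvec i) (bvec j) :: _ \<Rightarrow>\<^sub>0 'k::field) = f (i, j)"
  by (simp add: tens_bvec)

definition homog :: "('i, 'k::field) hopf_super \<Rightarrow> bool \<Rightarrow> ('i \<Rightarrow>\<^sub>0 'k) \<Rightarrow> bool" where
  "homog G b u \<longleftrightarrow> (\<forall>l\<in>Poly_Mapping.keys u. hodd G l = b)"

lemma homogD: "homog G b u \<Longrightarrow> Poly_Mapping.lookup u l \<noteq> 0 \<Longrightarrow> hodd G l = b"
  unfolding homog_def by (auto simp: in_keys_iff)

lemma homogI: "(\<And>l. Poly_Mapping.lookup u l \<noteq> 0 \<Longrightarrow> hodd G l = b) \<Longrightarrow> homog G b u"
  unfolding homog_def by (auto simp: in_keys_iff)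

lemma homog_bvec: "homog G (hodd G i) (bvec i)"
  by (rule homogI) (auto simp: lookup_bvec split: if_splits)

lemma homog_smul: "homog G b u \<Longrightarrow> homog G b (smul c u)"
  by (rule homogI) (auto dest: homogD)

lemma homog_zero: "homog G b 0"
  by (rule homogI) auto

lemma homog_add: "homog G b u \<Longrightarrow> homog G b v \<Longrightarrow> homog G b (u + v)"
  unfolding homog_def using keys_add[of u v] by blast

lemma homog_sum: "(\<And>a. a \<in> A \<Longrightarrow> homog G b (f a)) \<Longrightarrow> homog G b (\<Sum>a\<in>A. f a)"
  by (induction A rule: infinite_finite_induct) (auto simp: homog_zero homog_add)

lemma homog_eqI:
  assumes "klin f" "klin g" "homog G b u" "\<And>i. hodd G i = b \<Longrightarrow> f (bvec i) = g (bvec i)"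
  shows "f u = g u"
  by (rule klin_eq_on_keys[OF assms(1,2)]) (use assms(3,4) in \<open>auto simp: homog_def\<close>)

lemma klin_hprod_left: "klin (\<lambda>u. hprod G u v)" and klin_hprod_right: "klin (\<lambda>v. hprod G u v)"
  unfolding hprod_def by (intro klinI; simp add: tens_simps lin_simps)+

lemmas hprod_simps =
  klin_add[OF klin_hprod_left] klin_smul[OF klin_hprod_left] klin_sum[OF klin_hprod_left]
  klin_zero[OF klin_hprod_left]
  klin_add[OF klin_hprod_right] klin_smul[OF klin_hprod_right] klin_sum[OF klin_hprod_right]
  klin_zero[OF klin_hprod_right]

lemma hprod_bvec: "hprod G (bvec i) (bvec j) = (hmul G (i, j) :: _ \<Rightarrow>\<^sub>0 'k::field)"
  unfolding hprod_def by simp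

lemma klin_hprod2_left: "klin (\<lambda>u. hprod2 G u v)" and klin_hprod2_right: "klin (\<lambda>v. hprod2 G u v)"
  unfolding hprod2_def by (intro klinI; simp add: tens_simps lin_simps)+

lemmas hprod2_simps =
  klin_add[OF klin_hprod2_left] klin_smul[OF klin_hprod2_left] klin_sum[OF klin_hprod2_left]
  klin_zero[OF klin_hprod2_left]
  klin_add[OF klin_hprod2_right] klin_smul[OF klin_hprod2_right] klin_sum[OF klin_hprod2_right]
  klin_zero[OF klin_hprod2_right]

lemmas klin_intros = klin_comp[OF klin_hprod_left] klin_comp[OF klin_hprod_right]
  klin_comp[OF klin_hprod2_left] klin_comp[OF klin_hprod2_right] klin_comp[OF klin_tens_left]
  klin_comp[OF klin_tens_right] klin_comp[OF klin_lin] klin_smul_fun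

lemma klin_id: "klin (\<lambda>u. u)" by (rule klinI) auto

text \<open>The sign rule for \<open>(a \<otimes> b)(c \<otimes> d)\<close> holds for homogeneous \<open>b\<close> and \<open>c\<close> with
arbitrary \<open>a\<close> and \<open>d\<close>, since the sign sees only the two inner factors.\<close>

lemma hprod2_tens:
  fixes G :: "('i, 'k::field) hopf_super"
  assumes b: "homog G \<beta> b" and c: "homog G \<gamma> c"
  shows "hprod2 G (tens a b) (tens c d) =
    smul (ksign (\<beta> \<and> \<gamma>)) (tens (hprod G a c) (hprod G b d))"
proof (rule klin_eq_on_keys[of "\<lambda>a. hprod2 G (tens a b) (tens c d)"
      "\<lambda>a. smul (ksign (\<beta> \<and> \<gamma>)) (tens (hprod G a c) (hprod G b d))"])
  fix i
  show "hprod2 G (tens (bvec i) b) (tens c d) =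
    smul (ksign (\<beta> \<and> \<gamma>)) (tens (hprod G (bvec i) c) (hprod G b d))"
  proof (rule homog_eqI[of "\<lambda>b. hprod2 G (tens (bvec i) b) (tens c d)"
      "\<lambda>b. smul (ksign (\<beta> \<and> \<gamma>)) (tens (hprod G (bvec i) c) (hprod G b d))", OF _ _ b])
    fix j assume j: "hodd G j = \<beta>"
    show "hprod2 G (tens (bvec i) (bvec j)) (tens c d) =
      smul (ksign (\<beta> \<and> \<gamma>)) (tens (hprod G (bvec i) c) (hprod G (bvec j) d))"
    proof (rule homog_eqI[of "\<lambda>c. hprod2 G (tens (bvec i) (bvec j)) (tens c d)"
      "\<lambda>c. smul (ksign (\<beta> \<and> \<gamma>)) (tens (hprod G (bvec i) c) (hprod G (bvec j) d))", OF _ _ c])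
      fix k assume k: "hodd G k = \<gamma>"
      show "hprod2 G (tens (bvec i) (bvec j)) (tens (bvec k) d) =
        smul (ksign (\<beta> \<and> \<gamma>)) (tens (hprod G (bvec i) (bvec k)) (hprod G (bvec j) d))"
      proof (rule klin_eq_on_keys[of "\<lambda>d. hprod2 G (tens (bvec i) (bvec j)) (tens (bvec k) d)"
      "\<lambda>d. smul (ksign (\<beta> \<and> \<gamma>)) (tens (hprod G (bvec i) (bvec k)) (hprod G (bvec j) d))"])
        fix l
        show "hprod2 G (tens (bvec i) (bvec j)) (tens (bvec k) (bvec l)) =
          smul (ksign (\<beta> \<and> \<gamma>)) (tens (hprod G (bvec i) (bvec k)) (hprod G (bvec j) (bvec l)))"
          by (simp add: hprod2_def tens_bvec hprod_bvec j k)
      qed (intro klin_intros klin_id)+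
    qed (intro klin_intros klin_id)+
  qed (intro klin_intros klin_id)+
qed (intro klin_intros klin_id)+

section \<open>Hopf superalgebras\<close>

locale hopf =
  fixes G :: "('i, 'k::field) hopf_super"
  assumes G: "algebraic_supergroup G"
begin

lemma even_str: "even_structure G" and scalg: "supercomm_algebra G" and bialg: "bialgebra_compat G" and antip: "antipode_axiom G"
  using G unfolding algebraic_supergroup_def by auto

abbreviation prd (infixl "\<star>" 70) where "u \<star> v \<equiv> hprod G u v"
abbreviation prd2 (infixl "\<diamondop>" 70) where "u \<diamondop> v \<equiv> hprod2 G u v"
abbreviation unt ("\<I>") where "\<I> \<equiv> hone G"
abbreviation "\<Delta> \<equiv> lin (hcomul G)"
abbreviation "eps \<equiv> linform (hcounit G)"
abbreviation "antipode \<equiv> lin (hantip G)"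

lemma hprod_assoc: "(u \<star> v) \<star> w = u \<star> (v \<star> w)"
proof (rule trilinear_eqI[of "\<lambda>u v w. (u \<star> v) \<star> w" "\<lambda>u v w. u \<star> (v \<star> w)"])
  fix i j l show "(bvec i \<star> bvec j) \<star> bvec l = bvec i \<star> (bvec j \<star> bvec l)"
    using scalg unfolding hprod_bvec supercomm_algebra_def by blast
qed (intro klin_intros klin_id)+

lemma hone_left [simp]: "\<I> \<star> u = u"
  by (rule klin_eq_on_keys[OF klin_hprod_right klin_id])
     (use scalg in \<open>unfold supercomm_algebra_def, blast\<close>)

lemma hone_right [simp]: "u \<star> \<I> = u"
  by (rule klin_eq_on_keys[OF klin_hprod_left klin_id])
     (use scalg in \<open>unfold supercomm_algebra_def, blast\<close>)

lemma hprod_comm: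
  assumes u: "homog G \<alpha> u" and v: "homog G \<beta> v"
  shows "u \<star> v = smul (ksign (\<alpha> \<and> \<beta>)) (v \<star> u)"
proof (rule homog_eqI[of "\<lambda>u. u \<star> v" "\<lambda>u. smul (ksign (\<alpha> \<and> \<beta>)) (v \<star> u)", OF _ _ u])
  fix i assume i: "hodd G i = \<alpha>"
  show "bvec i \<star> v = smul (ksign (\<alpha> \<and> \<beta>)) (v \<star> bvec i)"
  proof (rule homog_eqI[of "\<lambda>v. bvec i \<star> v" "\<lambda>v. smul (ksign (\<alpha> \<and> \<beta>)) (v \<star> bvec i)", OF _ _ v])
    fix j assume j: "hodd G j = \<beta>"
    have "hmul G (i, j) = smul (ksign (hodd G i \<and> hodd G j)) (hmul G (j, i))"
      using scalg unfolding supercomm_algebra_def by blast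
    thus "bvec i \<star> bvec j = smul (ksign (\<alpha> \<and> \<beta>)) (bvec j \<star> bvec i)"
      by (simp add: hprod_bvec i j)
  qed (intro klin_intros klin_id)+
qed (intro klin_intros klin_id)+

lemma homog_hone: "homog G False \<I>"
  using even_str unfolding even_structure_def homog_def by auto

lemma homog_lin:
  assumes "homog G b u" "\<And>i. hodd G i = b \<Longrightarrow> homog G b' (f i)"
  shows "homog G b' (lin f u)"
  unfolding lin_def using assms by (intro homog_sum homog_smul) (auto simp: homog_def)

lemma homog_hprod:
  assumes "homog G \<alpha> u" "homog G \<beta> v"
  shows "homog G (\<alpha> \<noteq> \<beta>) (u \<star> v)"
proof -
  have "u \<star> v = lin (\<lambda>i. lin (\<lambda>j. hmul G (i, j)) v) u"
  proof (rule klin_eq_on_keys[of "\<lambda>u. u \<star> v" "lin (\<lambda>i. lin (\<lambda>j. hmul G (i, j)) v)"])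
    fix i show "bvec i \<star> v = lin (\<lambda>i. lin (\<lambda>j. hmul G (i, j)) v) (bvec i)"
      by (simp, rule klin_eq_on_keys[of "\<lambda>v. bvec i \<star> v" "lin (\<lambda>j. hmul G (i, j))"])
         (simp_all add: klin_hprod_right klin_lin hprod_bvec)
  qed (simp_all add: klin_hprod_left klin_lin)
  moreover have "homog G (\<alpha> \<noteq> \<beta>) (hmul G (i, j))" if "hodd G i = \<alpha>" "hodd G j = \<beta>" for i j
    using even_str that unfolding even_structure_def homog_def by auto
  ultimately show ?thesis
    by (simp only:) (intro homog_lin[OF assms(1)] homog_lin[OF assms(2)]; blast)
qed

lemma homog_antipode: "homog G \<alpha> u \<Longrightarrow> homog G \<alpha> (antipode u)"
  by (rule homog_lin[where b = \<alpha>], assumption) (use even_str in \<open>auto simp: even_structure_def homog_def\<close>)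

text \<open>The two bracketings of \<open>(a \<otimes> b)(c \<otimes> d)(e \<otimes> f)\<close> give the signs
\<open>|b||c| + (|b| + |d|)|e|\<close> and \<open>|d||e| + |b|(|c| + |e|)\<close>, which agree.\<close>

lemma hprod2_assoc: "(u \<diamondop> v) \<diamondop> w = u \<diamondop> (v \<diamondop> w)"
proof (rule trilinear_eqI[of "\<lambda>u v w. (u \<diamondop> v) \<diamondop> w" "\<lambda>u v w. u \<diamondop> (v \<diamondop> w)"])
  fix i j l :: "'i \<times> 'i"
  obtain a b c d e f where s: "i = (a, b)" "j = (c, d)" "l = (e, f)"
    by (cases i, cases j, cases l) blast
  have h: "homog G (hodd G a) (bvec a)" "homog G (hodd G b) (bvec b)" "homog G (hodd G c) (bvec c)"
    "homog G (hodd G d) (bvec d)" "homog G (hodd G e) (bvec e)" "homog G (hodd G f) (bvec f)"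
    by (rule homog_bvec)+
  define T where "T = tens (bvec a \<star> (bvec c \<star> bvec e)) (bvec b \<star> (bvec d \<star> bvec f))"
  have l: "(bvec i \<diamondop> bvec j) \<diamondop> bvec l = smul (ksign (hodd G b \<and> hodd G c) *
      ksign ((hodd G b \<noteq> hodd G d) \<and> hodd G e)) T"
    unfolding s tens_bvec[symmetric] hprod2_tens[OF h(2,3)] klin_smul[OF klin_hprod2_left]
      hprod2_tens[OF homog_hprod[OF h(2,4)] h(5)] hprod_assoc smul_simps(4) T_def ..
  have r: "bvec i \<diamondop> (bvec j \<diamondop> bvec l) = smul (ksign (hodd G d \<and> hodd G e) *
      ksign (hodd G b \<and> (hodd G c \<noteq> hodd G e))) T"
    unfolding s tens_bvec[symmetric] hprod2_tens[OF h(4,5)] klin_smul[OF klin_hprod2_right]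
      hprod2_tens[OF h(2) homog_hprod[OF h(3,5)]] smul_simps(4) T_def ..
  show "(bvec i \<diamondop> bvec j) \<diamondop> bvec l = bvec i \<diamondop> (bvec j \<diamondop> bvec l)"
    unfolding l r
    by (cases "hodd G b"; cases "hodd G c"; cases "hodd G d"; cases "hodd G e") simp_all
qed (intro klin_intros klin_id)+

lemma hprod2_one_left: "tens \<I> \<I> \<diamondop> z = z"
proof (rule klin_eq_on_keys[OF klin_hprod2_right klin_id])
  fix i :: "'i \<times> 'i"
  obtain a b where i: "i = (a, b)" by (cases i)
  show "tens \<I> \<I> \<diamondop> bvec i = bvec i"
    using hprod2_tens[OF homog_hone homog_bvec, of \<I> a "bvec b"] by (simp add: i tens_bvec)
qed

lemma hprod2_one_right: "z \<diamondop> tens \<I> \<I> = z"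
proof (rule klin_eq_on_keys[OF klin_hprod2_left klin_id])
  fix i :: "'i \<times> 'i"
  obtain a b where i: "i = (a, b)" by (cases i)
  show "bvec i \<diamondop> tens \<I> \<I> = bvec i"
    using hprod2_tens[OF homog_bvec homog_hone, of "bvec a" b \<I>] by (simp add: i tens_bvec)
qed

lemma comul_hprod: "\<Delta> (u \<star> v) = \<Delta> u \<diamondop> \<Delta> v"
proof (rule bilinear_eqI[of "\<lambda>u v. \<Delta> (u \<star> v)" "\<lambda>u v. \<Delta> u \<diamondop> \<Delta> v"])
  fix i j show "\<Delta> (bvec i \<star> bvec j) = \<Delta> (bvec i) \<diamondop> \<Delta> (bvec j)"
    using bialg by (simp add: hprod_bvec bialgebra_compat_def)
qed (intro klin_intros klin_id)+

lemma comul_hone: "\<Delta> \<I> = tens \<I> \<I>"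
  using bialg unfolding bialgebra_compat_def by blast

lemma eps_hone [simp]: "eps \<I> = 1"
  using bialg unfolding bialgebra_compat_def by blast

lemma eps_hprod: "eps (u \<star> v) = eps u * eps v"
proof (rule bilinear_form_eqI[of "\<lambda>u v. eps (u \<star> v)" "\<lambda>u v. eps u * eps v"])
  fix i j show "eps (bvec i \<star> bvec j) = eps (bvec i) * eps (bvec j)"
    using bialg by (simp add: hprod_bvec bialgebra_compat_def)
qed (simp_all add: hprod_simps linform_add linform_smul algebra_simps)

text \<open>The Koszul sign in the derivation rule disappears, because it is multiplied by
the counit, which kills odd elements.\<close>

lemma lie_odd_hprod:
  assumes "x \<in> lie_odd G"
  shows "linform x (u \<star> v) = linform x u * eps v + eps u * linform x v"
proof (rule bilinear_form_eqI[of "\<lambda>u v. linform x (u \<star> v)" "\<lambda>u v. linform x u * eps v + eps u * linform x v"])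
  fix i j
  have "ksign (hodd G i) * hcounit G i = hcounit G i"
    using even_str by (cases "hcounit G i = 0") (auto simp: even_structure_def)
  thus "linform x (bvec i \<star> bvec j) = linform x (bvec i) * eps (bvec j) + eps (bvec i) * linform x (bvec j)"
    using assms by (simp add: hprod_bvec lie_odd_def)
qed (simp_all add: hprod_simps linform_add linform_smul algebra_simps)

lemma lie_odd_hone:
  assumes "x \<in> lie_odd G"
  shows "linform x \<I> = 0"
proof -
  have "linform x \<I> + 0 = linform x \<I> + linform x \<I>"
    using lie_odd_hprod[OF assms, of \<I> \<I>] by simp
  thus ?thesis by (metis add_left_cancel)
qed

lemma lie_odd_even:
  assumes "x \<in> lie_odd G" "homog G False u"
  shows "linform x u = 0"
  unfolding linform_def using assms
  by (intro sum.neutral) (auto simp: lie_odd_def homog_def)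

end

section \<open>Representations on finite index sets\<close>

definition tensor_par :: "('a \<Rightarrow> bool) \<Rightarrow> ('b \<Rightarrow> bool) \<Rightarrow> 'a \<times> 'b \<Rightarrow> bool" where
  "tensor_par p q = (\<lambda>(i, a). p i \<noteq> q a)"

text \<open>The sign comes from moving the coefficient \<open>c i j\<close>, of parity \<open>p i + p j\<close>,
past the basis vector with index \<open>a\<close> of the second factor.\<close>

definition tensor_coef :: "('i, 'k::field) hopf_super \<Rightarrow> ('a \<Rightarrow> bool) \<Rightarrow> ('b \<Rightarrow> bool) \<Rightarrow>
    ('a \<Rightarrow> 'a \<Rightarrow> ('i \<Rightarrow>\<^sub>0 'k)) \<Rightarrow> ('b \<Rightarrow> 'b \<Rightarrow> ('i \<Rightarrow>\<^sub>0 'k)) \<Rightarrow> 'a \<times> 'b \<Rightarrow> 'a \<times> 'b \<Rightarrow> ('i \<Rightarrow>\<^sub>0 'k)" where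
  "tensor_coef G p q c d = (\<lambda>(i, a) (j, b). smul (ksign ((p i \<noteq> p j) \<and> q a)) (hprod G (c i j) (d a b)))"

text \<open>The sign is the one for which \<open>v\<^sub>i\<^sup>* \<otimes> v\<^sub>j \<mapsto> \<delta>\<^sub>i\<^sub>j\<close> is equivariant on the tensor
product of the dual with the original representation.\<close>

definition dual_coef :: "('i, 'k::field) hopf_super \<Rightarrow> ('a \<Rightarrow> bool) \<Rightarrow>
    ('a \<Rightarrow> 'a \<Rightarrow> ('i \<Rightarrow>\<^sub>0 'k)) \<Rightarrow> 'a \<Rightarrow> 'a \<Rightarrow> ('i \<Rightarrow>\<^sub>0 'k)" where
  "dual_coef G p c i j = smul (ksign (p i \<and> \<not> p j)) (lin (hantip G) (c j i))"

definition comod :: "('i, 'k::field) hopf_super \<Rightarrow> 'a set \<Rightarrow> ('a \<Rightarrow> bool) \<Rightarrow>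
    ('a \<Rightarrow> 'a \<Rightarrow> ('i \<Rightarrow>\<^sub>0 'k)) \<Rightarrow> bool" where
  "comod G I p c \<longleftrightarrow> finite I \<and>
     (\<forall>i\<in>I. \<forall>j\<in>I. homog G (p i \<noteq> p j) (c i j)) \<and>
     (\<forall>i\<in>I. \<forall>j\<in>I. lin (hcomul G) (c i j) = (\<Sum>l\<in>I. tens (c i l) (c l j))) \<and>
     (\<forall>i\<in>I. \<forall>j\<in>I. linform (hcounit G) (c i j) = (if i = j then 1 else 0))"

definition odd_action :: "('i \<Rightarrow> 'k::field) \<Rightarrow> ('a \<Rightarrow> bool) \<Rightarrow> ('a \<Rightarrow> 'a \<Rightarrow> ('i \<Rightarrow>\<^sub>0 'k)) \<Rightarrow> 'a \<Rightarrow> 'a \<Rightarrow> 'k" where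
  "odd_action x p c i j = ksign (p i) * linform x (c i j)"

definition even_on :: "'a set \<Rightarrow> ('a \<Rightarrow> bool) \<Rightarrow> 'b set \<Rightarrow> ('b \<Rightarrow> bool) \<Rightarrow> ('a \<Rightarrow> 'b \<Rightarrow> 'k::zero) \<Rightarrow> bool" where
  "even_on I p J q A \<longleftrightarrow> (\<forall>i\<in>I. \<forall>j\<in>J. A i j \<noteq> 0 \<longrightarrow> p i = q j)"

definition odd_on :: "'a set \<Rightarrow> ('a \<Rightarrow> bool) \<Rightarrow> ('a \<Rightarrow> 'a \<Rightarrow> 'k::zero) \<Rightarrow> bool" where
  "odd_on I p X \<longleftrightarrow> (\<forall>i\<in>I. \<forall>j\<in>I. X i j \<noteq> 0 \<longrightarrow> p i \<noteq> p j)"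

text \<open>A matrix \<open>E :: 'b \<Rightarrow> 'a \<Rightarrow> 'k\<close> has its row index first, so it is a map from the
space with basis \<open>I\<close> to the one with basis \<open>J\<close>; this is the order of arguments in
\<open>commutes I J\<close> and \<open>equivariant I J\<close>.\<close>

definition commutes :: "'a set \<Rightarrow> 'b set \<Rightarrow> ('a \<Rightarrow> 'a \<Rightarrow> 'k::comm_ring_1) \<Rightarrow> ('b \<Rightarrow> 'b \<Rightarrow> 'k) \<Rightarrow>
    ('b \<Rightarrow> 'a \<Rightarrow> 'k) \<Rightarrow> bool" where
  "commutes I J X Y E \<longleftrightarrow>
     (\<forall>l\<in>J. \<forall>j\<in>I. (\<Sum>i\<in>I. E l i * X i j) = (\<Sum>i\<in>J. Y l i * E i j))"

definition equivariant :: "'a set \<Rightarrow> 'b set \<Rightarrow> ('a \<Rightarrow> 'a \<Rightarrow> ('i \<Rightarrow>\<^sub>0 'k::field)) \<Rightarrow>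
    ('b \<Rightarrow> 'b \<Rightarrow> ('i \<Rightarrow>\<^sub>0 'k)) \<Rightarrow> ('b \<Rightarrow> 'a \<Rightarrow> 'k) \<Rightarrow> bool" where
  "equivariant I J c d E \<longleftrightarrow>
     (\<forall>l\<in>J. \<forall>j\<in>I. (\<Sum>i\<in>I. smul (E l i) (c i j)) = (\<Sum>i\<in>J. smul (E i j) (d l i)))"

text \<open>Applying \<open>x\<close> to the coefficients turns equivariance into commutation with the
action of \<open>x\<close>. Evenness is needed because the action carries the sign of the row.\<close>

lemma equivariant_commutes:
  assumes "equivariant I J c d E" "even_on J q I p E"
  shows "commutes I J (odd_action x p c) (odd_action x q d) E"
  unfolding commutes_def
proof (intro ballI)
  fix l j assume l: "l \<in> J" and j: "j \<in> I"
  have "(\<Sum>i\<in>I. E l i * odd_action x p c i j) = (\<Sum>i\<in>I. ksign (q l) * (E l i * linform x (c i j)))"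
    using assms(2) l by (intro sum.cong refl) (auto simp: odd_action_def even_on_def)
  also have "\<dots> = ksign (q l) * linform x (\<Sum>i\<in>I. smul (E l i) (c i j))"
    by (simp add: linform_sum linform_smul sum_distrib_left)
  also have "(\<Sum>i\<in>I. smul (E l i) (c i j)) = (\<Sum>i\<in>J. smul (E i j) (d l i))"
    using assms(1) l j unfolding equivariant_def by blast
  also have "ksign (q l) * linform x (\<Sum>i\<in>J. smul (E i j) (d l i)) = (\<Sum>i\<in>J. odd_action x q d l i * E i j)"
    by (simp add: linform_sum linform_smul sum_distrib_left odd_action_def mult_ac)
  finally show "(\<Sum>i\<in>I. E l i * odd_action x p c i j) = (\<Sum>i\<in>J. odd_action x q d l i * E i j)" .
qed

lemma comodD:
  assumes "comod G I p c"
  shows "finite I" "\<And>i j. i \<in> I \<Longrightarrow> j \<in> I \<Longrightarrow> homog G (p i \<noteq> p j) (c i j)"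
    "\<And>i j. i \<in> I \<Longrightarrow> j \<in> I \<Longrightarrow> lin (hcomul G) (c i j) = (\<Sum>l\<in>I. tens (c i l) (c l j))"
    "\<And>i j. i \<in> I \<Longrightarrow> j \<in> I \<Longrightarrow> linform (hcounit G) (c i j) = (if i = j then 1 else 0)"
  using assms unfolding comod_def by blast+

lemma comod_reindex:
  assumes "comod G I p c" "bij_betw f J I"
  shows "comod G J (\<lambda>j. p (f j)) (\<lambda>i j. c (f i) (f j))"
proof -
  have fJ: "f j \<in> I" if "j \<in> J" for j using assms(2) that by (auto dest: bij_betwE)
  have "finite J" using comodD(1)[OF assms(1)] assms(2) bij_betw_finite by blast
  moreover have "(\<Sum>l\<in>I. tens (c (f i) l) (c l (f j))) = (\<Sum>l\<in>J. tens (c (f i) (f l)) (c (f l) (f j)))" for i j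
    by (rule sum.reindex_bij_betw[OF assms(2), symmetric])
  moreover have "f i = f j \<longleftrightarrow> i = j" if "i \<in> J" "j \<in> J" for i j
    using assms(2) that by (auto simp: bij_betw_def inj_on_def)
  ultimately show ?thesis
    unfolding comod_def by (intro conjI ballI comodD(2)[OF assms(1)] fJ)
      (simp_all add: comodD(3,4)[OF assms(1)] fJ)
qed

context hopf
begin

lemma comod_tensor:
  assumes c: "comod G I p c" and d: "comod G J q d"
  shows "comod G (I \<times> J) (tensor_par p q) (tensor_coef G p q c d)"
  unfolding comod_def
proof (intro conjI ballI)
  show "finite (I \<times> J)" using comodD(1)[OF c] comodD(1)[OF d] by simp
next
  fix u v assume "u \<in> I \<times> J" "v \<in> I \<times> J"
  then obtain i a j b where s: "u = (i, a)" "v = (j, b)" "i \<in> I" "a \<in> J" "j \<in> I" "b \<in> J" by blast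
  have "homog G ((p i \<noteq> p j) \<noteq> (q a \<noteq> q b)) (c i j \<star> d a b)"
    by (intro homog_hprod comodD(2)[OF c] comodD(2)[OF d] s)
  moreover have "((p i \<noteq> p j) \<noteq> (q a \<noteq> q b)) = (tensor_par p q u \<noteq> tensor_par p q v)"
    by (auto simp: s tensor_par_def)
  ultimately show "homog G (tensor_par p q u \<noteq> tensor_par p q v) (tensor_coef G p q c d u v)"
    by (simp add: s tensor_coef_def homog_smul)
  show "eps (tensor_coef G p q c d u v) = (if u = v then 1 else 0)"
    using s by (simp add: tensor_coef_def linform_smul eps_hprod comodD(4)[OF c] comodD(4)[OF d])
  have "\<Delta> (tensor_coef G p q c d u v) = smul (ksign ((p i \<noteq> p j) \<and> q a))
      ((\<Sum>l\<in>I. tens (c i l) (c l j)) \<diamondop> (\<Sum>m\<in>J. tens (d a m) (d m b)))"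
    by (simp add: s tensor_coef_def lin_simps comul_hprod comodD(3)[OF c] comodD(3)[OF d])
  also have "\<dots> = (\<Sum>l\<in>I. \<Sum>m\<in>J. smul (ksign ((p i \<noteq> p j) \<and> q a))
      (tens (c i l) (c l j) \<diamondop> tens (d a m) (d m b)))"
    by (simp only: klin_sum[OF klin_hprod2_left] klin_sum[OF klin_hprod2_right] smul_sum)
       (rule sum.swap)
  also have "\<dots> = (\<Sum>l\<in>I. \<Sum>m\<in>J. tens (tensor_coef G p q c d u (l, m)) (tensor_coef G p q c d (l, m) v))"
  proof (intro sum.cong refl)
    fix l m assume l: "l \<in> I" and m: "m \<in> J"
    have h: "homog G (p l \<noteq> p j) (c l j)" "homog G (q a \<noteq> q m) (d a m)"
      using l m s comodD(2)[OF c] comodD(2)[OF d] by auto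
    show "smul (ksign ((p i \<noteq> p j) \<and> q a)) (tens (c i l) (c l j) \<diamondop> tens (d a m) (d m b)) =
      tens (tensor_coef G p q c d u (l, m)) (tensor_coef G p q c d (l, m) v)"
      unfolding hprod2_tens[OF h] s tensor_coef_def prod.case tens_simps smul_simps
      by (cases "p i"; cases "p j"; cases "p l"; cases "q a"; cases "q m") simp_all
  qed
  finally show "\<Delta> (tensor_coef G p q c d u v) =
      (\<Sum>l\<in>I \<times> J. tens (tensor_coef G p q c d u l) (tensor_coef G p q c d l v))"
    by (simp add: sum.cartesian_product case_prod_beta')
qed

text \<open>The matrix of coefficients of a comodule is invertible over the coordinate
ring, with inverse given by the antipode. All that is needed about the antipode follows from this.\<close>

lemma antipode_inverse:
  assumes c: "comod G I p c" and ij: "i \<in> I" "j \<in> I"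
  shows "(\<Sum>l\<in>I. antipode (c i l) \<star> c l j) = smul (if i = j then 1 else 0) \<I>"
    and "(\<Sum>l\<in>I. c i l \<star> antipode (c l j)) = smul (if i = j then 1 else 0) \<I>"
proof -
  have k1: "klin (\<lambda>u. lin (\<lambda>(j, l). hprod G (hantip G j) (bvec l)) (\<Delta> u))"
    "klin (\<lambda>u. lin (\<lambda>(j, l). hprod G (bvec j) (hantip G l)) (\<Delta> u))"
    by (intro klin_intros klin_id)+
  have k2: "klin (\<lambda>u. smul (eps u) \<I>)"
    by (rule klinI) (simp_all add: linform_add linform_smul smul_add_left)
  have L: "lin (\<lambda>(j, l). hprod G (hantip G j) (bvec l)) (\<Delta> u) = smul (eps u) \<I>" for u
    by (rule klin_eq_on_keys[OF k1(1) k2]) (use antip in \<open>simp add: antipode_axiom_def\<close>)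
  have R: "lin (\<lambda>(j, l). hprod G (bvec j) (hantip G l)) (\<Delta> u) = smul (eps u) \<I>" for u
    by (rule klin_eq_on_keys[OF k1(2) k2]) (use antip in \<open>simp add: antipode_axiom_def\<close>)
  have tL: "lin (\<lambda>(j, l). hprod G (hantip G j) (bvec l)) (tens u v) = antipode u \<star> v" for u v
    by (rule bilinear_eqI[of "\<lambda>u v. lin (\<lambda>(j, l). hprod G (hantip G j) (bvec l)) (tens u v)"
        "\<lambda>u v. antipode u \<star> v"]) (intro klin_intros klin_id | simp)+
  have tR: "lin (\<lambda>(j, l). hprod G (bvec j) (hantip G l)) (tens u v) = u \<star> antipode v" for u v
    by (rule bilinear_eqI[of "\<lambda>u v. lin (\<lambda>(j, l). hprod G (bvec j) (hantip G l)) (tens u v)"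
        "\<lambda>u v. u \<star> antipode v"]) (intro klin_intros klin_id | simp)+
  show "(\<Sum>l\<in>I. antipode (c i l) \<star> c l j) = smul (if i = j then 1 else 0) \<I>"
    using L[of "c i j"] by (simp only: comodD(3,4)[OF c ij] klin_sum[OF klin_lin] tL)
  show "(\<Sum>l\<in>I. c i l \<star> antipode (c l j)) = smul (if i = j then 1 else 0) \<I>"
    using R[of "c i j"] by (simp only: comodD(3,4)[OF c ij] klin_sum[OF klin_lin] tR)
qed

lemma eps_antipode:
  assumes c: "comod G I p c" and ij: "i \<in> I" "j \<in> I"
  shows "eps (antipode (c i j)) = (if i = j then 1 else 0)"
proof -
  have "eps (\<Sum>l\<in>I. antipode (c i l) \<star> c l j) = (\<Sum>l\<in>I. if l = j then eps (antipode (c i j)) else 0)"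
    unfolding linform_sum eps_hprod using ij by (intro sum.cong refl) (auto simp: comodD(4)[OF c])
  also have "\<dots> = eps (antipode (c i j))" using ij comodD(1)[OF c] by simp
  finally show ?thesis by (simp add: antipode_inverse[OF c ij] linform_smul)
qed

lemma lie_antipode:
  assumes c: "comod G I p c" and ij: "i \<in> I" "j \<in> I" and x: "x \<in> lie_odd G"
  shows "linform x (antipode (c i j)) = - linform x (c i j)"
proof -
  have "linform x (\<Sum>l\<in>I. antipode (c i l) \<star> c l j) =
      (\<Sum>l\<in>I. if l = j then linform x (antipode (c i j)) else 0) +
      (\<Sum>l\<in>I. if l = i then linform x (c i j) else 0)"
    unfolding linform_sum lie_odd_hprod[OF x] sum.distrib[symmetric]
    using ij by (intro sum.cong refl) (auto simp: comodD(4)[OF c] eps_antipode[OF c])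
  also have "\<dots> = linform x (antipode (c i j)) + linform x (c i j)" using ij comodD(1)[OF c] by simp
  finally show ?thesis
    by (simp add: antipode_inverse[OF c ij] linform_smul lie_odd_hone[OF x] eq_neg_iff_add_eq_0)
qed

text \<open>Over the algebra \<open>k[G] \<otimes> k[G]\<close>, both the entrywise coproduct of the inverse
matrix and the matrix on the right are inverses of the coproduct of the coefficient matrix: the
former is a left inverse, the latter a right inverse, so they coincide.\<close>

lemma comul_antipode:
  assumes c: "comod G I p c" and ij: "i \<in> I" "j \<in> I"
  shows "\<Delta> (antipode (c i j)) = (\<Sum>l\<in>I. smul (ksign ((p i \<noteq> p l) \<and> (p l \<noteq> p j)))
           (tens (antipode (c l j)) (antipode (c i l))))"
proof -
  define A where "A i j = (\<Sum>l\<in>I. tens (c i l) (c l j))" for i j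
  define B where "B i j = \<Delta> (antipode (c i j))" for i j
  define C where "C i j = (\<Sum>l\<in>I. smul (ksign ((p i \<noteq> p l) \<and> (p l \<noteq> p j)))
           (tens (antipode (c l j)) (antipode (c i l))))" for i j
  define E where "E = tens \<I> \<I>"
  have fin: "finite I" using comodD(1)[OF c] .
  have BA: "(\<Sum>l\<in>I. B i l \<diamondop> A l j) = smul (if i = j then 1 else 0) E" if "i \<in> I" "j \<in> I" for i j
  proof -
    have "(\<Sum>l\<in>I. B i l \<diamondop> A l j) = \<Delta> (\<Sum>l\<in>I. antipode (c i l) \<star> c l j)"
      unfolding lin_simps comul_hprod using that
      by (intro sum.cong refl) (simp add: A_def B_def comodD(3)[OF c])
    thus ?thesis by (simp add: antipode_inverse[OF c that] lin_simps comul_hone E_def)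
  qed
  have AC: "(\<Sum>j\<in>I. A i j \<diamondop> C j k) = smul (if i = k then 1 else 0) E" if ik: "i \<in> I" "k \<in> I" for i k
  proof -
    have "(\<Sum>j\<in>I. A i j \<diamondop> C j k) = (\<Sum>j\<in>I. \<Sum>l\<in>I. \<Sum>m\<in>I.
        smul (ksign ((p j \<noteq> p m) \<and> (p m \<noteq> p k)))
          (tens (c i l) (c l j) \<diamondop> tens (antipode (c m k)) (antipode (c j m))))"
      unfolding A_def C_def klin_sum[OF klin_hprod2_left] klin_sum[OF klin_hprod2_right]
        klin_smul[OF klin_hprod2_right] smul_sum
      by (rule sum.cong[OF refl], rule sum.swap)
    also have "\<dots> = (\<Sum>j\<in>I. \<Sum>l\<in>I. \<Sum>m\<in>I. smul (ksign ((p l \<noteq> p m) \<and> (p m \<noteq> p k)))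
          (tens (c i l \<star> antipode (c m k)) (c l j \<star> antipode (c j m))))"
    proof (intro sum.cong refl)
      fix j l m assume jlm: "j \<in> I" "l \<in> I" "m \<in> I"
      have h: "homog G (p l \<noteq> p j) (c l j)" "homog G (p m \<noteq> p k) (antipode (c m k))"
        using jlm ik comodD(2)[OF c] by (auto intro!: homog_antipode)
      show "smul (ksign ((p j \<noteq> p m) \<and> (p m \<noteq> p k)))
          (tens (c i l) (c l j) \<diamondop> tens (antipode (c m k)) (antipode (c j m))) =
        smul (ksign ((p l \<noteq> p m) \<and> (p m \<noteq> p k)))
          (tens (c i l \<star> antipode (c m k)) (c l j \<star> antipode (c j m)))"
        unfolding hprod2_tens[OF h] smul_simps
        by (cases "p l"; cases "p j"; cases "p m"; cases "p k") simp_all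
    qed
    also have "\<dots> = (\<Sum>l\<in>I. \<Sum>j\<in>I. \<Sum>m\<in>I. smul (ksign ((p l \<noteq> p m) \<and> (p m \<noteq> p k)))
          (tens (c i l \<star> antipode (c m k)) (c l j \<star> antipode (c j m))))"
      by (rule sum.swap)
    also have "\<dots> = (\<Sum>l\<in>I. \<Sum>m\<in>I. smul (ksign ((p l \<noteq> p m) \<and> (p m \<noteq> p k)))
          (tens (c i l \<star> antipode (c m k)) (\<Sum>j\<in>I. c l j \<star> antipode (c j m))))"
      unfolding klin_sum[OF klin_tens_right] smul_sum by (intro sum.cong refl sum.swap)
    also have "\<dots> = (\<Sum>l\<in>I. \<Sum>m\<in>I. if m = l then tens (c i l \<star> antipode (c l k)) \<I> else 0)"
      by (intro sum.cong refl) (auto simp: antipode_inverse[OF c] tens_simps)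
    also have "\<dots> = tens (\<Sum>l\<in>I. c i l \<star> antipode (c l k)) \<I>"
      using fin by (simp add: tens_simps)
    finally show ?thesis by (simp add: antipode_inverse[OF c that] tens_simps E_def)
  qed
  have E1: "u \<diamondop> E = u" "E \<diamondop> u = u" for u
    unfolding E_def by (rule hprod2_one_right, rule hprod2_one_left)
  have "B i j = (\<Sum>l\<in>I. if l = j then B i j else 0)" using ij fin by simp
  also have "\<dots> = (\<Sum>l\<in>I. B i l \<diamondop> (\<Sum>m\<in>I. A l m \<diamondop> C m j))"
    using ij by (intro sum.cong refl) (auto simp: AC hprod2_simps E1)
  also have "\<dots> = (\<Sum>m\<in>I. (\<Sum>l\<in>I. B i l \<diamondop> A l m) \<diamondop> C m j)"
    unfolding klin_sum[OF klin_hprod2_left] klin_sum[OF klin_hprod2_right] hprod2_assoc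
    by (rule sum.swap)
  also have "\<dots> = (\<Sum>m\<in>I. if m = i then C i j else 0)"
    using ij by (intro sum.cong refl) (auto simp: BA hprod2_simps E1)
  also have "\<dots> = C i j" using ij fin by simp
  finally show ?thesis by (simp add: B_def C_def)
qed

text \<open>The antipode reverses the two tensor factors, which is compensated by the transposition
of indices in the dual.\<close>

lemma comod_dual:
  assumes c: "comod G I p c"
  shows "comod G I p (dual_coef G p c)"
  unfolding comod_def
proof (intro conjI ballI)
  show "finite I" by (rule comodD(1)[OF c])
  fix i j assume ij: "i \<in> I" "j \<in> I"
  have "homog G (p j \<noteq> p i) (antipode (c j i))" by (intro homog_antipode comodD(2)[OF c] ij)
  thus "homog G (p i \<noteq> p j) (dual_coef G p c i j)"
    unfolding dual_coef_def eq_commute[of "p j"] by (rule homog_smul)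
  show "eps (dual_coef G p c i j) = (if i = j then 1 else 0)"
    using eps_antipode[OF c ij(2,1)] by (auto simp: dual_coef_def linform_smul)
  show "\<Delta> (dual_coef G p c i j) = (\<Sum>l\<in>I. tens (dual_coef G p c i l) (dual_coef G p c l j))"
    unfolding dual_coef_def klin_smul[OF klin_lin] comul_antipode[OF c ij(2,1)] smul_sum tens_simps smul_simps
    by (intro sum.cong refl) (simp add: ksign_def)
qed

lemma odd_action_odd:
  assumes "x \<in> lie_odd G" "comod G I p c"
  shows "odd_on I p (odd_action x p c)"
  unfolding odd_on_def odd_action_def
  using lie_odd_even[OF assms(1)] comodD(2)[OF assms(2)] by fastforce

lemma odd_action_tensor:
  assumes x: "x \<in> lie_odd G" and c: "comod G I p c" and d: "comod G J q d"
    and "i \<in> I" "j \<in> I" "a \<in> J" "b \<in> J"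
  shows "odd_action x (tensor_par p q) (tensor_coef G p q c d) (i, a) (j, b) =
    odd_action x p c i j * (if a = b then 1 else 0) + ksign (p i) * (if i = j then 1 else 0) * odd_action x q d a b"
proof (cases "p i = p j")
  case True
  hence "linform x (c i j) = 0"
    using lie_odd_even[OF x] comodD(2)[OF c assms(4,5)] by simp
  thus ?thesis
    by (cases "p i"; cases "q a") (simp_all add: odd_action_def tensor_par_def tensor_coef_def linform_smul lie_odd_hprod[OF x]
      comodD(4)[OF c assms(4,5)] comodD(4)[OF d assms(6,7)] True)
next
  case False
  hence "i \<noteq> j" by auto
  thus ?thesis using False
    by (cases "p i"; cases "q a") (simp_all add: odd_action_def tensor_par_def tensor_coef_def linform_smul lie_odd_hprod[OF x]
      comodD(4)[OF c assms(4,5)] comodD(4)[OF d assms(6,7)])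
qed

lemma odd_action_dual:
  assumes x: "x \<in> lie_odd G" and c: "comod G I p c" and ij: "i \<in> I" "j \<in> I"
  shows "odd_action x p (dual_coef G p c) i j = ksign (p i) * odd_action x p c j i"
proof (cases "p i = p j")
  case True
  hence "linform x (c j i) = 0"
    using lie_odd_even[OF x] comodD(2)[OF c ij(2,1)] by simp
  thus ?thesis by (simp add: odd_action_def dual_coef_def linform_smul lie_antipode[OF c ij(2,1) x])
next
  case False
  thus ?thesis
    by (cases "p i") (simp_all add: odd_action_def dual_coef_def linform_smul lie_antipode[OF c ij(2,1) x])
qed

end

section \<open>Koszul signs and tensor powers\<close>

abbreviation adj :: "nat \<Rightarrow> nat \<Rightarrow> nat" where
  "adj m \<equiv> Transposition.transpose m (Suc m)"

text \<open>The transposition of \<open>a\<close> and \<open>b + 1\<close> is the conjugate of the transposition of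
\<open>a\<close> and \<open>b\<close> by the adjacent one of \<open>b\<close> and \<open>b + 1\<close>. Signs and equivariance thus need to be
computed only for two neighbouring tensor factors.\<close>

lemma adjacent_transposition_induct [consumes 1, case_names id adj comp]:
  assumes "\<sigma> permutes {..<n}" "P id" "\<And>m. Suc m < n \<Longrightarrow> P (adj m)"
    and comp: "\<And>\<sigma> \<tau>. \<sigma> permutes {..<n} \<Longrightarrow> \<tau> permutes {..<n} \<Longrightarrow> P \<sigma> \<Longrightarrow> P \<tau> \<Longrightarrow> P (\<sigma> \<circ> \<tau>)"
  shows "P \<sigma>"
proof -
  have less: "P (Transposition.transpose a b)" if "a < b" "b < n" for a b
    using that
  proof (induction b)
    case (Suc b)
    show ?case
    proof (cases "a = b")
      case True
      thus ?thesis using assms(3) Suc by simp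
    next
      case False
      hence ab: "a < b" "b < n" using Suc.prems by auto
      have e: "Transposition.transpose a (Suc b) = (adj b \<circ> Transposition.transpose a b) \<circ> adj b"
        using ab by (auto simp: fun_eq_iff Transposition.transpose_def)
      have "adj b permutes {..<n}" "Transposition.transpose a b permutes {..<n}"
        using ab Suc.prems by (auto intro!: permutes_swap_id)
      moreover have "P (adj b)" "P (Transposition.transpose a b)"
        using assms(3) Suc ab by auto
      ultimately show ?thesis unfolding e by (intro comp permutes_compose) auto
    qed
  qed simp
  have "P (Transposition.transpose a b)" if "a < n" "b < n" "a \<noteq> b" for a b
    using less[of a b] less[of b a] that by (cases "a < b") (auto simp: transpose_commute)
  with assms(1) finite_lessThan show ?thesis
  proof (induction rule: permutes_induct)
    case (swap a b p)
    thus ?case by (intro comp) (auto intro!: permutes_swap_id)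
  qed (use assms(2) in auto)
qed

text \<open>The sign with which a permutation acts on a tensor product counts, modulo two, the inversions among
odd factors. It is written as a product over unordered pairs of positions,
since these are permuted by any permutation of the positions.
Here \<open>o'\<close> gives the parities before the action and \<open>o' \<circ> \<sigma>\<close> those after it.\<close>

definition odd_pairs :: "nat \<Rightarrow> (nat \<Rightarrow> bool) \<Rightarrow> nat set set" where
  "odd_pairs n o' = {A. A \<subseteq> {..<n} \<and> card A = 2 \<and> (\<forall>i\<in>A. o' i)}"

definition order_sign :: "(nat \<Rightarrow> nat) \<Rightarrow> nat set \<Rightarrow> 'k::comm_ring_1" where
  "order_sign \<sigma> A = (if \<forall>i\<in>A. \<forall>j\<in>A. i < j \<longrightarrow> \<sigma> i < \<sigma> j then 1 else - 1)"

definition koszul :: "nat \<Rightarrow> (nat \<Rightarrow> nat) \<Rightarrow> (nat \<Rightarrow> bool) \<Rightarrow> 'k::comm_ring_1" where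
  "koszul n \<sigma> o' = (\<Prod>A\<in>odd_pairs n (o' \<circ> \<sigma>). order_sign \<sigma> A)"

lemma finite_odd_pairs: "finite (odd_pairs n o')"
  unfolding odd_pairs_def by (rule finite_subset[of _ "Pow {..<n}"]) auto

lemma card2_obtain:
  assumes "card (A :: nat set) = 2"
  obtains i j where "A = {i, j}" "i < j"
proof -
  obtain i j where "A = {i, j}" "i \<noteq> j" using assms unfolding card_2_iff by blast
  thus ?thesis using that[of i j] that[of j i] by (cases "i < j") (auto simp: insert_commute)
qed

text \<open>A pair is inverted by \<open>\<sigma> \<circ> \<tau>\<close> if exactly one of the following happens: \<open>\<tau>\<close> inverts
it, or \<open>\<sigma>\<close> inverts its image under \<open>\<tau>\<close>. Reindexing the second factor along \<open>\<tau>\<close> gives the cocycle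
rule.\<close>

lemma koszul_comp:
  assumes \<sigma>: "\<sigma> permutes {..<n}" and \<tau>: "\<tau> permutes {..<n}"
  shows "koszul n (\<sigma> \<circ> \<tau>) o' = koszul n \<sigma> o' * koszul n \<tau> (o' \<circ> \<sigma>)"
proof -
  let ?S = "odd_pairs n (o' \<circ> \<sigma> \<circ> \<tau>)"
  have inj: "inj \<sigma>" "inj \<tau>" using \<sigma> \<tau> permutes_inj by auto
  have "koszul n (\<sigma> \<circ> \<tau>) o' = (\<Prod>A\<in>?S. order_sign \<sigma> (\<tau> ` A) * order_sign \<tau> A)"
    unfolding koszul_def o_assoc
  proof (rule prod.cong[OF refl])
    fix A assume "A \<in> ?S"
    then obtain i j where A: "A = {i, j}" "i < j" unfolding odd_pairs_def by (auto elim: card2_obtain)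
    have ne: "\<tau> i \<noteq> \<tau> j" "\<sigma> (\<tau> i) \<noteq> \<sigma> (\<tau> j)" using inj A(2) by (auto dest!: injD)
    show "order_sign (\<sigma> \<circ> \<tau>) A = order_sign \<sigma> (\<tau> ` A) * order_sign \<tau> A"
      using A(2) ne by (cases "\<tau> i < \<tau> j"; cases "\<sigma> (\<tau> i) < \<sigma> (\<tau> j)") (auto simp: order_sign_def A(1))
  qed
  also have "\<dots> = (\<Prod>A\<in>?S. order_sign \<sigma> (\<tau> ` A)) * koszul n \<tau> (o' \<circ> \<sigma>)"
    by (simp add: prod.distrib koszul_def)
  also have "(\<Prod>A\<in>?S. order_sign \<sigma> (\<tau> ` A)) = koszul n \<sigma> o'"
    unfolding koszul_def
  proof (rule prod.reindex_bij_betw)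
    show "bij_betw ((`) \<tau>) ?S (odd_pairs n (o' \<circ> \<sigma>))"
    proof (rule bij_betw_imageI)
      show "inj_on ((`) \<tau>) ?S" by (rule inj_on_image[OF inj_on_subset[OF inj(2) subset_UNIV]])
      show "(`) \<tau> ` ?S = odd_pairs n (o' \<circ> \<sigma>)"
      proof (intro equalityI subsetI)
        fix B assume "B \<in> (`) \<tau> ` ?S"
        thus "B \<in> odd_pairs n (o' \<circ> \<sigma>)"
          using permutes_image[OF \<tau>] card_image[OF inj_on_subset[OF inj(2)]]
          by (fastforce simp: odd_pairs_def)
      next
        fix B assume B: "B \<in> odd_pairs n (o' \<circ> \<sigma>)"
        have e: "\<tau> ` (inv_into UNIV \<tau> ` B) = B" using permutes_inverses[OF \<tau>] by (simp add: image_image)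
        have "inv_into UNIV \<tau> ` B \<subseteq> {..<n}"
          using B permutes_image[OF permutes_inv[OF \<tau>]] by (auto simp: odd_pairs_def)
        moreover have "card (inv_into UNIV \<tau> ` B) = 2"
          using B card_image[OF inj_on_subset[OF permutes_inj[OF permutes_inv[OF \<tau>]]]]
          by (auto simp: odd_pairs_def)
        ultimately have "inv_into UNIV \<tau> ` B \<in> ?S"
          using B permutes_inverses[OF \<tau>] by (auto simp: odd_pairs_def)
        with e show "B \<in> (`) \<tau> ` ?S" by (metis imageI)
      qed
    qed
  qed
  finally show ?thesis .
qed

lemma koszul_id [simp]: "koszul n id o' = 1"
  unfolding koszul_def by (intro prod.neutral) (auto simp: order_sign_def)

lemma koszul_cong:
  assumes \<sigma>: "\<sigma> permutes {..<n}" and "\<And>i. i < n \<Longrightarrow> o1 i = o2 i"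
  shows "koszul n \<sigma> o1 = koszul n \<sigma> o2"
proof -
  have "\<sigma> i < n" if "i < n" for i using permutes_in_image[OF \<sigma>, of i] that by simp
  hence "odd_pairs n (o1 \<circ> \<sigma>) = odd_pairs n (o2 \<circ> \<sigma>)"
    unfolding odd_pairs_def using assms(2) by fastforce
  thus ?thesis by (simp add: koszul_def)
qed

lemma koszul_adj:
  assumes "Suc m < n"
  shows "koszul n (adj m) o' = ksign (o' m \<and> o' (Suc m))"
proof -
  have "koszul n (adj m) o' =
      (\<Prod>A\<in>odd_pairs n (o' \<circ> adj m). if A = {m, Suc m} then - 1 else (1 :: 'a))"
    unfolding koszul_def
  proof (rule prod.cong[OF refl])
    fix A assume "A \<in> odd_pairs n (o' \<circ> adj m)"
    then obtain i j where A: "A = {i, j}" "i < j" unfolding odd_pairs_def by (auto elim: card2_obtain)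
    have "{i, j} = {m, Suc m} \<longleftrightarrow> i = m \<and> j = Suc m" using A(2) by (auto simp: doubleton_eq_iff)
    thus "order_sign (adj m) A = (if A = {m, Suc m} then - 1 else (1 :: 'a))"
      using A(2) by (auto simp: order_sign_def A(1) Transposition.transpose_def)
  qed
  also have "\<dots> = (if {m, Suc m} \<in> odd_pairs n (o' \<circ> adj m) then - 1 else 1)"
    by (simp add: prod.delta[OF finite_odd_pairs])
  also have "\<dots> = ksign (o' m \<and> o' (Suc m))"
    using assms by (auto simp: odd_pairs_def ksign_def)
  finally show ?thesis .
qed

lemma koszul_sq:
  assumes "\<sigma> permutes {..<n}"
  shows "koszul n \<sigma> o' * koszul n \<sigma> o' = (1 :: 'k::comm_ring_1)"
proof -
  have "order_sign \<sigma> A * order_sign \<sigma> A = (1 :: 'k)" for A by (simp add: order_sign_def)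
  thus ?thesis by (simp add: koszul_def prod.distrib[symmetric])
qed

text \<open>The odd factors lying between the two positions are crossed twice, so only the
crossing of the two factors themselves counts.\<close>

lemma koszul_transpose:
  assumes "a < n" "b < n" "a \<noteq> b" "o' a = o' b"
  shows "koszul n (Transposition.transpose a b) o' = (ksign (o' a) :: 'k::comm_ring_1)"
proof -
  have less: "koszul n (Transposition.transpose a b) o' = (ksign (o' a) :: 'k::comm_ring_1)"
    if "a < b" "b < n" "o' a = o' b" for a b o'
    using that
  proof (induction b arbitrary: o')
    case (Suc b)
    show ?case
    proof (cases "a = b")
      case True
      thus ?thesis using koszul_adj[of a n o'] Suc by simp
    next
      case False
      hence ab: "a < b" "b < n" using Suc.prems by auto
      let ?t = "Transposition.transpose a b"
      have e: "Transposition.transpose a (Suc b) = (adj b \<circ> ?t) \<circ> adj b"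
        using ab by (auto simp: fun_eq_iff Transposition.transpose_def)
      have p: "adj b permutes {..<n}" "?t permutes {..<n}"
        using ab Suc.prems by (auto intro!: permutes_swap_id)
      have v: "adj b a = a" "adj b b = Suc b" "adj b (Suc b) = b" "?t b = a" "?t (Suc b) = Suc b"
        using ab by (auto simp: Transposition.transpose_def)
      have IH: "koszul n ?t (o' \<circ> adj b) = (ksign (o' a) :: 'k)"
        using Suc.IH[of "o' \<circ> adj b"] ab Suc.prems v by (simp add: o_def)
      have "(koszul n (Transposition.transpose a (Suc b)) o' :: 'k) =
          koszul n (adj b) o' * koszul n ?t (o' \<circ> adj b) * koszul n (adj b) (o' \<circ> (adj b \<circ> ?t))"
        unfolding e by (simp only: koszul_comp permutes_compose p)
      also have "\<dots> = ksign (o' a)"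
        unfolding IH using Suc.prems
        by (simp add: koszul_adj v) (cases "o' b"; cases "o' (Suc b)"; simp)
      finally show ?thesis .
    qed
  qed simp
  show ?thesis
    using less[of a b o'] less[of b a o'] assms by (cases "a < b") (auto simp: transpose_commute)
qed

abbreviation words :: "nat \<Rightarrow> 'a set \<Rightarrow> (nat \<Rightarrow> 'a) set" where
  "words n I \<equiv> PiE {..<n} (\<lambda>_. I)"

text \<open>Tensor powers have the words of length \<open>n\<close> as basis. Words are
functions instead of lists so that permutations of positions act by composition; the recursions
split off the last letter.\<close>

primrec word_par :: "('a \<Rightarrow> bool) \<Rightarrow> nat \<Rightarrow> (nat \<Rightarrow> 'a) \<Rightarrow> bool" where
  "word_par p 0 w = False"
| "word_par p (Suc n) w = (word_par p n w \<noteq> p (w n))"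

primrec word_coef :: "('i, 'k::field) hopf_super \<Rightarrow> ('a \<Rightarrow> bool) \<Rightarrow> ('a \<Rightarrow> 'a \<Rightarrow> ('i \<Rightarrow>\<^sub>0 'k)) \<Rightarrow>
    nat \<Rightarrow> (nat \<Rightarrow> 'a) \<Rightarrow> (nat \<Rightarrow> 'a) \<Rightarrow> ('i \<Rightarrow>\<^sub>0 'k)" where
  "word_coef G p c 0 u w = hone G"
| "word_coef G p c (Suc n) u w = smul (ksign ((word_par p n u \<noteq> word_par p n w) \<and> p (u n)))
     (hprod G (word_coef G p c n u w) (c (u n) (w n)))"

lemma word_par_cong: "(\<And>i. i < n \<Longrightarrow> u i = w i) \<Longrightarrow> word_par p n u = word_par p n w"
  by (induction n) auto

lemma word_coef_cong:
  "(\<And>i. i < n \<Longrightarrow> u i = u' i) \<Longrightarrow> (\<And>i. i < n \<Longrightarrow> w i = w' i) \<Longrightarrow> word_coef G p c n u w = word_coef G p c n u' w'"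
  by (induction n) (auto simp: word_par_cong[of _ u u'] word_par_cong[of _ w w'])

text \<open>Splitting off the last letter identifies the next tensor power with a
tensor product, so facts about tensor products carry over by reindexing.\<close>

lemma words_Suc_bij:
  "bij_betw (\<lambda>w. (restrict w {..<n}, w n)) (words (Suc n) I) (words n I \<times> I)"
proof (rule bij_betw_byWitness[where f' = "\<lambda>(w, a). w(n := a)"])
  show "\<forall>w\<in>words (Suc n) I. (case (restrict w {..<n}, w n) of (w, a) \<Rightarrow> w(n := a)) = w"
    by (auto simp: fun_eq_iff PiE_def extensional_def restrict_def less_Suc_eq)
  show "\<forall>x\<in>words n I \<times> I. (\<lambda>w. (restrict w {..<n}, w n)) (case x of (w, a) \<Rightarrow> w(n := a)) = x"
    by (auto simp: fun_eq_iff PiE_def extensional_def restrict_def)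
qed (auto simp: PiE_def extensional_def Pi_def restrict_def)

lemma word_par_restrict: "word_par p n (restrict w {..<n}) = word_par p n w"
  by (rule word_par_cong) auto

lemma word_par_permute:
  assumes "\<sigma> permutes {..<n}"
  shows "word_par p n (w \<circ> \<sigma>) = word_par p n w"
  using assms
proof (induction arbitrary: w rule: adjacent_transposition_induct)
  case (adj m)
  thus ?case
  proof (induction n)
    case (Suc n)
    show ?case
    proof (cases "n = Suc m")
      case True
      have "word_par p m (w \<circ> adj m) = word_par p m w" by (rule word_par_cong) auto
      thus ?thesis unfolding True word_par.simps by (simp only: o_apply) auto
    next
      case False
      thus ?thesis using Suc by auto
    qed
  qed simp
next
  case (comp \<sigma> \<tau>)
  thus ?case by (simp only: o_assoc)
qed simp

lemma words_permute:
  assumes "\<sigma> permutes {..<n}" "w \<in> words n I"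
  shows "w \<circ> \<sigma> \<in> words n I"
proof -
  have "\<sigma> i < n \<longleftrightarrow> i < n" for i using permutes_in_image[OF assms(1), of i] by simp
  thus ?thesis using assms(2) by (auto simp: PiE_def extensional_def)
qed

lemma words_permute_inv:
  assumes "\<sigma> permutes {..<n}" "w \<in> words n I"
  shows "w \<circ> inv_into UNIV \<sigma> \<in> words n I" "w \<circ> inv_into UNIV \<sigma> \<circ> \<sigma> = w" "w \<circ> \<sigma> \<circ> inv_into UNIV \<sigma> = w"
  using words_permute[OF permutes_inv[OF assms(1)] assms(2)] permutes_inverses[OF assms(1)]
  by (auto simp: fun_eq_iff)

context hopf
begin

lemma comod_words:
  assumes c: "comod G I p c"
  shows "comod G (words n I) (word_par p n) (word_coef G p c n)"
proof (induction n)
  case 0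
  have "words 0 I = {\<lambda>_. undefined}" by simp
  thus ?case by (simp add: comod_def homog_hone comul_hone)
next
  case (Suc n)
  have e1: "(\<lambda>w. tensor_par (word_par p n) p (restrict w {..<n}, w n)) = word_par p (Suc n)"
    by (simp add: fun_eq_iff tensor_par_def word_par_restrict)
  have "word_coef G p c n (restrict u {..<n}) (restrict w {..<n}) = word_coef G p c n u w" for u w
    by (rule word_coef_cong) auto
  hence e2: "(\<lambda>u w. tensor_coef G (word_par p n) p (word_coef G p c n) c (restrict u {..<n}, u n) (restrict w {..<n}, w n))
      = word_coef G p c (Suc n)"
    by (simp add: fun_eq_iff tensor_coef_def word_par_restrict)
  show ?case
    using comod_reindex[OF comod_tensor[OF Suc.IH c] words_Suc_bij] unfolding e1 e2 .
qed

text \<open>For neighbouring factors at the end of a word this is supercommutativity of the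
coordinate ring; later letters do not see the exchange, as it preserves the parity of the
prefix.\<close>

lemma word_coef_adj:
  assumes c: "comod G I p c" and "Suc m < n"
    and "\<And>i. i < n \<Longrightarrow> u i \<in> I" "\<And>i. i < n \<Longrightarrow> w i \<in> I"
  shows "smul (ksign (p (w m) \<and> p (w (Suc m)))) (word_coef G p c n (u \<circ> adj m) (w \<circ> adj m)) =
    smul (ksign (p (u m) \<and> p (u (Suc m)))) (word_coef G p c n u w)"
  using assms(2-)
proof (induction n)
  case (Suc n)
  show ?case
  proof (cases "n = Suc m")
    case True
    have e: "word_coef G p c m (u \<circ> adj m) (w \<circ> adj m) = word_coef G p c m u w"
      "word_par p m (u \<circ> adj m) = word_par p m u" "word_par p m (w \<circ> adj m) = word_par p m w"
      by (auto intro!: word_coef_cong word_par_cong)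
    have h: "homog G (p (u m) \<noteq> p (w m)) (c (u m) (w m))"
      "homog G (p (u (Suc m)) \<noteq> p (w (Suc m))) (c (u (Suc m)) (w (Suc m)))"
      by (intro comodD(2)[OF c] Suc.prems; simp add: True)+
    show ?thesis
      unfolding True word_coef.simps word_par.simps e
      unfolding o_apply transpose_apply_first transpose_apply_second
        hprod_simps hprod_assoc hprod_comm[OF h] smul_simps
      by (cases "p (u m)"; cases "p (w m)"; cases "p (u (Suc m))"; cases "p (w (Suc m))";
          cases "word_par p m u"; cases "word_par p m w") simp_all
  next
    case False
    hence m: "Suc m < n" using Suc.prems by auto
    have "adj m permutes {..<n}" using m by (auto intro!: permutes_swap_id)
    hence e: "word_par p n (u \<circ> adj m) = word_par p n u" "word_par p n (w \<circ> adj m) = word_par p n w"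
      by (rule word_par_permute)+
    have n: "adj m n = n" using m by (auto simp: Transposition.transpose_def)
    have IH: "smul (ksign (p (w m) \<and> p (w (Suc m)))) (word_coef G p c n (u \<circ> adj m) (w \<circ> adj m)) =
      smul (ksign (p (u m) \<and> p (u (Suc m)))) (word_coef G p c n u w)"
      by (rule Suc.IH) (use m Suc.prems in auto)
    define s where "s = (ksign ((word_par p n u \<noteq> word_par p n w) \<and> p (u n)) :: 'k)"
    have "smul (ksign (p (w m) \<and> p (w (Suc m)))) (word_coef G p c (Suc n) (u \<circ> adj m) (w \<circ> adj m)) =
      smul s (smul (ksign (p (w m) \<and> p (w (Suc m)))) (word_coef G p c n (u \<circ> adj m) (w \<circ> adj m)) \<star> c (u n) (w n))"
      by (simp add: e n s_def hprod_simps mult.commute)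
    also have "\<dots> = smul (ksign (p (u m) \<and> p (u (Suc m)))) (word_coef G p c (Suc n) u w)"
      unfolding IH by (simp add: s_def hprod_simps mult.commute)
    finally show ?thesis .
  qed
qed simp

text \<open>By the cocycle rule the permutations for which this equivariance holds are closed under
composition, so the adjacent transpositions suffice.\<close>

lemma word_coef_permute:
  assumes c: "comod G I p c" and "\<sigma> permutes {..<n}"
    and "u \<in> words n I" "w \<in> words n I"
  shows "smul (koszul n \<sigma> (p \<circ> w)) (word_coef G p c n (u \<circ> \<sigma>) (w \<circ> \<sigma>)) =
    smul (koszul n \<sigma> (p \<circ> u)) (word_coef G p c n u w)"
  using assms(2-)
proof (induction arbitrary: u w rule: adjacent_transposition_induct)
  case (adj m)
  have k: "koszul n (adj m) (p \<circ> v) = (ksign (p (v m) \<and> p (v (Suc m))) :: 'k)" for v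
    by (simp add: koszul_adj[OF adj(1)])
  have "u i \<in> I" "w i \<in> I" if "i < n" for i
    using PiE_mem[OF adj(2)] PiE_mem[OF adj(3)] that by simp_all
  thus ?case unfolding k by (rule word_coef_adj[OF c adj(1)])
next
  case (comp \<sigma> \<tau>)
  have p: "u \<circ> \<sigma> \<in> words n I" "w \<circ> \<sigma> \<in> words n I" by (rule words_permute[OF comp.hyps(1)], rule comp.prems)+
  have "smul (koszul n (\<sigma> \<circ> \<tau>) (p \<circ> w)) (word_coef G p c n (u \<circ> (\<sigma> \<circ> \<tau>)) (w \<circ> (\<sigma> \<circ> \<tau>))) =
    smul (koszul n \<sigma> (p \<circ> w)) (smul (koszul n \<tau> (p \<circ> (w \<circ> \<sigma>))) (word_coef G p c n (u \<circ> \<sigma> \<circ> \<tau>) (w \<circ> \<sigma> \<circ> \<tau>)))"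
    by (simp only: koszul_comp[OF comp.hyps(1,2)] smul_simps(4) o_assoc)
  also have "\<dots> = smul (koszul n \<tau> (p \<circ> (u \<circ> \<sigma>))) (smul (koszul n \<sigma> (p \<circ> w)) (word_coef G p c n (u \<circ> \<sigma>) (w \<circ> \<sigma>)))"
    unfolding comp.IH(2)[OF p] smul_simps(4) by (simp only: mult.commute)
  also have "\<dots> = smul (koszul n (\<sigma> \<circ> \<tau>) (p \<circ> u)) (word_coef G p c n u w)"
    unfolding comp.IH(1)[OF comp.prems] by (simp only: koszul_comp[OF comp.hyps(1,2)] smul_simps(4) o_assoc mult.commute)
  finally show ?case .
qed simp

end

section \<open>A Young symmetrizer of square shape\<close>

text \<open>The element \<open>\<Sum>r. \<chi>(r) r\<close> of the group algebra acting on words, where the sum is over \<open>R\<close>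
and \<open>\<chi>\<close> is the sign character if \<open>t\<close> holds and the trivial character otherwise: \<open>koszul n r (\<lambda>_. t)\<close> is
the sign for a word with all letters of parity \<open>t\<close>. Words whose letters all have parity \<open>t\<close> are
thus symmetrized without signs.\<close>

definition signed_symm :: "nat \<Rightarrow> (nat \<Rightarrow> nat) set \<Rightarrow> bool \<Rightarrow> ('a \<Rightarrow> bool) \<Rightarrow>
    (nat \<Rightarrow> 'a) \<Rightarrow> (nat \<Rightarrow> 'a) \<Rightarrow> 'k::comm_ring_1" where
  "signed_symm n R t p u w =
     (\<Sum>r\<in>R. if u = w \<circ> r then koszul n r (\<lambda>_. t) * koszul n r (p \<circ> w) else 0)"

lemma finite_perms: "R \<subseteq> {\<sigma>. \<sigma> permutes {..<n::nat}} \<Longrightarrow> finite R"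
  using finite_permutations[of "{..<n}"] finite_subset by blast

text \<open>Covers two situations: \<open>f\<close> may be a coefficient of the tensor power of a comodule,
which gives equivariance, or a tensor power of an even matrix, which gives naturality under even
linear maps between different spaces.\<close>

lemma signed_symm_intertwine:
  fixes f :: "(nat \<Rightarrow> 'a) \<Rightarrow> (nat \<Rightarrow> 'b) \<Rightarrow> 'k::comm_ring_1"
  assumes fin: "finite I" "finite J" and R: "R \<subseteq> {\<sigma>. \<sigma> permutes {..<n}}"
    and f: "\<And>r v y. r \<in> R \<Longrightarrow> v \<in> words n I \<Longrightarrow> y \<in> words n J \<Longrightarrow>
      koszul n r (p \<circ> v) * f v y = koszul n r (q \<circ> y) * f (v \<circ> r) (y \<circ> r)"
    and u: "u \<in> words n I" and y: "y \<in> words n J"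
  shows "(\<Sum>w\<in>words n I. signed_symm n R t p u w * f w y) =
    (\<Sum>w\<in>words n J. f u w * signed_symm n R t q w y)"
proof -
  have fw: "finite (words n I)" "finite (words n J)" using fin by (auto intro!: finite_PiE)
  have "(\<Sum>w\<in>words n I. signed_symm n R t p u w * f w y) =
      (\<Sum>w\<in>words n I. \<Sum>r\<in>R. if u = w \<circ> r then koszul n r (\<lambda>_. t) * (koszul n r (p \<circ> w) * f w y) else 0)"
    unfolding signed_symm_def sum_distrib_right by (intro sum.cong refl) (simp add: mult.assoc)
  also have "\<dots> = (\<Sum>r\<in>R. \<Sum>w\<in>words n I. if u = w \<circ> r then koszul n r (\<lambda>_. t) * (koszul n r (p \<circ> w) * f w y) else 0)"
    by (rule sum.swap)
  also have "\<dots> = (\<Sum>r\<in>R. \<Sum>w\<in>words n J. if w = y \<circ> r then koszul n r (\<lambda>_. t) * (koszul n r (q \<circ> y) * f u w) else 0)"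
  proof (rule sum.cong[OF refl])
    fix r assume r: "r \<in> R"
    hence p: "r permutes {..<n}" using R by auto
    have eq: "u = w \<circ> r \<longleftrightarrow> w = u \<circ> inv_into UNIV r" for w
      using permutes_inverses[OF p] by (auto simp: fun_eq_iff)
    let ?v = "u \<circ> inv_into UNIV r"
    have v: "?v \<in> words n I" "?v \<circ> r = u" using words_permute_inv[OF p u] by auto
    have "(\<Sum>w\<in>words n I. if u = w \<circ> r then koszul n r (\<lambda>_. t) * (koszul n r (p \<circ> w) * f w y) else 0) =
        koszul n r (\<lambda>_. t) * (koszul n r (p \<circ> ?v) * f ?v y)"
      unfolding eq using v(1) fw by simp
    also have "\<dots> = koszul n r (\<lambda>_. t) * (koszul n r (q \<circ> y) * f u (y \<circ> r))"
      unfolding f[OF r v(1) y] v(2) ..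
    also have "\<dots> = (\<Sum>w\<in>words n J. if w = y \<circ> r then koszul n r (\<lambda>_. t) * (koszul n r (q \<circ> y) * f u w) else 0)"
      using words_permute[OF p y] fw by simp
    finally show "(\<Sum>w\<in>words n I. if u = w \<circ> r then koszul n r (\<lambda>_. t) * (koszul n r (p \<circ> w) * f w y) else 0) =
      (\<Sum>w\<in>words n J. if w = y \<circ> r then koszul n r (\<lambda>_. t) * (koszul n r (q \<circ> y) * f u w) else 0)" .
  qed
  also have "\<dots> = (\<Sum>w\<in>words n J. \<Sum>r\<in>R. if w = y \<circ> r then koszul n r (\<lambda>_. t) * (koszul n r (q \<circ> y) * f u w) else 0)"
    by (rule sum.swap)
  also have "\<dots> = (\<Sum>w\<in>words n J. f u w * signed_symm n R t q w y)"
    unfolding signed_symm_def sum_distrib_left by (intro sum.cong refl) (simp add: mult_ac)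
  finally show ?thesis .
qed

lemma signed_symm_even:
  assumes R: "R \<subseteq> {\<sigma>. \<sigma> permutes {..<n}}"
  shows "even_on W (word_par p n) W (word_par p n) (signed_symm n R t p)"
  unfolding even_on_def
proof (intro ballI impI)
  fix u w assume "signed_symm n R t p u w \<noteq> 0"
  then obtain r where r: "r \<in> R" "u = w \<circ> r"
    unfolding signed_symm_def by (auto elim!: sum.not_neutral_contains_not_neutral split: if_splits)
  hence "r permutes {..<n}" using R by auto
  thus "word_par p n u = word_par p n w" unfolding r(2) by (rule word_par_permute)
qed

definition word_mat :: "nat \<Rightarrow> ('a \<Rightarrow> 'b \<Rightarrow> 'k::comm_ring_1) \<Rightarrow> (nat \<Rightarrow> 'a) \<Rightarrow> (nat \<Rightarrow> 'b) \<Rightarrow> 'k" where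
  "word_mat n \<alpha> u w = (\<Prod>z<n. \<alpha> (u z) (w z))"

lemma signed_symm_word_mat:
  assumes fin: "finite I" "finite J" and R: "R \<subseteq> {\<sigma>. \<sigma> permutes {..<n}}"
    and ev: "even_on I p J q \<alpha>"
    and u: "u \<in> words n I" and y: "y \<in> words n J"
  shows "(\<Sum>w\<in>words n I. signed_symm n R t p u w * word_mat n \<alpha> w y) =
    (\<Sum>w\<in>words n J. word_mat n \<alpha> u w * signed_symm n R t q w y)"
proof (rule signed_symm_intertwine[OF fin R _ u y])
  fix r v y assume r: "r \<in> R" and v: "v \<in> words n I" and y: "y \<in> words n J"
  have p: "r permutes {..<n}" using r R by auto
  have e: "word_mat n \<alpha> (v \<circ> r) (y \<circ> r) = word_mat n \<alpha> v y"
    unfolding word_mat_def o_apply by (rule prod.permute[OF p, symmetric, unfolded o_def])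
  show "koszul n r (p \<circ> v) * word_mat n \<alpha> v y = koszul n r (q \<circ> y) * word_mat n \<alpha> (v \<circ> r) (y \<circ> r)"
  proof (cases "\<forall>z<n. \<alpha> (v z) (y z) \<noteq> 0")
    case True
    hence "koszul n r (p \<circ> v) = (koszul n r (q \<circ> y) :: 'c)"
      using ev v y by (intro koszul_cong[OF p]) (auto simp: even_on_def PiE_def Pi_def)
    thus ?thesis by (simp add: e)
  next
    case False
    hence "word_mat n \<alpha> v y = 0" unfolding word_mat_def by (intro prod_zero) auto
    thus ?thesis by (simp add: e)
  qed
qed

text \<open>Multiplication by \<open>\<tau>\<close> permutes the summands and changes their signs when \<open>\<tau>\<close> fixes the
word \<open>y\<close> and acts on it with sign \<open>-1\<close>, so the sum is its own negative. Depending on whether \<open>y\<close>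
is the argument or the value, \<open>\<tau>\<close> is multiplied from the left or from the right.\<close>

lemma signed_symm_kill_right:
  assumes R: "R \<subseteq> {\<sigma>. \<sigma> permutes {..<n}}" and \<tau>: "\<tau> \<in> R" "\<tau> \<circ> \<tau> = id"
    and closed: "\<And>r. r \<in> R \<Longrightarrow> \<tau> \<circ> r \<in> R"
    and y: "y \<circ> \<tau> = y" "koszul n \<tau> (\<lambda>_. t) * koszul n \<tau> (p \<circ> y) = (- 1 :: 'k::field_char_0)"
  shows "signed_symm n R t p u y = (0 :: 'k)"
proof -
  let ?g = "\<lambda>r. if u = y \<circ> r then koszul n r (\<lambda>_. t) * koszul n r (p \<circ> y) else (0 :: 'k)"
  have tt: "\<tau> \<circ> (\<tau> \<circ> r) = r" for r using \<tau>(2) by (metis comp_assoc id_comp)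
  have "sum ?g R = (\<Sum>r\<in>R. ?g (\<tau> \<circ> r))"
    by (rule sum.reindex_bij_witness[of _ "\<lambda>r. \<tau> \<circ> r" "\<lambda>r. \<tau> \<circ> r"]) (auto simp only: tt closed)
  also have "\<dots> = (\<Sum>r\<in>R. - ?g r)"
  proof (rule sum.cong[OF refl])
    fix r assume r: "r \<in> R"
    have p: "\<tau> permutes {..<n}" "r permutes {..<n}" using r \<tau> R by auto
    have e1: "y \<circ> (\<tau> \<circ> r) = y \<circ> r" using y(1) by (metis comp_assoc)
    have e2: "(p \<circ> y) \<circ> \<tau> = p \<circ> y" using y(1) by (metis comp_assoc)
    have e3: "(\<lambda>_. t) \<circ> \<tau> = (\<lambda>_. t)" by auto
    have "koszul n (\<tau> \<circ> r) (\<lambda>_. t) * koszul n (\<tau> \<circ> r) (p \<circ> y) =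
      (koszul n \<tau> (\<lambda>_. t) * koszul n \<tau> (p \<circ> y)) * (koszul n r (\<lambda>_. t) * koszul n r (p \<circ> y) :: 'k)"
      unfolding koszul_comp[OF p] e2 e3 by (simp only: mult_ac)
    thus "?g (\<tau> \<circ> r) = - ?g r" unfolding e1 y(2) by simp
  qed
  also have "\<dots> = - sum ?g R" by (rule sum_negf)
  finally have "sum ?g R = 0" by simp
  thus ?thesis by (simp add: signed_symm_def)
qed

lemma signed_symm_kill_left:
  assumes R: "R \<subseteq> {\<sigma>. \<sigma> permutes {..<n}}" and \<tau>: "\<tau> \<in> R" "\<tau> \<circ> \<tau> = id"
    and closed: "\<And>r. r \<in> R \<Longrightarrow> r \<circ> \<tau> \<in> R"
    and y: "y \<circ> \<tau> = y" "koszul n \<tau> (\<lambda>_. t) * koszul n \<tau> (p \<circ> y) = (- 1 :: 'k::field_char_0)"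
  shows "signed_symm n R t p y w = (0 :: 'k)"
proof -
  let ?g = "\<lambda>r. if y = w \<circ> r then koszul n r (\<lambda>_. t) * koszul n r (p \<circ> w) else (0 :: 'k)"
  have tt: "r \<circ> \<tau> \<circ> \<tau> = r" for r :: "nat \<Rightarrow> 'x" using \<tau>(2) by (metis comp_assoc comp_id)
  have "sum ?g R = (\<Sum>r\<in>R. ?g (r \<circ> \<tau>))"
    by (rule sum.reindex_bij_witness[of _ "\<lambda>r. r \<circ> \<tau>" "\<lambda>r. r \<circ> \<tau>"]) (auto simp only: tt closed)
  also have "\<dots> = (\<Sum>r\<in>R. - ?g r)"
  proof (rule sum.cong[OF refl])
    fix r assume r: "r \<in> R"
    have p: "\<tau> permutes {..<n}" "r permutes {..<n}" using r \<tau> R by auto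
    have e1: "y = w \<circ> (r \<circ> \<tau>) \<longleftrightarrow> y = w \<circ> r"
      using y(1) tt[of "w \<circ> r"] by (metis comp_assoc)
    have e3: "(\<lambda>_. t) \<circ> r = (\<lambda>_. t)" by auto
    show "?g (r \<circ> \<tau>) = - ?g r"
    proof (cases "y = w \<circ> r")
      case True
      hence e2: "(p \<circ> w) \<circ> r = p \<circ> y" by (simp add: comp_assoc)
      have "koszul n (r \<circ> \<tau>) (\<lambda>_. t) * koszul n (r \<circ> \<tau>) (p \<circ> w) =
        (koszul n \<tau> (\<lambda>_. t) * koszul n \<tau> (p \<circ> y)) * (koszul n r (\<lambda>_. t) * koszul n r (p \<circ> w) :: 'k)"
        unfolding koszul_comp[OF p(2,1)] e2 e3 by (simp only: mult_ac)
      thus ?thesis unfolding e1 y(2) by simp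
    qed (simp only: e1 if_False minus_zero)
  qed
  also have "\<dots> = - sum ?g R" by (rule sum_negf)
  finally have "sum ?g R = 0" by simp
  thus ?thesis by (simp add: signed_symm_def)
qed

text \<open>The cell in row \<open>i\<close> and column \<open>j\<close> of the square is the position \<open>i * s + j\<close>.\<close>

definition row_perms :: "nat \<Rightarrow> (nat \<Rightarrow> nat) set" where
  "row_perms s = {\<sigma>. \<sigma> permutes {..<s * s} \<and> (\<forall>z<s * s. \<sigma> z div s = z div s)}"

definition col_perms :: "nat \<Rightarrow> (nat \<Rightarrow> nat) set" where
  "col_perms s = {\<sigma>. \<sigma> permutes {..<s * s} \<and> (\<forall>z<s * s. \<sigma> z mod s = z mod s)}"

text \<open>The characters of the two factors are opposite. So letters of parity \<open>t\<close> are antisymmetrized along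
columns only, and letters of the other parity along rows only.\<close>

definition young :: "nat \<Rightarrow> bool \<Rightarrow> 'a set \<Rightarrow> ('a \<Rightarrow> bool) \<Rightarrow> (nat \<Rightarrow> 'a) \<Rightarrow> (nat \<Rightarrow> 'a) \<Rightarrow> 'k::comm_ring_1" where
  "young s t I p u w = (\<Sum>y\<in>words (s * s) I.
     signed_symm (s * s) (row_perms s) t p u y * signed_symm (s * s) (col_perms s) (\<not> t) p y w)"

lemma row_perms_sub: "row_perms s \<subseteq> {\<sigma>. \<sigma> permutes {..<s * s}}"
  and col_perms_sub: "col_perms s \<subseteq> {\<sigma>. \<sigma> permutes {..<s * s}}"
  unfolding row_perms_def col_perms_def by auto

text \<open>With fewer than \<open>s\<close> letters for \<open>s * s\<close> cells, some letter fills more than \<open>s\<close>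
cells, too many for different rows and too many for different columns.\<close>

lemma grid_pigeonhole:
  assumes "finite J" "card J < s" "y \<in> words (s * s) J"
  obtains z z' x x' where "z < s * s" "z' < s * s" "z \<noteq> z'" "z div s = z' div s"
    "x < s * s" "x' < s * s" "x \<noteq> x'" "x mod s = x' mod s" "y z = y z'" "y x = y x'" "y z = y x"
proof -
  let ?Z = "\<lambda>a. {z \<in> {..<s * s}. y z = a}"
  have s: "s > 0" using assms(2) by simp
  have "\<exists>a\<in>J. card (?Z a) > s"
  proof (rule ccontr)
    assume "\<not> ?thesis"
    hence le: "card (?Z a) \<le> s" if "a \<in> J" for a using that by (meson not_less)
    have "{..<s * s} = (\<Union>a\<in>J. ?Z a)" using assms(3) by auto
    hence "s * s \<le> (\<Sum>a\<in>J. card (?Z a))"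
      using card_UN_le[OF assms(1), of ?Z] by (metis card_lessThan)
    also have "\<dots> \<le> card J * s" using sum_bounded_above[of J "\<lambda>a. card (?Z a)" s] le by simp
    also have "\<dots> < s * s" using assms(2) s by simp
    finally show False by simp
  qed
  then obtain a where a: "card (?Z a) > s" by blast
  have pg: "\<not> inj_on f (?Z a)" if "f ` ?Z a \<subseteq> {..<s}" for f
    using card_inj_on_le[OF _ that] a by auto
  have "(\<lambda>z. z div s) ` ?Z a \<subseteq> {..<s}" by (auto simp: less_mult_imp_div_less)
  from pg[OF this] obtain z z' where z: "z \<in> ?Z a" "z' \<in> ?Z a" "z \<noteq> z'" "z div s = z' div s"
    unfolding inj_on_def by blast
  have "(\<lambda>z. z mod s) ` ?Z a \<subseteq> {..<s}" using s by auto
  from pg[OF this] obtain x x' where x: "x \<in> ?Z a" "x' \<in> ?Z a" "x \<noteq> x'" "x mod s = x' mod s"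
    unfolding inj_on_def by blast
  show ?thesis by (rule that[of z z' x x']) (use z x in auto)
qed

lemma transpose_word:
  assumes "y z = y z'"
  shows "y \<circ> Transposition.transpose z z' = y"
  using assms by (auto simp: fun_eq_iff Transposition.transpose_def)

text \<open>The symmetrizer factors over all fillings \<open>y\<close> of the square. In each of them some
letter is repeated in a row and in a column. If it has parity \<open>t\<close>, the repetition in the column kills
the column factor, otherwise the repetition in the row kills the row factor.\<close>

lemma young_eq_0:
  assumes "finite J" "card J < s"
  shows "young s t J p u w = (0 :: 'k::field_char_0)"
  unfolding young_def
proof (intro sum.neutral ballI)
  fix y assume y: "y \<in> words (s * s) J"
  obtain z z' x x' where zx: "z < s * s" "z' < s * s" "z \<noteq> z'" "z div s = z' div s"
    "x < s * s" "x' < s * s" "x \<noteq> x'" "x mod s = x' mod s" "y z = y z'" "y x = y x'" "y z = y x"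
    by (rule grid_pigeonhole[OF assms y])
  let ?\<tau> = "Transposition.transpose z z'" and ?\<rho> = "Transposition.transpose x x'"
  have \<tau>p: "?\<tau> permutes {..<s * s}" "?\<rho> permutes {..<s * s}"
    using zx by (auto intro!: permutes_swap_id)
  have \<tau>: "?\<tau> \<in> row_perms s"
    using \<tau>p(1) zx by (auto simp: row_perms_def Transposition.transpose_def)
  have \<rho>: "?\<rho> \<in> col_perms s"
    using \<tau>p(2) zx by (auto simp: col_perms_def Transposition.transpose_def)
  have cr: "?\<tau> \<circ> r \<in> row_perms s" if "r \<in> row_perms s" for r
  proof -
    have r: "r permutes {..<s * s}" "\<And>z. z < s * s \<Longrightarrow> r z div s = z div s"
      using that by (auto simp: row_perms_def)
    hence "r z < s * s" if "z < s * s" for z using permutes_in_image[OF r(1), of z] that by simp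
    thus ?thesis using \<tau> r permutes_compose[OF r(1) \<tau>p(1)] by (simp add: row_perms_def)
  qed
  have cc: "r \<circ> ?\<rho> \<in> col_perms s" if "r \<in> col_perms s" for r
  proof -
    have r: "r permutes {..<s * s}" "\<And>z. z < s * s \<Longrightarrow> r z mod s = z mod s"
      using that by (auto simp: col_perms_def)
    have "?\<rho> z < s * s" if "z < s * s" for z using permutes_in_image[OF \<tau>p(2), of z] that by simp
    thus ?thesis using \<rho> r permutes_compose[OF \<tau>p(2) r(1)] by (simp add: col_perms_def)
  qed
  have "signed_symm (s * s) (row_perms s) t p u y = (0 :: 'k)" if "p (y z) \<noteq> t"
  proof (rule signed_symm_kill_right[OF row_perms_sub \<tau> _ cr])
    show "koszul (s * s) ?\<tau> (\<lambda>_. t) * koszul (s * s) ?\<tau> (p \<circ> y) = (- 1 :: 'k)"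
      using that zx by (cases t) (simp_all add: koszul_transpose)
  qed (simp_all add: transpose_word zx)
  moreover have "signed_symm (s * s) (col_perms s) (\<not> t) p y w = (0 :: 'k)" if "p (y z) = t"
  proof (rule signed_symm_kill_left[OF col_perms_sub \<rho> _ cc])
    show "koszul (s * s) ?\<rho> (\<lambda>_. \<not> t) * koszul (s * s) ?\<rho> (p \<circ> y) = (- 1 :: 'k)"
      using that zx by (cases t) (simp_all add: koszul_transpose)
  qed (simp_all add: transpose_word zx)
  ultimately show "signed_symm (s * s) (row_perms s) t p u y *
      signed_symm (s * s) (col_perms s) (\<not> t) p y w = (0 :: 'k)" by auto
qed

text \<open>The witness has the letter \<open>v i\<close> throughout row \<open>i\<close>. Every row permutation fixes
it, and no column permutation does except the identity; all letters having parity \<open>t\<close>, the signs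
cancel and the diagonal entry counts the row permutations.\<close>

lemma young_nonzero:
  assumes fin: "finite I" and v: "inj_on v {..<s}" "\<And>i. i < s \<Longrightarrow> v i \<in> I" "\<And>i. i < s \<Longrightarrow> p (v i) = t"
  shows "\<exists>w\<in>words (s * s) I. young s t I p w w \<noteq> (0 :: 'k::field_char_0)"
proof -
  let ?n = "s * s"
  define w where "w = restrict (\<lambda>z. v (z div s)) {..<?n}"
  have row: "z div s < s" if "z < ?n" for z using that by (simp add: less_mult_imp_div_less)
  have w: "w \<in> words ?n I" using v(2) row by (auto simp: w_def)
  have fw: "finite (words ?n I)" using fin by (auto intro!: finite_PiE)
  have wr: "w \<circ> r = w" if "r \<in> row_perms s" for r
  proof
    fix z
    have r: "r permutes {..<?n}" "z < ?n \<Longrightarrow> r z div s = z div s" using that by (auto simp: row_perms_def)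
    have "r z < ?n \<longleftrightarrow> z < ?n" using permutes_in_image[OF r(1), of z] by simp
    thus "(w \<circ> r) z = w z" using r(2) by (auto simp: w_def)
  qed
  have wc: "c = id" if c: "c \<in> col_perms s" "w \<circ> c = w" for c
  proof
    fix z
    have cp: "c permutes {..<?n}" "z < ?n \<Longrightarrow> c z mod s = z mod s" using c(1) by (auto simp: col_perms_def)
    show "c z = id z"
    proof (cases "z < ?n")
      case True
      hence cz: "c z < ?n" using permutes_in_image[OF cp(1), of z] by simp
      have "v (c z div s) = v (z div s)" using fun_cong[OF c(2), of z] True cz by (simp add: w_def)
      hence "c z div s = z div s" using v(1) row[OF True] row[OF cz] by (auto dest: inj_onD)
      thus ?thesis using cp(2)[OF True] by (metis div_mult_mod_eq id_apply)
    next
      case False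
      thus ?thesis using cp(1) by (simp add: permutes_not_in)
    qed
  qed
  have idc: "id \<in> col_perms s" by (auto simp: col_perms_def permutes_id)
  have fc: "finite (col_perms s)" "finite (row_perms s)"
    using finite_perms[OF col_perms_sub] finite_perms[OF row_perms_sub] by auto
  have col: "signed_symm ?n (col_perms s) (\<not> t) p w w = (1 :: 'k)"
  proof -
    have "signed_symm ?n (col_perms s) (\<not> t) p w w = (\<Sum>c\<in>col_perms s. if c = id then 1 else (0 :: 'k))"
      unfolding signed_symm_def
    proof (rule sum.cong[OF refl])
      fix c assume "c \<in> col_perms s"
      thus "(if w = w \<circ> c then koszul ?n c (\<lambda>_. \<not> t) * koszul ?n c (p \<circ> w) else 0) =
          (if c = id then 1 else (0 :: 'k))"
        using wc[of c] by (cases "c = id") auto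
    qed
    thus ?thesis using idc fc by simp
  qed
  have rowy: "signed_symm ?n (row_perms s) t p w y =
      (if y = w then of_nat (card (row_perms s)) else (0 :: 'k))" for y
  proof -
    have "signed_symm ?n (row_perms s) t p w y = (\<Sum>r\<in>row_perms s. if y = w then 1 else (0 :: 'k))"
      unfolding signed_symm_def
    proof (rule sum.cong[OF refl])
      fix r assume r: "r \<in> row_perms s"
      hence rp: "r permutes {..<?n}" by (simp add: row_perms_def)
      have "w = y \<circ> r \<longleftrightarrow> y = w"
      proof
        assume e: "w = y \<circ> r"
        have "y \<circ> r = w \<circ> r" using e wr[OF r] by simp
        thus "y = w" using permutes_surj[OF rp] by (metis comp_assoc comp_id surj_iff)
      qed (simp add: wr[OF r])
      moreover have "koszul ?n r (p \<circ> w) = (koszul ?n r (\<lambda>_. t) :: 'k)"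
        by (rule koszul_cong[OF rp]) (simp add: w_def v(3) row)
      ultimately show "(if w = y \<circ> r then koszul ?n r (\<lambda>_. t) * koszul ?n r (p \<circ> y) else 0) =
          (if y = w then 1 else (0 :: 'k))"
        by (auto simp: koszul_sq[OF rp])
    qed
    thus ?thesis by simp
  qed
  have "young s t I p w w = (\<Sum>y\<in>words ?n I. if y = w then of_nat (card (row_perms s)) else (0 :: 'k))"
    unfolding young_def rowy by (rule sum.cong[OF refl]) (simp add: col)
  also have "\<dots> = of_nat (card (row_perms s))" using w fw by simp
  also have "\<dots> \<noteq> 0"
  proof -
    have "id \<in> row_perms s" by (auto simp: row_perms_def permutes_id)
    thus ?thesis using fc by auto
  qed
  finally show ?thesis using w by blast
qed

lemma young_even:
  "even_on W (word_par p (s * s)) W (word_par p (s * s)) (young s t I p :: _ \<Rightarrow> _ \<Rightarrow> 'k::comm_ring_1)"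
  unfolding even_on_def
proof (intro ballI impI)
  fix u w assume "young s t I p u w \<noteq> (0 :: 'k)"
  then obtain y where "signed_symm (s * s) (row_perms s) t p u y \<noteq> (0 :: 'k)"
      "signed_symm (s * s) (col_perms s) (\<not> t) p y w \<noteq> (0 :: 'k)"
    unfolding young_def by (auto elim!: sum.not_neutral_contains_not_neutral dest: mult_not_zero)
  thus "word_par p (s * s) u = word_par p (s * s) w"
    using signed_symm_even[OF row_perms_sub, of UNIV p s t, where 'b = 'k]
      signed_symm_even[OF col_perms_sub, of UNIV p s "\<not> t", where 'b = 'k] unfolding even_on_def by blast
qed

text \<open>The symmetrizer commutes with the tensor power of \<open>\<alpha>\<close>, and so moves to the smaller
space, where it vanishes.\<close>

lemma young_word_mat_eq_0:
  fixes \<alpha> :: "'a \<Rightarrow> 'b \<Rightarrow> 'k::field_char_0"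
  assumes fin: "finite I" "finite J" and J: "card J < s" and ev: "even_on I p J q \<alpha>"
    and u: "u \<in> words (s * s) I" and y: "y \<in> words (s * s) J"
  shows "(\<Sum>w\<in>words (s * s) I. young s t I p u w * word_mat (s * s) \<alpha> w y) = 0"
proof -
  let ?n = "s * s" let ?a = "\<lambda>p. signed_symm ?n (row_perms s) t p"
  let ?b = "\<lambda>p. signed_symm ?n (col_perms s) (\<not> t) p" let ?W = "words ?n I" let ?V = "words ?n J"
  have "(\<Sum>w\<in>?W. young s t I p u w * word_mat ?n \<alpha> w y) =
      (\<Sum>x\<in>?W. ?a p u x * (\<Sum>w\<in>?W. ?b p x w * word_mat ?n \<alpha> w y))"
    unfolding young_def sum_distrib_left sum_distrib_right
    by (subst sum.swap) (simp only: mult.assoc)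
  also have "\<dots> = (\<Sum>x\<in>?W. ?a p u x * (\<Sum>w\<in>?V. word_mat ?n \<alpha> x w * ?b q w y))"
    by (intro sum.cong refl arg_cong2[of _ _ _ _ "(*)"] signed_symm_word_mat[OF fin col_perms_sub ev _ y])
  also have "\<dots> = (\<Sum>w\<in>?V. (\<Sum>x\<in>?W. ?a p u x * word_mat ?n \<alpha> x w) * ?b q w y)"
    unfolding sum_distrib_left sum_distrib_right by (subst sum.swap) (simp only: mult.assoc)
  also have "\<dots> = (\<Sum>w\<in>?V. (\<Sum>x\<in>?V. word_mat ?n \<alpha> u x * ?a q x w) * ?b q w y)"
    by (intro sum.cong refl arg_cong2[of _ _ _ _ "(*)"] signed_symm_word_mat[OF fin row_perms_sub ev u])
  also have "\<dots> = (\<Sum>x\<in>?V. word_mat ?n \<alpha> u x * young s t J q x y)"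
    unfolding young_def sum_distrib_left sum_distrib_right by (subst sum.swap) (simp only: mult.assoc)
  finally show ?thesis by (simp add: young_eq_0[OF fin(2) J])
qed

lemma (in hopf) signed_symm_equivariant:
  assumes c: "comod G I p c" and R: "R \<subseteq> {\<sigma>. \<sigma> permutes {..<n}}"
  shows "equivariant (words n I) (words n I) (word_coef G p c n) (word_coef G p c n) (signed_symm n R t p)"
  unfolding equivariant_def
proof (intro ballI)
  fix u y assume u: "u \<in> words n I" and y: "y \<in> words n I"
  have fin: "finite I" by (rule comodD(1)[OF c])
  show "(\<Sum>w\<in>words n I. smul (signed_symm n R t p u w) (word_coef G p c n w y)) =
    (\<Sum>w\<in>words n I. smul (signed_symm n R t p w y) (word_coef G p c n u w))"
  proof (rule poly_mapping_eqI)
    fix l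
    have "(\<Sum>w\<in>words n I. signed_symm n R t p u w * Poly_Mapping.lookup (word_coef G p c n w y) l) =
      (\<Sum>w\<in>words n I. Poly_Mapping.lookup (word_coef G p c n u w) l * signed_symm n R t p w y)"
    proof (rule signed_symm_intertwine[OF fin fin R _ u y])
      fix r v y assume "r \<in> R" and v: "v \<in> words n I" and y: "y \<in> words n I"
      hence "r permutes {..<n}" using R by auto
      from word_coef_permute[OF c this v y]
      show "koszul n r (p \<circ> v) * Poly_Mapping.lookup (word_coef G p c n v y) l =
        koszul n r (p \<circ> y) * Poly_Mapping.lookup (word_coef G p c n (v \<circ> r) (y \<circ> r)) l"
        by (metis lookup_smul)
    qed
    thus "Poly_Mapping.lookup (\<Sum>w\<in>words n I. smul (signed_symm n R t p u w) (word_coef G p c n w y)) l =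
      Poly_Mapping.lookup (\<Sum>w\<in>words n I. smul (signed_symm n R t p w y) (word_coef G p c n u w)) l"
      by (simp add: lookup_sum' mult.commute)
  qed
qed

lemma equivariant_comp:
  assumes A: "equivariant J K d e A" and B: "equivariant I J c d B"
  shows "equivariant I K c e (\<lambda>k i. \<Sum>j\<in>J. A k j * B j i)"
  unfolding equivariant_def
proof (intro ballI)
  fix l j assume l: "l \<in> K" and j: "j \<in> I"
  have "(\<Sum>i\<in>I. smul (\<Sum>m\<in>J. A l m * B m i) (c i j)) = (\<Sum>m\<in>J. smul (A l m) (\<Sum>i\<in>I. smul (B m i) (c i j)))"
    unfolding smul_sum_left smul_sum smul_simps by (rule sum.swap)
  also have "\<dots> = (\<Sum>m\<in>J. smul (A l m) (\<Sum>i\<in>J. smul (B i j) (d m i)))"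
    using B j unfolding equivariant_def by (intro sum.cong refl) simp
  also have "\<dots> = (\<Sum>i\<in>J. smul (B i j) (\<Sum>m\<in>J. smul (A l m) (d m i)))"
    unfolding smul_sum smul_simps by (subst sum.swap) (simp only: mult.commute)
  also have "\<dots> = (\<Sum>i\<in>J. smul (B i j) (\<Sum>m\<in>K. smul (A m i) (e l m)))"
    using A l unfolding equivariant_def by (intro sum.cong refl) simp
  also have "\<dots> = (\<Sum>m\<in>K. smul (\<Sum>i\<in>J. A m i * B i j) (e l m))"
    unfolding smul_sum_left smul_sum smul_simps by (subst sum.swap) (simp only: mult.commute)
  finally show "(\<Sum>i\<in>I. smul (\<Sum>m\<in>J. A l m * B m i) (c i j)) = (\<Sum>i\<in>K. smul (\<Sum>m\<in>J. A i m * B m j) (e l i))" .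
qed

lemma (in hopf) young_equivariant:
  assumes "comod G I p c"
  shows "equivariant (words (s * s) I) (words (s * s) I) (word_coef G p c (s * s)) (word_coef G p c (s * s)) (young s t I p)"
  unfolding young_def
  by (rule equivariant_comp[OF signed_symm_equivariant[OF assms row_perms_sub] signed_symm_equivariant[OF assms col_perms_sub]])

section \<open>Partial supertraces\<close>

definition strace :: "'a set \<Rightarrow> ('a \<Rightarrow> bool) \<Rightarrow> ('a \<Rightarrow> 'a \<Rightarrow> 'k::comm_ring_1) \<Rightarrow> 'k" where
  "strace I p g = (\<Sum>i\<in>I. ksign (p i) * g i i)"

definition mcomp :: "'b set \<Rightarrow> ('a \<Rightarrow> 'b \<Rightarrow> 'k::comm_ring_1) \<Rightarrow> ('b \<Rightarrow> 'c \<Rightarrow> 'k) \<Rightarrow> 'a \<Rightarrow> 'c \<Rightarrow> 'k" where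
  "mcomp J A B i k = (\<Sum>j\<in>J. A i j * B j k)"

definition endo :: "'a set \<Rightarrow> ('a \<Rightarrow> bool) \<Rightarrow> ('a \<Rightarrow> 'a \<Rightarrow> 'k::comm_ring_1) \<Rightarrow> ('a \<Rightarrow> 'a \<Rightarrow> 'k) \<Rightarrow> bool" where
  "endo I p X g \<longleftrightarrow> even_on I p I p g \<and> commutes I I X X g"

text \<open>The endomorphism \<open>1 - \<nu>\<close> is negligible. For a projection \<open>\<nu>\<close> this says that the complementary summand
is zero in the semisimplification; stated in this way, the notion passes to tensor products.\<close>

definition carries_strace :: "'a set \<Rightarrow> ('a \<Rightarrow> bool) \<Rightarrow> ('a \<Rightarrow> 'a \<Rightarrow> 'k::comm_ring_1) \<Rightarrow> ('a \<Rightarrow> 'a \<Rightarrow> 'k) \<Rightarrow> bool" where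
  "carries_strace I p X \<nu> \<longleftrightarrow> endo I p X \<nu> \<and>
     (\<forall>g. endo I p X g \<longrightarrow> strace I p g = strace I p (mcomp I g \<nu>))"

lemma mcomp_assoc: "mcomp J (mcomp I A B) C i l = mcomp I A (mcomp J B C) i l"
  unfolding mcomp_def sum_distrib_left sum_distrib_right
  by (subst sum.swap) (simp only: mult.assoc)

lemma mcomp_cong:
  "(\<And>j. j \<in> J \<Longrightarrow> A i j = A' i j) \<Longrightarrow> (\<And>j. j \<in> J \<Longrightarrow> B j k = B' j k) \<Longrightarrow> mcomp J A B i k = mcomp J A' B' i k"
  unfolding mcomp_def by (rule sum.cong) auto

lemma commutes_mcomp:
  "commutes I J X Y E \<longleftrightarrow> (\<forall>l\<in>J. \<forall>j\<in>I. mcomp I E X l j = mcomp J Y E l j)"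
  unfolding commutes_def mcomp_def ..

lemma commutes_comp:
  assumes B: "commutes I J X Y B" and A: "commutes J K Y Z A"
  shows "commutes I K X Z (mcomp J A B)"
  unfolding commutes_mcomp
proof (intro ballI)
  fix l j assume l: "l \<in> K" and j: "j \<in> I"
  have "mcomp I (mcomp J A B) X l j = mcomp J A (mcomp I B X) l j" by (rule mcomp_assoc)
  also have "\<dots> = mcomp J A (mcomp J Y B) l j"
    using B j unfolding commutes_mcomp by (intro mcomp_cong) auto
  also have "\<dots> = mcomp J (mcomp J A Y) B l j" by (rule mcomp_assoc[symmetric])
  also have "\<dots> = mcomp J (mcomp K Z A) B l j"
    using A l unfolding commutes_mcomp by (intro mcomp_cong) auto
  also have "\<dots> = mcomp K Z (mcomp J A B) l j" by (rule mcomp_assoc)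
  finally show "mcomp I (mcomp J A B) X l j = mcomp K Z (mcomp J A B) l j" .
qed

lemma even_comp:
  assumes "even_on I p J q A" "even_on J q K r B"
  shows "even_on I p K r (mcomp J A B :: _ \<Rightarrow> _ \<Rightarrow> 'k::comm_ring_1)"
  unfolding even_on_def mcomp_def
proof (intro ballI impI)
  fix i k assume i: "i \<in> I" "k \<in> K" and "(\<Sum>j\<in>J. A i j * B j k) \<noteq> 0"
  then obtain j where "j \<in> J" "A i j * B j k \<noteq> 0" by (auto elim: sum.not_neutral_contains_not_neutral)
  hence "j \<in> J" "A i j \<noteq> 0" "B j k \<noteq> 0" by (auto dest: mult_not_zero)
  thus "p i = r k" using assms i unfolding even_on_def by metis
qed

lemma endo_comp: "endo I p X A \<Longrightarrow> endo I p X B \<Longrightarrow> endo I p X (mcomp I A B)"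
  unfolding endo_def by (auto intro: even_comp commutes_comp)

lemma carries_strace_reindex:
  fixes X :: "'a \<Rightarrow> 'a \<Rightarrow> 'k::comm_ring_1"
  assumes C: "carries_strace I p X \<nu>" and f: "bij_betw f J I"
  shows "carries_strace J (\<lambda>j. p (f j)) (\<lambda>i j. X (f i) (f j)) (\<lambda>i j. \<nu> (f i) (f j))"
proof -
  define h where "h = inv_into J f"
  have fJ: "f j \<in> I" if "j \<in> J" for j using f that by (auto dest: bij_betwE)
  have hI: "h i \<in> J" "f (h i) = i" if "i \<in> I" for i
    using f that unfolding h_def
    by (metis bij_betw_def inv_into_into, metis bij_betw_inv_into_right)
  have hf: "h (f j) = j" if "j \<in> J" for j using f that unfolding h_def by (rule bij_betw_inv_into_left)
  have sm: "(\<Sum>i\<in>I. F i) = (\<Sum>j\<in>J. F (f j))" for F :: "_ \<Rightarrow> 'k"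
    by (rule sum.reindex_bij_betw[OF f, symmetric])
  have "endo J (\<lambda>j. p (f j)) (\<lambda>i j. X (f i) (f j)) (\<lambda>i j. \<nu> (f i) (f j))"
    using C fJ unfolding carries_strace_def endo_def even_on_def commutes_def by (simp add: sm)
  moreover have "strace J (\<lambda>j. p (f j)) g = strace J (\<lambda>j. p (f j)) (mcomp J g (\<lambda>i j. \<nu> (f i) (f j)))"
    if g: "endo J (\<lambda>j. p (f j)) (\<lambda>i j. X (f i) (f j)) g" for g
  proof -
    let ?g = "\<lambda>i j. g (h i) (h j)"
    have "(\<Sum>m\<in>J. ?g l (f m) * X (f m) j) = (\<Sum>m\<in>J. X l (f m) * ?g (f m) j)"
      if lj: "l \<in> I" "j \<in> I" for l j
    proof -
      have "(\<Sum>m\<in>J. g (h l) m * X (f m) (f (h j))) = (\<Sum>m\<in>J. X (f (h l)) (f m) * g m (h j))"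
        using g lj hI unfolding endo_def commutes_def by blast
      thus ?thesis using lj by (simp add: hI hf cong: sum.cong)
    qed
    moreover have "even_on I p I p ?g"
      using g hI unfolding endo_def even_on_def by metis
    ultimately have "endo I p X ?g" unfolding endo_def commutes_def by (simp add: sm)
    hence "strace I p ?g = strace I p (mcomp I ?g \<nu>)" using C unfolding carries_strace_def by blast
    thus ?thesis unfolding strace_def mcomp_def by (simp add: sm hf cong: sum.cong)
  qed
  ultimately show ?thesis unfolding carries_strace_def by blast
qed

lemma sum_times_delta:
  assumes "finite I" "j \<in> I"
  shows "(\<Sum>i\<in>I. f i * (if i = j then 1 else 0)) = (f j :: 'k::comm_ring_1)"
    "(\<Sum>i\<in>I. f i * (if j = i then 1 else 0)) = (f j :: 'k::comm_ring_1)"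
    "(\<Sum>i\<in>I. (if i = j then 1 else 0) * f i) = (f j :: 'k::comm_ring_1)"
    "(\<Sum>i\<in>I. (if j = i then 1 else 0) * f i) = (f j :: 'k::comm_ring_1)"
proof -
  have e: "f i * (if i = j then 1 else 0) = (if i = j then f i else 0)"
    "f i * (if j = i then 1 else 0) = (if i = j then f i else 0)"
    "(if i = j then 1 else 0) * f i = (if i = j then f i else 0)"
    "(if j = i then 1 else 0) * f i = (if i = j then f i else 0)" for i by auto
  show "(\<Sum>i\<in>I. f i * (if i = j then 1 else 0)) = f j"
    "(\<Sum>i\<in>I. f i * (if j = i then 1 else 0)) = f j"
    "(\<Sum>i\<in>I. (if i = j then 1 else 0) * f i) = f j"
    "(\<Sum>i\<in>I. (if j = i then 1 else 0) * f i) = f j"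
    unfolding e using assms by simp_all
qed

text \<open>The operator \<open>X \<otimes> 1 + 1 \<otimes> Y\<close>, where the odd operator \<open>Y\<close> is moved past a basis vector of parity
\<open>p i\<close>.\<close>

definition tensor_op :: "('a \<Rightarrow> bool) \<Rightarrow> ('a \<Rightarrow> 'a \<Rightarrow> 'k::comm_ring_1) \<Rightarrow> ('b \<Rightarrow> 'b \<Rightarrow> 'k) \<Rightarrow> 'a \<times> 'b \<Rightarrow> 'a \<times> 'b \<Rightarrow> 'k" where
  "tensor_op p X Y = (\<lambda>(i, a) (j, b). X i j * (if a = b then 1 else 0) +
     ksign (p i) * (if i = j then 1 else 0) * Y a b)"

lemma tensor_op_left:
  assumes "finite I" "finite J" "i \<in> I" "a \<in> J"
  shows "(\<Sum>w\<in>I \<times> J. tensor_op p X Y (i, a) w * g w) =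
    (\<Sum>i'\<in>I. X i i' * g (i', a)) + ksign (p i) * (\<Sum>a'\<in>J. Y a a' * g (i, a'))"
proof -
  have "(\<Sum>w\<in>I \<times> J. tensor_op p X Y (i, a) w * g w) = (\<Sum>i'\<in>I. \<Sum>a'\<in>J. tensor_op p X Y (i, a) (i', a') * g (i', a'))"
    by (simp add: sum.cartesian_product case_prod_beta')
  also have "\<dots> = (\<Sum>i'\<in>I. \<Sum>a'\<in>J. (X i i' * g (i', a')) * (if a = a' then 1 else 0)) +
      (\<Sum>i'\<in>I. (\<Sum>a'\<in>J. ksign (p i) * (Y a a' * g (i', a'))) * (if i = i' then 1 else 0))"
    unfolding sum_distrib_right sum.distrib[symmetric]
    by (intro sum.cong refl) (simp add: tensor_op_def algebra_simps)
  also have "\<dots> = (\<Sum>i'\<in>I. X i i' * g (i', a)) + ksign (p i) * (\<Sum>a'\<in>J. Y a a' * g (i, a'))"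
    by (simp only: sum_times_delta assms sum_distrib_left)
  finally show ?thesis .
qed

lemma tensor_op_right:
  assumes "finite I" "finite J" "j \<in> I" "b \<in> J"
  shows "(\<Sum>w\<in>I \<times> J. g w * tensor_op p X Y w (j, b)) =
    (\<Sum>i'\<in>I. g (i', b) * X i' j) + ksign (p j) * (\<Sum>a'\<in>J. g (j, a') * Y a' b)"
proof -
  have "(\<Sum>w\<in>I \<times> J. g w * tensor_op p X Y w (j, b)) = (\<Sum>i'\<in>I. \<Sum>a'\<in>J. g (i', a') * tensor_op p X Y (i', a') (j, b))"
    by (simp add: sum.cartesian_product case_prod_beta')
  also have "\<dots> = (\<Sum>i'\<in>I. \<Sum>a'\<in>J. (g (i', a') * X i' j) * (if a' = b then 1 else 0)) +
      (\<Sum>i'\<in>I. (\<Sum>a'\<in>J. ksign (p i') * (g (i', a') * Y a' b)) * (if i' = j then 1 else 0))"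
    unfolding sum_distrib_right sum.distrib[symmetric]
    by (intro sum.cong refl) (simp add: tensor_op_def algebra_simps)
  also have "\<dots> = (\<Sum>i'\<in>I. g (i', b) * X i' j) + ksign (p j) * (\<Sum>a'\<in>J. g (j, a') * Y a' b)"
    by (simp only: sum_times_delta assms sum_distrib_left)
  finally show ?thesis .
qed

lemma commutes_tensor_op_iff:
  assumes "finite I" "finite J"
  shows "commutes (I \<times> J) (I \<times> J) (tensor_op p X Y) (tensor_op p X Y) g \<longleftrightarrow>
    (\<forall>i\<in>I. \<forall>a\<in>J. \<forall>j\<in>I. \<forall>b\<in>J.
      (\<Sum>i'\<in>I. g (i, a) (i', b) * X i' j) + ksign (p j) * (\<Sum>a'\<in>J. g (i, a) (j, a') * Y a' b) =
      (\<Sum>i'\<in>I. X i i' * g (i', a) (j, b)) + ksign (p i) * (\<Sum>a'\<in>J. Y a a' * g (i, a') (j, b)))"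
proof -
  have "commutes (I \<times> J) (I \<times> J) (tensor_op p X Y) (tensor_op p X Y) g \<longleftrightarrow>
    (\<forall>i\<in>I. \<forall>a\<in>J. \<forall>j\<in>I. \<forall>b\<in>J.
      (\<Sum>w\<in>I \<times> J. g (i, a) w * tensor_op p X Y w (j, b)) = (\<Sum>w\<in>I \<times> J. tensor_op p X Y (i, a) w * g w (j, b)))"
    unfolding commutes_def by auto
  also have "\<dots> \<longleftrightarrow> (\<forall>i\<in>I. \<forall>a\<in>J. \<forall>j\<in>I. \<forall>b\<in>J.
      (\<Sum>i'\<in>I. g (i, a) (i', b) * X i' j) + ksign (p j) * (\<Sum>a'\<in>J. g (i, a) (j, a') * Y a' b) =
      (\<Sum>i'\<in>I. X i i' * g (i', a) (j, b)) + ksign (p i) * (\<Sum>a'\<in>J. Y a a' * g (i, a') (j, b)))"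
    by (intro ball_cong refl) (simp only: tensor_op_left tensor_op_right assms)
  finally show ?thesis .
qed

lemma endo_tensor:
  assumes fin: "finite I" "finite J" and \<nu>: "endo I p X \<nu>" and \<mu>: "endo J q Y \<mu>"
  shows "endo (I \<times> J) (tensor_par p q) (tensor_op p X Y) (\<lambda>(i, a) (j, b). \<nu> i j * \<mu> a b)"
  unfolding endo_def commutes_tensor_op_iff[OF fin]
proof (intro conjI ballI)
  show "even_on (I \<times> J) (tensor_par p q) (I \<times> J) (tensor_par p q) (\<lambda>(i, a) (j, b). \<nu> i j * \<mu> a b)"
    using \<nu> \<mu> unfolding endo_def even_on_def tensor_par_def by (auto dest!: mult_not_zero; blast)
  fix i a j b assume s: "i \<in> I" "a \<in> J" "j \<in> I" "b \<in> J"
  have 1: "(\<Sum>i'\<in>I. \<nu> i i' * X i' j) = (\<Sum>i'\<in>I. X i i' * \<nu> i' j)"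
    "(\<Sum>a'\<in>J. \<mu> a a' * Y a' b) = (\<Sum>a'\<in>J. Y a a' * \<mu> a' b)"
    using \<nu> \<mu> s unfolding endo_def commutes_def by auto
  have 2: "ksign (p j) * \<nu> i j = ksign (p i) * \<nu> i j"
    using \<nu> s unfolding endo_def even_on_def by (cases "\<nu> i j = 0") auto
  have "(\<Sum>i'\<in>I. \<nu> i i' * \<mu> a b * X i' j) + ksign (p j) * (\<Sum>a'\<in>J. \<nu> i j * \<mu> a a' * Y a' b) =
      (\<Sum>i'\<in>I. \<nu> i i' * X i' j) * \<mu> a b + ksign (p j) * \<nu> i j * (\<Sum>a'\<in>J. \<mu> a a' * Y a' b)"
    by (simp add: sum_distrib_left sum_distrib_right mult_ac)
  also have "\<dots> = (\<Sum>i'\<in>I. X i i' * (\<nu> i' j * \<mu> a b)) + ksign (p i) * (\<Sum>a'\<in>J. Y a a' * (\<nu> i j * \<mu> a' b))"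
    unfolding 1 2 by (simp add: sum_distrib_left sum_distrib_right mult_ac)
  finally show "(\<Sum>i'\<in>I. (case (i, a) of (i, a) \<Rightarrow> \<lambda>(j, b). \<nu> i j * \<mu> a b) (i', b) * X i' j) +
      ksign (p j) * (\<Sum>a'\<in>J. (case (i, a) of (i, a) \<Rightarrow> \<lambda>(j, b). \<nu> i j * \<mu> a b) (j, a') * Y a' b) =
    (\<Sum>i'\<in>I. X i i' * (case (i', a) of (i, a) \<Rightarrow> \<lambda>(j, b). \<nu> i j * \<mu> a b) (j, b)) +
      ksign (p i) * (\<Sum>a'\<in>J. Y a a' * (case (i, a') of (i, a) \<Rightarrow> \<lambda>(j, b). \<nu> i j * \<mu> a b) (j, b))"
    by simp
qed

lemma endo_id:
  assumes "finite I"
  shows "endo I p X (\<lambda>i j. if i = j then 1 else 0)"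
  unfolding endo_def even_on_def commutes_def by (auto simp: sum_times_delta[OF assms])

text \<open>Summing the commutation relation over the diagonal of the second factor, with the
weights of the supertrace, cancels the terms with \<open>Y\<close>.\<close>

lemma partial_strace_right:
  assumes fin: "finite I" "finite J" and Y: "odd_on J q Y"
    and g: "endo (I \<times> J) (tensor_par p q) (tensor_op p X Y) g"
  shows "endo I p X (\<lambda>i j. \<Sum>a\<in>J. ksign (q a) * g (i, a) (j, a))"
  unfolding endo_def
proof
  have ev: "tensor_par p q u = tensor_par p q v" if "g u v \<noteq> 0" "u \<in> I \<times> J" "v \<in> I \<times> J" for u v
    using g that unfolding endo_def even_on_def by blast
  show "even_on I p I p (\<lambda>i j. \<Sum>a\<in>J. ksign (q a) * g (i, a) (j, a))"
    unfolding even_on_def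
  proof (intro ballI impI)
    fix i j assume ij: "i \<in> I" "j \<in> I" "(\<Sum>a\<in>J. ksign (q a) * g (i, a) (j, a)) \<noteq> 0"
    then obtain a where "a \<in> J" "ksign (q a) * g (i, a) (j, a) \<noteq> 0"
      by (auto elim: sum.not_neutral_contains_not_neutral)
    thus "p i = p j" using ev[of "(i, a)" "(j, a)"] ij by (auto simp: tensor_par_def dest: mult_not_zero)
  qed
  show "commutes I I X X (\<lambda>i j. \<Sum>a\<in>J. ksign (q a) * g (i, a) (j, a))"
    unfolding commutes_def
  proof (intro ballI)
    fix i j assume ij: "i \<in> I" "j \<in> I"
    have c: "(\<Sum>i'\<in>I. g (i, a) (i', b) * X i' j) + ksign (p j) * (\<Sum>a'\<in>J. g (i, a) (j, a') * Y a' b) =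
      (\<Sum>i'\<in>I. X i i' * g (i', a) (j, b)) + ksign (p i) * (\<Sum>a'\<in>J. Y a a' * g (i, a') (j, b))"
      if "a \<in> J" "b \<in> J" for a b
      using g ij that unfolding endo_def commutes_tensor_op_iff[OF fin] by blast
    define S where "S = (\<Sum>a\<in>J. \<Sum>a'\<in>J. ksign (q a) * ksign (p j) * (g (i, a) (j, a') * Y a' a))"
    define S' where "S' = (\<Sum>a\<in>J. \<Sum>a'\<in>J. ksign (q a) * ksign (p i) * (Y a a' * g (i, a') (j, a)))"
    \<comment> \<open>Where a summand is nonzero, \<open>Y\<close> changes the parity in the second factor, and so the even map
      \<open>g\<close> changes it in the first; the two sign changes compensate.\<close>
    have SS: "S = S'"
    proof -
      have "S = (\<Sum>a\<in>J. \<Sum>a'\<in>J. ksign (q a') * ksign (p i) * (Y a' a * g (i, a) (j, a')))"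
        unfolding S_def
      proof (intro sum.cong refl)
        fix a a' assume a: "a \<in> J" "a' \<in> J"
        show "ksign (q a) * ksign (p j) * (g (i, a) (j, a') * Y a' a) =
          ksign (q a') * ksign (p i) * (Y a' a * g (i, a) (j, a'))"
        proof (cases "g (i, a) (j, a') = 0 \<or> Y a' a = 0")
          case False
          hence "(p i \<noteq> q a) = (p j \<noteq> q a')" "q a' \<noteq> q a"
            using ev[of "(i, a)" "(j, a')"] Y ij a by (auto simp: tensor_par_def odd_on_def)
          thus ?thesis by (cases "p i"; cases "p j"; cases "q a"; cases "q a'") (auto simp: mult.commute)
        qed auto
      qed
      also have "\<dots> = S'" unfolding S'_def by (rule sum.swap)
      finally show ?thesis .
    qed
    have "(\<Sum>i'\<in>I. (\<Sum>a\<in>J. ksign (q a) * g (i, a) (i', a)) * X i' j) + S =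
      (\<Sum>a\<in>J. ksign (q a) * ((\<Sum>i'\<in>I. g (i, a) (i', a) * X i' j) + ksign (p j) * (\<Sum>a'\<in>J. g (i, a) (j, a') * Y a' a)))"
      unfolding S_def sum_distrib_left sum_distrib_right distrib_left sum.distrib
      by (subst sum.swap) (simp only: mult.assoc)
    also have "\<dots> = (\<Sum>a\<in>J. ksign (q a) * ((\<Sum>i'\<in>I. X i i' * g (i', a) (j, a)) + ksign (p i) * (\<Sum>a'\<in>J. Y a a' * g (i, a') (j, a))))"
      by (intro sum.cong refl) (simp only: c)
    also have "\<dots> = (\<Sum>i'\<in>I. X i i' * (\<Sum>a\<in>J. ksign (q a) * g (i', a) (j, a))) + S'"
      unfolding S'_def sum_distrib_left sum_distrib_right distrib_left sum.distrib
      by (subst (3) sum.swap) (simp add: mult_ac)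
    finally show "(\<Sum>i'\<in>I. (\<Sum>a\<in>J. ksign (q a) * g (i, a) (i', a)) * X i' j) =
        (\<Sum>i'\<in>I. X i i' * (\<Sum>a\<in>J. ksign (q a) * g (i', a) (j, a)))"
      using SS by simp
  qed
qed

text \<open>Here the relation is summed over the diagonal of the first factor without weights.
This cancels the terms with \<open>X\<close>, and the signs of the supertrace are already present in the terms with
\<open>Y\<close>.\<close>

lemma partial_strace_left:
  assumes fin: "finite I" "finite J"
    and g: "endo (I \<times> J) (tensor_par p q) (tensor_op p X Y) g"
  shows "endo J q Y (\<lambda>a b. \<Sum>i\<in>I. ksign (p i) * g (i, a) (i, b))"
  unfolding endo_def
proof
  have ev: "tensor_par p q u = tensor_par p q v" if "g u v \<noteq> 0" "u \<in> I \<times> J" "v \<in> I \<times> J" for u v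
    using g that unfolding endo_def even_on_def by blast
  show "even_on J q J q (\<lambda>a b. \<Sum>i\<in>I. ksign (p i) * g (i, a) (i, b))"
    unfolding even_on_def
  proof (intro ballI impI)
    fix a b assume ab: "a \<in> J" "b \<in> J" "(\<Sum>i\<in>I. ksign (p i) * g (i, a) (i, b)) \<noteq> 0"
    then obtain i where "i \<in> I" "ksign (p i) * g (i, a) (i, b) \<noteq> 0"
      by (auto elim: sum.not_neutral_contains_not_neutral)
    thus "q a = q b" using ev[of "(i, a)" "(i, b)"] ab by (auto simp: tensor_par_def dest: mult_not_zero)
  qed
  show "commutes J J Y Y (\<lambda>a b. \<Sum>i\<in>I. ksign (p i) * g (i, a) (i, b))"
    unfolding commutes_def
  proof (intro ballI)
    fix a b assume ab: "a \<in> J" "b \<in> J"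
    have c: "(\<Sum>i'\<in>I. g (i, a) (i', b) * X i' i) + ksign (p i) * (\<Sum>a'\<in>J. g (i, a) (i, a') * Y a' b) =
      (\<Sum>i'\<in>I. X i i' * g (i', a) (i, b)) + ksign (p i) * (\<Sum>a'\<in>J. Y a a' * g (i, a') (i, b))"
      if "i \<in> I" for i
      using g ab that unfolding endo_def commutes_tensor_op_iff[OF fin] by blast
    define S where "S = (\<Sum>i\<in>I. \<Sum>i'\<in>I. g (i, a) (i', b) * X i' i)"
    have S: "S = (\<Sum>i\<in>I. \<Sum>i'\<in>I. X i i' * g (i', a) (i, b))"
      unfolding S_def by (subst sum.swap) (simp only: mult.commute)
    have "S + (\<Sum>a'\<in>J. (\<Sum>i\<in>I. ksign (p i) * g (i, a) (i, a')) * Y a' b) =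
      (\<Sum>i\<in>I. (\<Sum>i'\<in>I. g (i, a) (i', b) * X i' i) + ksign (p i) * (\<Sum>a'\<in>J. g (i, a) (i, a') * Y a' b))"
      unfolding S_def sum_distrib_left sum_distrib_right sum.distrib
      by (subst (3) sum.swap) (simp only: mult.assoc)
    also have "\<dots> = (\<Sum>i\<in>I. (\<Sum>i'\<in>I. X i i' * g (i', a) (i, b)) + ksign (p i) * (\<Sum>a'\<in>J. Y a a' * g (i, a') (i, b)))"
      by (intro sum.cong refl) (rule c)
    also have "\<dots> = S + (\<Sum>a'\<in>J. Y a a' * (\<Sum>i\<in>I. ksign (p i) * g (i, a') (i, b)))"
      unfolding S sum_distrib_left sum_distrib_right sum.distrib
      by (subst (4) sum.swap) (simp only: mult_ac)
    finally show "(\<Sum>a'\<in>J. (\<Sum>i\<in>I. ksign (p i) * g (i, a) (i, a')) * Y a' b) =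
      (\<Sum>a'\<in>J. Y a a' * (\<Sum>i\<in>I. ksign (p i) * g (i, a') (i, b)))" by simp
  qed
qed

lemma ksign_neq: "ksign (a \<noteq> b) = (ksign a * ksign b :: 'k::comm_ring_1)"
  by (cases a; cases b; simp)

text \<open>Partial supertraces are endomorphisms of one factor, so \<open>\<nu>\<close> may be inserted in the first factor
and then \<open>\<mu>\<close> in the second.\<close>

lemma carries_strace_tensor:
  fixes X :: "'a \<Rightarrow> 'a \<Rightarrow> 'k::comm_ring_1"
  assumes fin: "finite I" "finite J" and Y: "odd_on J q Y"
    and \<nu>: "carries_strace I p X \<nu>" and \<mu>: "carries_strace J q Y \<mu>"
  shows "carries_strace (I \<times> J) (tensor_par p q) (tensor_op p X Y) (\<lambda>(i, a) (j, b). \<nu> i j * \<mu> a b)"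
  unfolding carries_strace_def
proof (intro conjI allI impI)
  have en: "endo I p X \<nu>" "endo J q Y \<mu>" using \<nu> \<mu> unfolding carries_strace_def by auto
  show "endo (I \<times> J) (tensor_par p q) (tensor_op p X Y) (\<lambda>(i, a) (j, b). \<nu> i j * \<mu> a b)"
    by (rule endo_tensor[OF fin en])
  fix g assume g: "endo (I \<times> J) (tensor_par p q) (tensor_op p X Y) g"
  define g' where "g' = mcomp (I \<times> J) g (\<lambda>(i, a) (j, b). \<nu> i j * (if a = b then 1 else 0))"
  have eg': "endo (I \<times> J) (tensor_par p q) (tensor_op p X Y) g'"
    unfolding g'_def by (rule endo_comp[OF g endo_tensor[OF fin en(1) endo_id[OF fin(2)]]])
  have g': "g' u (j, b) = (\<Sum>l\<in>I. g u (l, b) * \<nu> l j)" if "b \<in> J" for u j b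
  proof -
    have "g' u (j, b) = (\<Sum>l\<in>I. \<Sum>a\<in>J. (g u (l, a) * \<nu> l j) * (if a = b then 1 else 0))"
      unfolding g'_def mcomp_def by (simp add: sum.cartesian_product case_prod_beta' mult.assoc)
    thus ?thesis by (simp only: sum_times_delta fin that)
  qed
  have st: "strace (I \<times> J) (tensor_par p q) h = strace I p (\<lambda>i j. \<Sum>a\<in>J. ksign (q a) * h (i, a) (j, a))"
    "strace (I \<times> J) (tensor_par p q) h = strace J q (\<lambda>a b. \<Sum>i\<in>I. ksign (p i) * h (i, a) (i, b))" for h :: "_ \<Rightarrow> _ \<Rightarrow> 'k"
  proof -
    have "strace (I \<times> J) (tensor_par p q) h = (\<Sum>i\<in>I. \<Sum>a\<in>J. ksign (p i) * (ksign (q a) * h (i, a) (i, a)))"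
      unfolding strace_def by (simp add: sum.cartesian_product case_prod_beta' tensor_par_def ksign_neq[simplified] mult.assoc)
    thus "strace (I \<times> J) (tensor_par p q) h = strace I p (\<lambda>i j. \<Sum>a\<in>J. ksign (q a) * h (i, a) (j, a))"
      "strace (I \<times> J) (tensor_par p q) h = strace J q (\<lambda>a b. \<Sum>i\<in>I. ksign (p i) * h (i, a) (i, b))"
      unfolding strace_def sum_distrib_left by (simp_all add: mult.left_commute sum.swap[of _ J I])
  qed
  have "strace (I \<times> J) (tensor_par p q) g = strace I p (mcomp I (\<lambda>i j. \<Sum>a\<in>J. ksign (q a) * g (i, a) (j, a)) \<nu>)"
    unfolding st(1) using \<nu> partial_strace_right[OF fin Y g] unfolding carries_strace_def by blast
  also have "\<dots> = strace (I \<times> J) (tensor_par p q) g'"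
    unfolding st(1)
  proof (unfold strace_def, rule sum.cong[OF refl])
    fix i assume "i \<in> I"
    have "mcomp I (\<lambda>i j. \<Sum>a\<in>J. ksign (q a) * g (i, a) (j, a)) \<nu> i i = (\<Sum>a\<in>J. ksign (q a) * g' (i, a) (i, a))"
      unfolding mcomp_def sum_distrib_right
      by (subst sum.swap) (simp add: g' sum_distrib_left mult.assoc cong: sum.cong)
    thus "ksign (p i) * mcomp I (\<lambda>i j. \<Sum>a\<in>J. ksign (q a) * g (i, a) (j, a)) \<nu> i i =
        ksign (p i) * (\<Sum>a\<in>J. ksign (q a) * g' (i, a) (i, a))" by simp
  qed
  also have "\<dots> = strace J q (mcomp J (\<lambda>a b. \<Sum>i\<in>I. ksign (p i) * g' (i, a) (i, b)) \<mu>)"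
    unfolding st(2) using \<mu> partial_strace_left[OF fin eg'] unfolding carries_strace_def by blast
  also have "\<dots> = strace (I \<times> J) (tensor_par p q) (mcomp (I \<times> J) g (\<lambda>(i, a) (j, b). \<nu> i j * \<mu> a b))"
    unfolding st(2)
  proof (unfold strace_def, rule sum.cong[OF refl])
    fix a assume "a \<in> J"
    have "mcomp (I \<times> J) g (\<lambda>(i, a) (j, b). \<nu> i j * \<mu> a b) (i, a) (i, a) = (\<Sum>b\<in>J. g' (i, a) (i, b) * \<mu> b a)" for i
    proof -
      have "mcomp (I \<times> J) g (\<lambda>(i, a) (j, b). \<nu> i j * \<mu> a b) (i, a) (i, a) =
          (\<Sum>l\<in>I. \<Sum>b\<in>J. g (i, a) (l, b) * (\<nu> l i * \<mu> b a))"
        unfolding mcomp_def by (simp add: sum.cartesian_product case_prod_beta')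
      also have "\<dots> = (\<Sum>b\<in>J. g' (i, a) (i, b) * \<mu> b a)"
        by (subst sum.swap) (simp add: g' sum_distrib_right mult.assoc cong: sum.cong)
      finally show ?thesis .
    qed
    hence "mcomp J (\<lambda>a b. \<Sum>i\<in>I. ksign (p i) * g' (i, a) (i, b)) \<mu> a a =
        (\<Sum>i\<in>I. ksign (p i) * mcomp (I \<times> J) g (\<lambda>(i, a) (j, b). \<nu> i j * \<mu> a b) (i, a) (i, a))"
      unfolding mcomp_def[of J] sum_distrib_right sum_distrib_left
      by (subst sum.swap) (simp add: sum_distrib_left mult.assoc)
    thus "ksign (q a) * mcomp J (\<lambda>a b. \<Sum>i\<in>I. ksign (p i) * g' (i, a) (i, b)) \<mu> a a =
       ksign (q a) * (\<Sum>i\<in>I. ksign (p i) * mcomp (I \<times> J) g (\<lambda>(i, a) (j, b). \<nu> i j * \<mu> a b) (i, a) (i, a))"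
      by simp
  qed
  finally show "strace (I \<times> J) (tensor_par p q) g =
    strace (I \<times> J) (tensor_par p q) (mcomp (I \<times> J) g (\<lambda>(i, a) (j, b). \<nu> i j * \<mu> a b))" .
qed

section \<open>A nonzero negligible equivariant endomorphism\<close>

lemma carries_strace_cong:
  assumes "carries_strace I p X \<nu>"
    and "\<And>i. i \<in> I \<Longrightarrow> p i = p' i"
    and "\<And>i j. i \<in> I \<Longrightarrow> j \<in> I \<Longrightarrow> X i j = X' i j"
    and "\<And>i j. i \<in> I \<Longrightarrow> j \<in> I \<Longrightarrow> \<nu> i j = \<nu>' i j"
  shows "carries_strace I p' X' \<nu>'"
proof -
  have e: "endo I p X g \<longleftrightarrow> endo I p' X' g" for g
    unfolding endo_def even_on_def commutes_def using assms(2,3)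
    by (simp cong: ball_cong sum.cong)
  have "endo I p X \<nu> \<longleftrightarrow> endo I p X \<nu>'"
    unfolding endo_def even_on_def commutes_def using assms(4)
    by (simp cong: ball_cong sum.cong)
  moreover have "strace I p g = strace I p' g" for g :: "_ \<Rightarrow> _ \<Rightarrow> 'b"
    unfolding strace_def using assms(2) by (simp cong: sum.cong)
  moreover have "strace I p' (mcomp I g \<nu>) = strace I p' (mcomp I g \<nu>')" for g
    unfolding strace_def mcomp_def using assms(4) by (simp cong: sum.cong)
  ultimately show ?thesis using assms(1) unfolding carries_strace_def e by simp
qed

lemma (in hopf) carries_strace_words:
  assumes x: "x \<in> lie_odd G" and c: "comod G I p c"
    and \<nu>: "carries_strace I p (odd_action x p c) \<nu>"
  shows "carries_strace (words n I) (word_par p n) (odd_action x (word_par p n) (word_coef G p c n)) (word_mat n \<nu>)"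
proof (induction n)
  case 0
  have "words 0 I = {\<lambda>_. undefined}" by simp
  thus ?case
    by (simp add: carries_strace_def endo_def even_on_def commutes_def strace_def mcomp_def word_mat_def odd_action_def
        lie_odd_hone[OF x])
next
  case (Suc n)
  have fin: "finite (words n I)" "finite I"
    using comodD(1)[OF comod_words[OF c]] comodD(1)[OF c] by auto
  let ?f = "\<lambda>w. (restrict w {..<n}, w n)"
  have T: "carries_strace (words n I \<times> I) (tensor_par (word_par p n) p)
      (tensor_op (word_par p n) (odd_action x (word_par p n) (word_coef G p c n)) (odd_action x p c))
      (\<lambda>(i, a) (j, b). word_mat n \<nu> i j * \<nu> a b)"
    by (rule carries_strace_tensor[OF fin odd_action_odd[OF x c] Suc.IH \<nu>])
  show ?case
  proof (rule carries_strace_cong[OF carries_strace_reindex[OF T words_Suc_bij]])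
    fix u assume "u \<in> words (Suc n) I"
    show "tensor_par (word_par p n) p (?f u) = word_par p (Suc n) u" by (simp add: tensor_par_def word_par_restrict)
  next
    fix u w assume uw: "u \<in> words (Suc n) I" "w \<in> words (Suc n) I"
    have f: "restrict u {..<n} \<in> words n I" "restrict w {..<n} \<in> words n I" "u n \<in> I" "w n \<in> I"
      using uw by (auto simp: PiE_def Pi_def)
    have "word_coef G p c n (restrict u {..<n}) (restrict w {..<n}) = word_coef G p c n u w"
      by (rule word_coef_cong) auto
    hence "tensor_coef G (word_par p n) p (word_coef G p c n) c (?f u) (?f w) = word_coef G p c (Suc n) u w"
      by (simp add: tensor_coef_def word_par_restrict)
    moreover have "tensor_par (word_par p n) p (?f u) = word_par p (Suc n) u" by (simp add: tensor_par_def word_par_restrict)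
    ultimately have "odd_action x (tensor_par (word_par p n) p) (tensor_coef G (word_par p n) p (word_coef G p c n) c) (?f u) (?f w) =
        odd_action x (word_par p (Suc n)) (word_coef G p c (Suc n)) u w"
      unfolding odd_action_def by simp
    thus "tensor_op (word_par p n) (odd_action x (word_par p n) (word_coef G p c n)) (odd_action x p c) (?f u) (?f w) =
        odd_action x (word_par p (Suc n)) (word_coef G p c (Suc n)) u w"
      using odd_action_tensor[OF x comod_words[OF c] c f] by (simp add: tensor_op_def)
    have "word_mat n \<nu> (restrict u {..<n}) (restrict w {..<n}) = word_mat n \<nu> u w"
      unfolding word_mat_def by (rule prod.cong) auto
    thus "(case ?f u of (i, a) \<Rightarrow> \<lambda>(j, b). word_mat n \<nu> i j * \<nu> a b) (?f w) = word_mat (Suc n) \<nu> u w"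
      by (simp add: word_mat_def)
  qed
qed

lemma word_mat_factor:
  assumes "finite J" "\<And>i j. i \<in> I \<Longrightarrow> j \<in> I \<Longrightarrow> \<nu> i j = mcomp J \<alpha> \<beta> i j"
    and "u \<in> words n I" "w \<in> words n I"
  shows "word_mat n \<nu> u w = mcomp (words n J) (word_mat n \<alpha>) (word_mat n \<beta>) u w"
proof -
  have "word_mat n \<nu> u w = (\<Prod>z<n. \<Sum>b\<in>J. \<alpha> (u z) b * \<beta> b (w z))"
    unfolding word_mat_def using assms(2,3,4) by (intro prod.cong refl) (auto simp: mcomp_def)
  also have "\<dots> = (\<Sum>y\<in>words n J. \<Prod>z<n. \<alpha> (u z) (y z) * \<beta> (y z) (w z))"
    using assms(1) by (intro prod_sum_PiE) auto
  finally show ?thesis by (simp add: mcomp_def word_mat_def prod.distrib)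
qed

lemma word_mat_even:
  assumes "even_on I p J q \<alpha>"
  shows "even_on (words n I) (word_par p n) (words n J) (word_par q n) (word_mat n \<alpha> :: _ \<Rightarrow> _ \<Rightarrow> 'k::comm_ring_1)"
  unfolding even_on_def
proof (intro ballI impI)
  fix u w assume u: "u \<in> words n I" and w: "w \<in> words n J" and nz: "word_mat n \<alpha> u w \<noteq> 0"
  have "p (u z) = q (w z)" if "z < n" for z
  proof -
    have "\<alpha> (u z) (w z) \<noteq> 0" using nz that unfolding word_mat_def by (auto intro: prod_zero)
    thus ?thesis using assms u w that unfolding even_on_def by auto
  qed
  thus "word_par p n u = word_par q n w" by (induction n) auto
qed

text \<open>Bernoulli's inequality for the ratio \<open>1 + 1/a\<close>, cleared of denominators.\<close>

lemma exists_power_dominating: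
  assumes "a < (b :: nat)"
  shows "\<exists>k. 2 * a ^ k < b ^ k"
proof (cases "a = 0")
  case True
  thus ?thesis using assms by (intro exI[of _ 1]) auto
next
  case False
  have B: "a ^ k * (a + k) \<le> a * (a + 1) ^ k" for k
  proof (induction k)
    case (Suc k)
    have "a ^ Suc k * (a + Suc k) \<le> (a + 1) * (a ^ k * (a + k))"
      by (simp add: algebra_simps)
    also have "\<dots> \<le> (a + 1) * (a * (a + 1) ^ k)" by (rule mult_left_mono[OF Suc]) simp
    finally show ?case by (simp add: algebra_simps)
  qed simp
  have "a * (2 * a ^ (a + 1)) < a ^ (a + 1) * (a + (a + 1))" using False by (simp add: algebra_simps)
  also have "\<dots> \<le> a * (a + 1) ^ (a + 1)" by (rule B)
  finally have "2 * a ^ (a + 1) < (a + 1) ^ (a + 1)" using False by simp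
  also have "\<dots> \<le> b ^ (a + 1)" using assms by (intro power_mono) auto
  finally show ?thesis by blast
qed

text \<open>Nonvanishing is required of a diagonal entry, which holds for the Young symmetrizer and
singles out a pair of basis vectors on which the pairing attached to \<open>E\<close> is not zero.\<close>

definition negligible_endo :: "('i, 'k::field) hopf_super \<Rightarrow> ('i \<Rightarrow> 'k) \<Rightarrow> 'a set \<Rightarrow> ('a \<Rightarrow> bool) \<Rightarrow>
    ('a \<Rightarrow> 'a \<Rightarrow> ('i \<Rightarrow>\<^sub>0 'k)) \<Rightarrow> ('a \<Rightarrow> 'a \<Rightarrow> 'k) \<Rightarrow> bool" where
  "negligible_endo G x W p c E \<longleftrightarrow> comod G W p c \<and> equivariant W W c c E \<and> even_on W p W p E \<and>
     (\<exists>w\<in>W. E w w \<noteq> 0) \<and> (\<forall>F. endo W p (odd_action x p c) F \<longrightarrow> strace W p (mcomp W F E) = 0)"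

lemma exists_majority_letters:
  assumes "finite T" "2 * m < card T"
  obtains t v where "inj_on v {..<Suc m}" "\<And>i. i < Suc m \<Longrightarrow> v i \<in> T" "\<And>i. i < Suc m \<Longrightarrow> p (v i) = (t :: bool)"
proof -
  have "T = {u\<in>T. p u = True} \<union> {u\<in>T. p u = False}" by auto
  hence "card T \<le> card {u\<in>T. p u = True} + card {u\<in>T. p u = False}" by (metis card_Un_le)
  hence "Suc m \<le> card {u\<in>T. p u = True} \<or> Suc m \<le> card {u\<in>T. p u = False}"
    using assms(2) by linarith
  then obtain t where t: "Suc m \<le> card {u\<in>T. p u = t}" by blast
  have "\<exists>v. inj_on v {..<Suc m} \<and> v ` {..<Suc m} \<subseteq> {u\<in>T. p u = t}"
    by (rule card_le_inj[of "{..<Suc m}" "{u\<in>T. p u = t}", THEN exE]) (use t assms(1) in auto)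
  thus ?thesis using that by blast
qed

text \<open>The passage to the \<open>k\<close>-th tensor power serves to make the dimension of the
representation more than twice that of the part through which \<open>\<nu>\<close> factors, which has the index set
\<open>J\<close>. Then one parity alone provides more letters than that part has altogether, and the Young
symmetrizer separates the two.\<close>

lemma exists_negligible_endo:
  fixes G :: "('i, 'k::field_char_0) hopf_super" and \<alpha> :: "'a \<Rightarrow> 'b \<Rightarrow> 'k"
  assumes G: "algebraic_supergroup G" and x: "x \<in> lie_odd G" and c: "comod G I p c"
    and \<nu>: "carries_strace I p (odd_action x p c) \<nu>"
    and fac: "\<And>i j. i \<in> I \<Longrightarrow> j \<in> I \<Longrightarrow> \<nu> i j = mcomp J \<alpha> \<beta> i j"
    and \<alpha>: "even_on I p J q \<alpha>" and J: "finite J" "card J < card I"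
  shows "\<exists>(W :: (nat \<Rightarrow> nat \<Rightarrow> 'a) set) p' c' E. negligible_endo G x W p' c' E"
proof -
  interpret hopf G by (unfold_locales) (rule G)
  have fin: "finite I" by (rule comodD(1)[OF c])
  obtain k where k: "2 * card J ^ k < card I ^ k" using exists_power_dominating[OF J(2)] by blast
  let ?T = "words k I" and ?pT = "word_par p k" and ?cT = "word_coef G p c k" and ?V = "words k J"
  \<comment> \<open>One more than the dimension of the \<open>k\<close>-th tensor power of the smaller space.\<close>
  let ?s = "Suc (card J ^ k)"
  have cV: "card ?V = card J ^ k" "finite ?V" and cT: "card ?T = card I ^ k" "finite ?T"
    using fin J(1) by (auto simp: card_PiE intro!: finite_PiE)
  obtain t v where v: "inj_on v {..<?s}" "\<And>i. i < ?s \<Longrightarrow> v i \<in> ?T" "\<And>i. i < ?s \<Longrightarrow> ?pT (v i) = t"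
    using exists_majority_letters[of ?T "card J ^ k" ?pT] k cT by metis
  have cc: "comod G ?T ?pT ?cT" by (rule comod_words[OF c])
  define n where "n = ?s * ?s"
  let ?W = "words n ?T" and ?pW = "word_par ?pT n" and ?cW = "word_coef G ?pT ?cT n"
  let ?E = "young ?s t ?T ?pT :: _ \<Rightarrow> _ \<Rightarrow> 'k"
  have ccW: "comod G ?W ?pW ?cW" by (rule comod_words[OF cc])
  have fW: "finite ?W" by (rule comodD(1)[OF ccW])
  have car: "carries_strace ?W ?pW (odd_action x ?pW ?cW) (word_mat n (word_mat k \<nu>))"
    by (intro carries_strace_words[OF x cc] carries_strace_words[OF x c] \<nu>)
  have ev: "even_on ?W ?pW ?W ?pW ?E" unfolding n_def by (rule young_even)
  have gm: "equivariant ?W ?W ?cW ?cW ?E" unfolding n_def by (rule young_equivariant[OF cc])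
  have nz: "\<exists>w\<in>?W. ?E w w \<noteq> 0" unfolding n_def
    by (rule young_nonzero[where v = v]) (use cT(2) v in blast)+
  have "strace ?W ?pW (mcomp ?W F ?E) = 0" if F: "endo ?W ?pW (odd_action x ?pW ?cW) F" for F
  proof -
    have "endo ?W ?pW (odd_action x ?pW ?cW) ?E"
      unfolding endo_def using ev equivariant_commutes[OF gm ev] by blast
    hence "endo ?W ?pW (odd_action x ?pW ?cW) (mcomp ?W F ?E)" by (rule endo_comp[OF F])
    hence "strace ?W ?pW (mcomp ?W F ?E) = strace ?W ?pW (mcomp ?W (mcomp ?W F ?E) (word_mat n (word_mat k \<nu>)))"
      using car unfolding carries_strace_def by blast
    also have "\<dots> = 0"
      unfolding strace_def
    proof (intro sum.neutral ballI)
      fix w assume w: "w \<in> ?W"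
      have Ek: "mcomp ?W ?E (word_mat n (word_mat k \<nu>)) u w = 0" if u: "u \<in> ?W" for u
      proof -
        have "mcomp ?W ?E (word_mat n (word_mat k \<nu>)) u w =
            mcomp ?W ?E (mcomp (words n ?V) (word_mat n (word_mat k \<alpha>)) (word_mat n (word_mat k \<beta>))) u w"
          by (intro mcomp_cong refl word_mat_factor[OF cV(2) _ _ w] word_mat_factor[OF J(1) fac]) auto
        also have "\<dots> = mcomp (words n ?V) (mcomp ?W ?E (word_mat n (word_mat k \<alpha>))) (word_mat n (word_mat k \<beta>)) u w"
          by (rule mcomp_assoc[symmetric])
        also have "\<dots> = 0"
          unfolding mcomp_def[of "words n ?V"]
        proof (intro sum.neutral ballI)
          fix y assume y: "y \<in> words n ?V"
          have "mcomp ?W ?E (word_mat n (word_mat k \<alpha>)) u y = 0"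
            unfolding mcomp_def n_def
            by (rule young_word_mat_eq_0[OF cT(2) cV(2) _ word_mat_even[OF \<alpha>]])
               (use cV u y in \<open>simp_all add: n_def\<close>)
          thus "mcomp ?W ?E (word_mat n (word_mat k \<alpha>)) u y * word_mat n (word_mat k \<beta>) y w = 0" by simp
        qed
        finally show ?thesis .
      qed
      have "mcomp ?W (mcomp ?W F ?E) (word_mat n (word_mat k \<nu>)) w w = mcomp ?W F (\<lambda>_ _. 0) w w"
        unfolding mcomp_assoc by (rule mcomp_cong[OF refl]) (rule Ek)
      thus "ksign (?pW w) * mcomp ?W (mcomp ?W F ?E) (word_mat n (word_mat k \<nu>)) w w = 0"
        by (simp add: mcomp_def)
    qed
    finally show ?thesis .
  qed
  hence "negligible_endo G x ?W ?pW ?cW ?E"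
    unfolding negligible_endo_def using ccW gm ev nz by blast
  thus ?thesis by blast
qed

section \<open>Splitting a surjection onto a projective representation\<close>

lemma Rep_comod:
  fixes G :: "('i, 'k::field) hopf_super"
  shows "M \<in> Rep G \<longleftrightarrow> comod G {..<vdim M} (vodd M) (vcoef M)"
  unfolding Rep_def comod_def homog_def by (auto simp: Ball_def)

text \<open>The pairing \<open>v\<^sub>a\<^sup>* \<otimes> v\<^sub>b \<mapsto> E a b\<close> is equivariant: \<open>E\<close> commutes with the
coefficient matrix, which then meets its inverse.\<close>

lemma (in hopf) evaluation_equivariant:
  assumes c: "comod G W p c" and E: "equivariant W W c c E" "even_on W p W p E"
    and ab: "a0 \<in> W" "b0 \<in> W"
  shows "(\<Sum>a\<in>W. \<Sum>b\<in>W. smul (E a b) (tensor_coef G p p (dual_coef G p c) c (a, b) (a0, b0))) = smul (E a0 b0) \<I>"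
proof -
  have fin: "finite W" by (rule comodD(1)[OF c])
  have "(\<Sum>a\<in>W. \<Sum>b\<in>W. smul (E a b) (tensor_coef G p p (dual_coef G p c) c (a, b) (a0, b0))) =
      (\<Sum>a\<in>W. \<Sum>b\<in>W. antipode (c a0 a) \<star> smul (E a b) (c b b0))"
  proof (intro sum.cong refl)
    fix a b assume w: "a \<in> W" "b \<in> W"
    show "smul (E a b) (tensor_coef G p p (dual_coef G p c) c (a, b) (a0, b0)) = antipode (c a0 a) \<star> smul (E a b) (c b b0)"
    proof (cases "E a b = 0")
      case False
      hence "p a = p b" using E(2) w unfolding even_on_def by blast
      thus ?thesis by (cases "p b"; cases "p a0") (simp_all add: tensor_coef_def dual_coef_def hprod_simps)
    qed (simp add: hprod_simps)
  qed
  also have "\<dots> = (\<Sum>a\<in>W. antipode (c a0 a) \<star> (\<Sum>b\<in>W. smul (E b b0) (c a b)))"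
    using E(1) ab unfolding equivariant_def by (intro sum.cong refl) (simp add: klin_sum[OF klin_hprod_right, symmetric])
  also have "\<dots> = (\<Sum>b\<in>W. smul (E b b0) (\<Sum>a\<in>W. antipode (c a0 a) \<star> c a b))"
    unfolding klin_sum[OF klin_hprod_right] klin_smul[OF klin_hprod_right] smul_sum by (rule sum.swap)
  also have "\<dots> = (\<Sum>b\<in>W. if b = a0 then smul (E a0 b0) \<I> else 0)"
    using ab by (intro sum.cong refl) (auto simp: antipode_inverse[OF c])
  also have "\<dots> = smul (E a0 b0) \<I>" using ab fin by simp
  finally show ?thesis .
qed

text \<open>The number on the left is the supertrace of the composite of
\<open>H : Q \<rightarrow> Q \<otimes> W\<^sup>* \<otimes> W\<close> with the pairing attached to \<open>E\<close>. Contracting \<open>Q\<close> first instead, one obtains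
from \<open>H\<close> an endomorphism \<open>F'\<close> of \<open>W\<close>, and the same number is the supertrace of \<open>F' E\<close>.\<close>

lemma strace_through_projective:
  fixes G :: "('i, 'k::field) hopf_super"
  assumes G: "algebraic_supergroup G" and x: "x \<in> lie_odd G"
    and d: "comod G Q r d" and c: "comod G W p c" and Eev: "even_on W p W p E"
    and H: "even_on (Q \<times> (W \<times> W)) (tensor_par r (tensor_par p p)) Q r H"
    and Hc: "commutes Q (Q \<times> (W \<times> W)) (odd_action x r d)
      (odd_action x (tensor_par r (tensor_par p p)) (tensor_coef G r (tensor_par p p) d (tensor_coef G p p (dual_coef G p c) c))) H"
    and E: "\<And>F. endo W p (odd_action x p c) F \<Longrightarrow> strace W p (mcomp W F E) = 0"
  shows "(\<Sum>q\<in>Q. ksign (r q) * (\<Sum>a\<in>W. \<Sum>b\<in>W. E a b * H (q, (a, b)) q)) = 0"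
proof -
  interpret hopf G by (unfold_locales) (rule G)
  let ?D = "dual_coef G p c" and ?X = "odd_action x p c" and ?P = "odd_action x r d"
  have D: "comod G W p ?D" by (rule comod_dual[OF c])
  have DC: "comod G (W \<times> W) (tensor_par p p) (tensor_coef G p p ?D c)" by (rule comod_tensor[OF D c])
  have fin: "finite Q" "finite W" "finite (W \<times> W)"
    using comodD(1)[OF d] comodD(1)[OF c] by auto
  define F where "F b a = (\<Sum>q\<in>Q. ksign (r q) * H (q, (a, b)) q)" for b a
  define F' where "F' b a = ksign (p a) * F b a" for b a
  have Heq: "(\<Sum>q''\<in>Q. H (q, (a, b)) q'' * ?P q'' q') =
      (\<Sum>q''\<in>Q. ?P q q'' * H (q'', (a, b)) q') + ksign (r q) * (ksign (p a) *
        ((\<Sum>a'\<in>W. ?X a' a * H (q, (a', b)) q') + (\<Sum>b'\<in>W. ?X b b' * H (q, (a, b')) q')))"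
    if w: "q \<in> Q" "q' \<in> Q" "a \<in> W" "b \<in> W" for q q' a b
  proof -
    let ?Z = "odd_action x (tensor_par r (tensor_par p p)) (tensor_coef G r (tensor_par p p) d (tensor_coef G p p ?D c))"
    have Z: "?Z (q, (a, b)) u = tensor_op r ?P (tensor_op p (odd_action x p ?D) ?X) (q, (a, b)) u"
      if "u \<in> Q \<times> (W \<times> W)" for u
    proof -
      obtain q1 a1 b1 where u: "u = (q1, (a1, b1))" "q1 \<in> Q" "a1 \<in> W" "b1 \<in> W" using \<open>u \<in> _\<close> by auto
      show ?thesis
        using odd_action_tensor[OF x d DC, of q q1 "(a, b)" "(a1, b1)"] odd_action_tensor[OF x D c, of a a1 b b1] w u
        by (simp add: tensor_op_def)
    qed
    have "(\<Sum>q''\<in>Q. H (q, (a, b)) q'' * ?P q'' q') = (\<Sum>u\<in>Q \<times> (W \<times> W). ?Z (q, (a, b)) u * H u q')"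
      using Hc w unfolding commutes_def by blast
    also have "\<dots> = (\<Sum>u\<in>Q \<times> (W \<times> W). tensor_op r ?P (tensor_op p (odd_action x p ?D) ?X) (q, (a, b)) u * H u q')"
      by (intro sum.cong refl) (simp only: Z)
    also have "\<dots> = (\<Sum>q''\<in>Q. ?P q q'' * H (q'', (a, b)) q') +
        ksign (r q) * (\<Sum>v\<in>W \<times> W. tensor_op p (odd_action x p ?D) ?X (a, b) v * H (q, v) q')"
      by (rule tensor_op_left) (use fin w in auto)
    also have "(\<Sum>v\<in>W \<times> W. tensor_op p (odd_action x p ?D) ?X (a, b) v * H (q, v) q') =
        (\<Sum>a'\<in>W. odd_action x p ?D a a' * H (q, (a', b)) q') + ksign (p a) * (\<Sum>b'\<in>W. ?X b b' * H (q, (a, b')) q')"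
      by (rule tensor_op_left) (use fin w in auto)
    also have "(\<Sum>a'\<in>W. odd_action x p ?D a a' * H (q, (a', b)) q') =
        ksign (p a) * (\<Sum>a'\<in>W. ?X a' a * H (q, (a', b)) q')"
      unfolding sum_distrib_left using w by (intro sum.cong refl) (simp add: odd_action_dual[OF x c])
    finally show ?thesis by (simp add: distrib_left)
  qed
  \<comment> \<open>The contraction \<open>F\<close> anticommutes with \<open>x\<close>: the terms with the action on \<open>Q\<close> occur as a product and
    as the product in the other order, and cancel under the sum over \<open>q\<close>.\<close>
  have anti: "(\<Sum>a'\<in>W. F b a' * ?X a' a) + (\<Sum>b'\<in>W. ?X b b' * F b' a) = 0" if w: "a \<in> W" "b \<in> W" for a b
  proof -
    define S where "S = (\<Sum>q\<in>Q. \<Sum>q''\<in>Q. H (q, (a, b)) q'' * ?P q'' q)"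
    have S: "S = (\<Sum>q\<in>Q. \<Sum>q''\<in>Q. ?P q q'' * H (q'', (a, b)) q)"
      unfolding S_def by (subst sum.swap) (simp only: mult.commute)
    have "S = S + ksign (p a) * ((\<Sum>a'\<in>W. F b a' * ?X a' a) + (\<Sum>b'\<in>W. ?X b b' * F b' a))"
    proof -
      have "S = (\<Sum>q\<in>Q. (\<Sum>q''\<in>Q. ?P q q'' * H (q'', (a, b)) q) + ksign (r q) * (ksign (p a) *
        ((\<Sum>a'\<in>W. ?X a' a * H (q, (a', b)) q) + (\<Sum>b'\<in>W. ?X b b' * H (q, (a, b')) q))))"
        unfolding S_def using w by (intro sum.cong refl Heq)
      also have "\<dots> = S + ksign (p a) * ((\<Sum>q\<in>Q. \<Sum>a'\<in>W. ksign (r q) * (?X a' a * H (q, (a', b)) q)) +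
          (\<Sum>q\<in>Q. \<Sum>b'\<in>W. ksign (r q) * (?X b b' * H (q, (a, b')) q)))"
        unfolding S sum.distrib sum_distrib_left distrib_left by (simp only: mult.left_commute)
      also have "(\<Sum>q\<in>Q. \<Sum>a'\<in>W. ksign (r q) * (?X a' a * H (q, (a', b)) q)) = (\<Sum>a'\<in>W. F b a' * ?X a' a)"
        unfolding F_def sum_distrib_right by (subst sum.swap) (simp only: mult_ac)
      also have "(\<Sum>q\<in>Q. \<Sum>b'\<in>W. ksign (r q) * (?X b b' * H (q, (a, b')) q)) = (\<Sum>b'\<in>W. ?X b b' * F b' a)"
        unfolding F_def sum_distrib_left by (subst sum.swap) (simp only: mult_ac)
      finally show ?thesis .
    qed
    hence "ksign (p a) * ((\<Sum>a'\<in>W. F b a' * ?X a' a) + (\<Sum>b'\<in>W. ?X b b' * F b' a)) = 0" by simp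
    hence "ksign (p a) * (ksign (p a) * ((\<Sum>a'\<in>W. F b a' * ?X a' a) + (\<Sum>b'\<in>W. ?X b b' * F b' a))) = 0"
      by (simp only: mult_zero_right)
    thus ?thesis by (simp only: ksign_sq)
  qed
  have Fev: "p a = p b" if nz: "F b a \<noteq> 0" and w: "a \<in> W" "b \<in> W" for a b
  proof -
    obtain q where "q \<in> Q" "ksign (r q) * H (q, (a, b)) q \<noteq> 0"
      using nz unfolding F_def by (auto elim: sum.not_neutral_contains_not_neutral)
    hence "tensor_par r (tensor_par p p) (q, (a, b)) = r q"
      using H w unfolding even_on_def by (auto dest!: mult_not_zero)
    thus ?thesis by (auto simp: tensor_par_def)
  qed
  \<comment> \<open>Composing with the parity operator turns anticommutation into commutation.\<close>
  have "endo W p ?X F'"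
    unfolding endo_def even_on_def commutes_def
  proof (intro conjI ballI impI)
    fix b a assume "b \<in> W" "a \<in> W" "F' b a \<noteq> 0"
    thus "p b = p a" using Fev[of b a] by (auto simp: F'_def dest: mult_not_zero)
  next
    fix b a assume w: "b \<in> W" "a \<in> W"
    have "(\<Sum>a'\<in>W. F' b a' * ?X a' a) = (\<Sum>a'\<in>W. - ksign (p a) * (F b a' * ?X a' a))"
    proof (rule sum.cong[OF refl])
      fix a' assume a': "a' \<in> W"
      show "F' b a' * ?X a' a = - ksign (p a) * (F b a' * ?X a' a)"
      proof (cases "?X a' a = 0")
        case False
        hence "p a' \<noteq> p a" using odd_action_odd[OF x c] w a' unfolding odd_on_def by blast
        thus ?thesis by (cases "p a"; cases "p a'") (simp_all add: F'_def)
      qed simp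
    qed
    also have "\<dots> = - ksign (p a) * (\<Sum>a'\<in>W. F b a' * ?X a' a)" by (simp only: sum_distrib_left)
    also have "\<dots> = ksign (p a) * (\<Sum>b'\<in>W. ?X b b' * F b' a)"
      using anti[OF w(2,1)] by (simp add: add_eq_0_iff)
    also have "\<dots> = (\<Sum>b'\<in>W. ?X b b' * F' b' a)"
      by (simp add: F'_def sum_distrib_left mult_ac)
    finally show "(\<Sum>a'\<in>W. F' b a' * ?X a' a) = (\<Sum>b'\<in>W. ?X b b' * F' b' a)" .
  qed
  hence "strace W p (mcomp W F' E) = 0" by (rule E)
  moreover have "strace W p (mcomp W F' E) = (\<Sum>b\<in>W. \<Sum>a\<in>W. E a b * F b a)"
    unfolding strace_def mcomp_def sum_distrib_left
  proof (intro sum.cong refl)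
    fix a b assume w: "a \<in> W" "b \<in> W"
    show "ksign (p b) * (F' b a * E a b) = E a b * F b a"
    proof (cases "E a b = 0")
      case False
      hence "p a = p b" using Eev w unfolding even_on_def by blast
      thus ?thesis by (simp add: F'_def mult_ac)
    qed simp
  qed
  moreover have "(\<Sum>b\<in>W. \<Sum>a\<in>W. E a b * F b a) =
      (\<Sum>q\<in>Q. ksign (r q) * (\<Sum>a\<in>W. \<Sum>b\<in>W. E a b * H (q, (a, b)) q))"
  proof -
    have "(\<Sum>b\<in>W. \<Sum>a\<in>W. E a b * F b a) = (\<Sum>a\<in>W. \<Sum>b\<in>W. \<Sum>q\<in>Q. ksign (r q) * (E a b * H (q, (a, b)) q))"
      unfolding F_def sum_distrib_left by (subst sum.swap) (simp only: mult.left_commute)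
    also have "\<dots> = (\<Sum>a\<in>W. \<Sum>q\<in>Q. \<Sum>b\<in>W. ksign (r q) * (E a b * H (q, (a, b)) q))"
      by (rule sum.cong[OF refl], rule sum.swap)
    also have "\<dots> = (\<Sum>q\<in>Q. \<Sum>a\<in>W. \<Sum>b\<in>W. ksign (r q) * (E a b * H (q, (a, b)) q))"
      by (rule sum.swap)
    finally show ?thesis unfolding sum_distrib_left .
  qed
  ultimately show ?thesis by simp
qed

text \<open>The matrix \<open>\<Phi>\<close> is the identity of \<open>P\<close> tensored with the pairing attached to \<open>E\<close>, a map
onto \<open>P\<close>. Projectivity gives an equivariant section \<open>H\<close>, and \<open>g\<close> is the composite of \<open>H g\<close> with \<open>\<Phi>\<close>.\<close>

lemma projective_strace_zero:
  fixes G :: "('i, 'k::field) hopf_super" and W :: "'a set"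
  assumes G: "algebraic_supergroup G" and x: "x \<in> lie_odd G" and P: "projective_rep G P"
    and neg: "negligible_endo G x W p c E"
    and g: "endo {..<vdim P} (vodd P) (odd_action x (vodd P) (vcoef P)) g"
  shows "strace {..<vdim P} (vodd P) g = 0"
proof -
  interpret hopf G by (unfold_locales) (rule G)
  let ?m = "vdim P" and ?r = "vodd P" and ?d = "vcoef P" and ?Q = "{..<vdim P}"
  have c: "comod G W p c" and Eg: "equivariant W W c c E" and Eev: "even_on W p W p E"
    and E0: "\<And>F. endo W p (odd_action x p c) F \<Longrightarrow> strace W p (mcomp W F E) = 0"
    using neg unfolding negligible_endo_def by auto
  obtain w0 where w0: "w0 \<in> W" "E w0 w0 \<noteq> 0" using neg unfolding negligible_endo_def by auto
  have PR: "P \<in> Rep G" using P unfolding projective_rep_def by blast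
  have d: "comod G ?Q ?r ?d" using PR by (simp add: Rep_comod)
  let ?D = "dual_coef G p c"
  let ?cQ = "tensor_coef G p p ?D c"
  let ?A = "?Q \<times> (W \<times> W)" and ?pA = "tensor_par ?r (tensor_par p p)" and ?cA = "tensor_coef G ?r (tensor_par p p) ?d ?cQ"
  have cA: "comod G ?A ?pA ?cA" by (intro comod_tensor d comod_dual c)
  have finA: "finite ?A" by (rule comodD(1)[OF cA])
  have finW: "finite W" by (rule comodD(1)[OF c])
  define N where "N = card ?A"
  obtain f where f: "bij_betw f {..<N} ?A"
    using ex_bij_betw_nat_finite[OF finA] unfolding N_def atLeast0LessThan by blast
  \<comment> \<open>Representations have an initial segment of \<open>nat\<close> as basis, so the index set of
    \<open>P \<otimes> W\<^sup>* \<otimes> W\<close> is enumerated by \<open>f\<close>.\<close>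
  define M where "M = \<lparr>vdim = N, vodd = (\<lambda>j. ?pA (f j)), vcoef = (\<lambda>i j. ?cA (f i) (f j))\<rparr>"
  have MR: "M \<in> Rep G" unfolding Rep_comod M_def using comod_reindex[OF cA f] by simp
  have fA: "f j \<in> ?A" if "j < N" for j using f that by (auto dest: bij_betwE)
  have sm: "(\<Sum>j<N. F (f j)) = (\<Sum>v\<in>?A. F v)" for F :: "_ \<Rightarrow> 'z::comm_monoid_add"
    by (rule sum.reindex_bij_betw[OF f])
  have smA: "(\<Sum>v\<in>?A. F v) = (\<Sum>q\<in>?Q. \<Sum>a\<in>W. \<Sum>b\<in>W. F (q, (a, b)))" for F :: "_ \<Rightarrow> 'z::comm_monoid_add"
    by (simp add: sum.cartesian_product case_prod_beta')
  define \<Phi> :: "nat \<Rightarrow> nat \<times> 'a \<times> 'a \<Rightarrow> 'k" where "\<Phi> q v = (if q = fst v then E (fst (snd v)) (snd (snd v)) else 0)" for q v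
  have \<Phi>ev: "even_on ?Q ?r ?A ?pA \<Phi>"
    using Eev unfolding even_on_def \<Phi>_def by (auto simp: tensor_par_def split: if_splits)
  have \<Phi>g: "equivariant ?A ?Q ?cA ?d \<Phi>"
    unfolding equivariant_def
  proof (intro ballI)
    fix l v assume l: "l \<in> ?Q" and "v \<in> ?A"
    then obtain q0 a0 b0 where v: "v = (q0, (a0, b0))" "q0 \<in> ?Q" "a0 \<in> W" "b0 \<in> W" by auto
    have "(\<Sum>i\<in>?A. smul (\<Phi> l i) (?cA i v)) =
        (\<Sum>q\<in>?Q. if q = l then \<Sum>a\<in>W. \<Sum>b\<in>W. smul (E a b) (?cA (l, (a, b)) v) else 0)"
      unfolding smA by (intro sum.cong refl) (auto simp: \<Phi>_def)
    also have "\<dots> = (\<Sum>a\<in>W. \<Sum>b\<in>W. smul (E a b) (?cA (l, (a, b)) v))" using l by simp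
    also have "\<dots> = (\<Sum>a\<in>W. \<Sum>b\<in>W. ?d l q0 \<star> smul (E a b) (?cQ (a, b) (a0, b0)))"
    proof (intro sum.cong refl)
      fix a b assume ab: "a \<in> W" "b \<in> W"
      show "smul (E a b) (?cA (l, (a, b)) v) = ?d l q0 \<star> smul (E a b) (?cQ (a, b) (a0, b0))"
      proof (cases "E a b = 0")
        case False
        hence "p a = p b" using Eev ab unfolding even_on_def by blast
        thus ?thesis by (simp add: tensor_coef_def[of G ?r] v hprod_simps tensor_par_def)
      qed (simp add: hprod_simps)
    qed
    also have "\<dots> = ?d l q0 \<star> (\<Sum>a\<in>W. \<Sum>b\<in>W. smul (E a b) (?cQ (a, b) (a0, b0)))"
      by (simp only: klin_sum[OF klin_hprod_right])
    also have "\<dots> = smul (E a0 b0) (?d l q0)"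
      by (simp add: evaluation_equivariant[OF c Eg Eev v(3,4)] hprod_simps)
    also have "\<dots> = (\<Sum>i\<in>?Q. if i = q0 then smul (E a0 b0) (?d l q0) else 0)" using v(2) by simp
    also have "\<dots> = (\<Sum>i\<in>?Q. smul (\<Phi> i v) (?d l i))"
      by (intro sum.cong refl) (simp add: \<Phi>_def v)
    finally show "(\<Sum>i\<in>?A. smul (\<Phi> l i) (?cA i v)) = (\<Sum>i\<in>?Q. smul (\<Phi> i v) (?d l i))" .
  qed
  define \<phi> where "\<phi> = mat ?m N (\<lambda>(q, j). \<Phi> q (f j))"
  have "\<phi> \<in> even_maps M P"
  proof -
    have "vodd P i = ?pA (f j)" if "i < ?m" "j < N" "\<Phi> i (f j) \<noteq> 0" for i j
      using bspec[OF bspec[OF \<Phi>ev[unfolded even_on_def]] fA[OF that(2)], of i] that by simp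
    thus ?thesis unfolding even_maps_def \<phi>_def M_def by simp
  qed
  moreover have "(\<Sum>i<N. smul (\<phi> $$ (l, i)) (?cA (f i) (f j))) = (\<Sum>i<?m. smul (\<phi> $$ (i, j)) (?d l i))"
    if lj: "l < ?m" "j < N" for l j
  proof -
    have "(\<Sum>i<N. smul (\<phi> $$ (l, i)) (?cA (f i) (f j))) = (\<Sum>i<N. smul (\<Phi> l (f i)) (?cA (f i) (f j)))"
      using lj by (intro sum.cong refl) (simp add: \<phi>_def)
    also have "\<dots> = (\<Sum>v\<in>?A. smul (\<Phi> l v) (?cA v (f j)))" by (rule sm)
    also have "\<dots> = (\<Sum>i\<in>?Q. smul (\<Phi> i (f j)) (?d l i))"
      using bspec[OF bspec[OF \<Phi>g[unfolded equivariant_def]] fA[OF lj(2)], of l] lj by simp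
    also have "\<dots> = (\<Sum>i<?m. smul (\<phi> $$ (i, j)) (?d l i))"
      using lj by (intro sum.cong refl) (simp add: \<phi>_def)
    finally show ?thesis .
  qed
  ultimately have \<phi>g: "\<phi> \<in> ghom M P" unfolding ghom_def M_def by simp
  have dims: "dim_row \<phi> = ?m" "dim_col \<phi> = N" by (simp_all add: \<phi>_def)
  have surj: "surj_mat \<phi>"
    unfolding surj_mat_def dims
  proof (intro equalityI subsetI)
    fix v assume "v \<in> (*\<^sub>v) \<phi> ` carrier_vec N"
    then obtain u where "v = \<phi> *\<^sub>v u" by blast
    thus "v \<in> carrier_vec ?m" by (intro carrier_vecI) (simp add: dims)
  next
    fix v :: "'k vec" assume v: "v \<in> carrier_vec ?m"
    define u where "u = vec N (\<lambda>j. if snd (f j) = (w0, w0) then v $ fst (f j) / E w0 w0 else 0)"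
    have "\<phi> *\<^sub>v u = v"
    proof (rule eq_vecI)
      show "dim_vec (\<phi> *\<^sub>v u) = dim_vec v" using v by (simp add: dims)
      fix l assume l: "l < dim_vec v"
      hence lm: "l < ?m" using v by simp
      have "(\<phi> *\<^sub>v u) $ l = (\<Sum>j<N. \<phi> $$ (l, j) * u $ j)"
        using lm by (simp add: dims scalar_prod_def u_def atLeast0LessThan)
      also have "\<dots> = (\<Sum>j<N. (\<lambda>w. \<Phi> l w * (if snd w = (w0, w0) then v $ fst w / E w0 w0 else 0)) (f j))"
        using lm by (intro sum.cong refl) (simp add: \<phi>_def u_def)
      also have "\<dots> = (\<Sum>w\<in>?A. \<Phi> l w * (if snd w = (w0, w0) then v $ fst w / E w0 w0 else 0))"
        by (rule sm)
      also have "\<dots> = (\<Sum>w\<in>?A. if w = (l, (w0, w0)) then v $ l else 0)"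
        using w0(2) by (intro sum.cong refl) (auto simp: \<Phi>_def)
      also have "\<dots> = v $ l" using lm w0 finA by (simp add: sum.delta')
      finally show "(\<phi> *\<^sub>v u) $ l = v $ l" .
    qed
    moreover have "u \<in> carrier_vec N" by (simp add: u_def)
    ultimately show "v \<in> (*\<^sub>v) \<phi> ` carrier_vec N" by blast
  qed
  have "1\<^sub>m ?m \<in> ghom P P"
    unfolding ghom_def even_maps_def
    by (auto simp: if_distrib[of "\<lambda>z. smul z _"] cong: if_cong)
  then obtain h where h: "h \<in> ghom P M" "\<phi> * h = 1\<^sub>m ?m"
    using P MR PR \<phi>g surj unfolding projective_rep_def by blast
  have hdim: "h \<in> carrier_mat N ?m"
    using h(1) unfolding ghom_def even_maps_def M_def by simp
  define k where "k = inv_into {..<N} f"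
  have k: "k v < N" "f (k v) = v" if "v \<in> ?A" for v
    using bij_betw_inv_into[OF f] bij_betw_inv_into_right[OF f that] that
    unfolding k_def by (auto dest: bij_betwE)
  have kf: "k (f j) = j" if "j < N" for j
    using bij_betw_inv_into_left[OF f] that unfolding k_def by simp
  define H :: "nat \<times> 'a \<times> 'a \<Rightarrow> nat \<Rightarrow> 'k" where "H v q = h $$ (k v, q)" for v q
  have Hev: "even_on ?A ?pA ?Q ?r H"
    unfolding even_on_def
  proof (intro ballI impI)
    fix v q assume vq: "v \<in> ?A" "q \<in> ?Q" "H v q \<noteq> 0"
    have "vodd M (k v) = vodd P q"
      using h(1) vq k[OF vq(1)] unfolding ghom_def even_maps_def H_def by (auto simp: M_def)
    thus "?pA v = ?r q" using k[OF vq(1)] by (simp add: M_def)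
  qed
  have Hg: "equivariant ?Q ?A ?d ?cA H"
    unfolding equivariant_def
  proof (intro ballI)
    fix l j assume l: "l \<in> ?A" and j: "j \<in> ?Q"
    have "(\<Sum>i<?m. smul (h $$ (k l, i)) (vcoef P i j)) = (\<Sum>i<N. smul (h $$ (i, j)) (vcoef M (k l) i))"
      using h(1) k[OF l] j unfolding ghom_def by (simp add: M_def)
    also have "\<dots> = (\<Sum>i<N. (\<lambda>v. smul (H v j) (?cA l v)) (f i))"
      by (intro sum.cong refl) (simp add: M_def H_def kf k[OF l])
    also have "\<dots> = (\<Sum>v\<in>?A. smul (H v j) (?cA l v))" by (rule sm)
    finally show "(\<Sum>i\<in>?Q. smul (H l i) (?d i j)) = (\<Sum>i\<in>?A. smul (H i j) (?cA l i))"
      by (simp add: H_def)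
  qed
  define H' where "H' = mcomp ?Q H g"
  have H'ev: "even_on ?A ?pA ?Q ?r H'"
    unfolding H'_def using g by (auto intro: even_comp[OF Hev] simp: endo_def)
  have H'c: "commutes ?Q ?A (odd_action x ?r ?d) (odd_action x ?pA ?cA) H'"
    unfolding H'_def using g by (auto intro: commutes_comp[OF _ equivariant_commutes[OF Hg Hev]] simp: endo_def)
  have "strace ?Q ?r g = (\<Sum>q\<in>?Q. ksign (?r q) * (\<Sum>a\<in>W. \<Sum>b\<in>W. E a b * H' (q, (a, b)) q))"
    unfolding strace_def
  proof (intro sum.cong refl arg_cong2[of _ _ _ _ "(*)"])
    fix q assume q: "q \<in> ?Q"
    have id: "mcomp ?A \<Phi> H q q' = (if q = q' then 1 else 0)" if q': "q' \<in> ?Q" for q'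
    proof -
      have "(\<phi> * h) $$ (q, q') = (\<Sum>j<N. \<phi> $$ (q, j) * h $$ (j, q'))"
        using q q' hdim by (simp add: dims scalar_prod_def atLeast0LessThan)
      also have "\<dots> = (\<Sum>j<N. (\<lambda>v. \<Phi> q v * H v q') (f j))"
        using q by (intro sum.cong refl) (simp add: \<phi>_def H_def kf)
      also have "\<dots> = mcomp ?A \<Phi> H q q'" unfolding mcomp_def by (rule sm)
      finally show ?thesis using h(2) q q' by simp
    qed
    have "g q q = (\<Sum>q'\<in>?Q. (if q = q' then 1 else 0) * g q' q)"
      using q by (simp only: sum_times_delta finite_lessThan)
    also have "\<dots> = mcomp ?Q (mcomp ?A \<Phi> H) g q q"
      unfolding mcomp_def[of ?Q] by (intro sum.cong refl) (simp only: id)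
    also have "\<dots> = mcomp ?A \<Phi> H' q q" unfolding H'_def by (rule mcomp_assoc)
    also have "\<dots> = (\<Sum>q'\<in>?Q. if q' = q then \<Sum>a\<in>W. \<Sum>b\<in>W. E a b * H' (q, (a, b)) q else 0)"
      unfolding mcomp_def smA by (intro sum.cong refl) (auto simp: \<Phi>_def)
    also have "\<dots> = (\<Sum>a\<in>W. \<Sum>b\<in>W. E a b * H' (q, (a, b)) q)" using q by simp
    finally show "g q q = (\<Sum>a\<in>W. \<Sum>b\<in>W. E a b * H' (q, (a, b)) q)" .
  qed
  also have "\<dots> = 0"
    by (rule strace_through_projective[OF G x d c Eev H'ev H'c E0])
  finally show ?thesis .
qed

section \<open>Fitting's lemma\<close>

lemma entry_mult:
  assumes "A \<in> carrier_mat r n" "B \<in> carrier_mat n c" "i < r" "j < c"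
  shows "(A * B) $$ (i, j) = (\<Sum>l<n. A $$ (i, l) * B $$ (l, j))"
  using assms by (simp add: scalar_prod_def atLeast0LessThan)

lemma linear_dependence:
  fixes f :: "'a \<Rightarrow> 'b \<Rightarrow> 'k::field"
  assumes "finite S" "finite K" "card S < card K"
  shows "\<exists>c. (\<exists>k\<in>K. c k \<noteq> 0) \<and> (\<forall>s\<in>S. (\<Sum>k\<in>K. c k * f k s) = 0)"
  using assms
proof (induction S arbitrary: K f rule: finite_induct)
  case empty
  hence "K \<noteq> {}" by auto
  thus ?case by (intro exI[of _ "\<lambda>_. 1"]) auto
next
  case (insert s S)
  show ?case
  proof (cases "\<forall>k\<in>K. f k s = 0")
    case True
    have "card S < card K" using insert by simp
    then obtain c where "\<exists>k\<in>K. c k \<noteq> 0" "\<forall>t\<in>S. (\<Sum>k\<in>K. c k * f k t) = 0"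
      using insert.IH[OF insert.prems(1)] by blast
    thus ?thesis using True by (intro exI[of _ c]) auto
  next
    case False
    then obtain k0 where k0: "k0 \<in> K" "f k0 s \<noteq> 0" by blast
    let ?K = "K - {k0}"
    have "card S < card ?K" using insert k0 by simp
    then obtain c where c: "\<exists>k\<in>?K. c k \<noteq> 0"
      "\<forall>t\<in>S. (\<Sum>k\<in>?K. c k * (f k t - f k s / f k0 s * f k0 t)) = 0"
      using insert.IH[of ?K "\<lambda>k t. f k t - f k s / f k0 s * f k0 t"] insert.prems(1) by blast
    define d where "d k = (if k = k0 then - (\<Sum>k\<in>?K. c k * f k s) / f k0 s else c k)" for k
    have D: "(\<Sum>k\<in>K. d k * f k t) = (\<Sum>k\<in>?K. c k * (f k t - f k s / f k0 s * f k0 t))" for t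
    proof -
      have "(\<Sum>k\<in>K. d k * f k t) = d k0 * f k0 t + (\<Sum>k\<in>?K. d k * f k t)"
        using insert.prems(1) k0(1) by (rule sum.remove)
      also have "(\<Sum>k\<in>?K. d k * f k t) = (\<Sum>k\<in>?K. c k * f k t)"
        by (rule sum.cong) (auto simp: d_def)
      also have "d k0 * f k0 t + (\<Sum>k\<in>?K. c k * f k t) = (\<Sum>k\<in>?K. c k * (f k t - f k s / f k0 s * f k0 t))"
        by (simp add: d_def right_diff_distrib sum_subtractf sum_distrib_right sum_divide_distrib mult.assoc)
      finally show ?thesis .
    qed
    have "\<exists>k\<in>K. d k \<noteq> 0" using c(1) by (auto simp: d_def)
    moreover have "(\<Sum>k\<in>K. d k * f k t) = 0" if "t \<in> insert s S" for t
      using that c(2) k0(2) unfolding D by auto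
    ultimately show ?thesis by blast
  qed
qed

context
  fixes n :: nat
begin

lemmas sq_assoc = assoc_mult_mat[of _ n n _ n _ n]

lemma pow_add_mat:
  assumes A: "(A :: 'k::field mat) \<in> carrier_mat n n"
  shows "A ^\<^sub>m (a + b) = A ^\<^sub>m a * A ^\<^sub>m b"
  using A by (induction b) (simp_all add: sq_assoc)

lemma commute_pow:
  assumes A: "(A :: 'k::field mat) \<in> carrier_mat n n" and B: "B \<in> carrier_mat n n" and c: "A * B = B * A"
  shows "A ^\<^sub>m k * B = B * A ^\<^sub>m k"
proof (induction k)
  case (Suc k)
  have "A ^\<^sub>m Suc k * B = A ^\<^sub>m k * B * A" using A B c by (simp add: sq_assoc)
  thus ?case unfolding Suc using A B by (simp add: sq_assoc)
qed (use A B in simp)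

text \<open>The first \<open>n\<^sup>2 + 1\<close> powers of \<open>A\<close> are linearly dependent. Solving a dependency for its
lowest term expresses \<open>A\<^sup>m\<close> by higher powers, with a quotient \<open>W\<close> that is a polynomial in \<open>A\<close> and hence
commutes with the centralizer of \<open>A\<close>.\<close>

lemma pow_relation:
  assumes A: "(A :: 'k::field mat) \<in> carrier_mat n n"
  shows "\<exists>m W. W \<in> carrier_mat n n \<and> A ^\<^sub>m m = A ^\<^sub>m (Suc m) * W \<and>
    (\<forall>B\<in>carrier_mat n n. A * B = B * A \<longrightarrow> W * B = B * W)"
proof -
  have "card ({..<n} \<times> {..<n}) < card {..n * n}" by simp
  then obtain c where c: "\<exists>k\<in>{..n * n}. c k \<noteq> 0"
    "\<forall>s\<in>{..<n} \<times> {..<n}. (\<Sum>k\<le>n * n. c k * (A ^\<^sub>m k) $$ s) = 0"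
    using linear_dependence[of "{..<n} \<times> {..<n}" "{..n * n}" "\<lambda>k s. (A ^\<^sub>m k) $$ s"] by auto
  define m where "m = (LEAST k. c k \<noteq> 0)"
  obtain k0 where k0: "k0 \<le> n * n" "c k0 \<noteq> 0" using c(1) by auto
  have m: "c m \<noteq> 0" "m \<le> n * n"
    unfolding m_def using LeastI[of "\<lambda>k. c k \<noteq> 0", OF k0(2)]
      Least_le[of "\<lambda>k. c k \<noteq> 0", OF k0(2)] k0(1) by linarith+
  have ml: "\<And>k. k < m \<Longrightarrow> c k = 0" unfolding m_def by (blast dest: not_less_Least)
  define L where "L = n * n - m"
  define w where "w k = - c (Suc m + k) / c m" for k
  define W where "W = mat n n (\<lambda>(i, j). \<Sum>k<L. w k * (A ^\<^sub>m k) $$ (i, j))"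
  have W: "W \<in> carrier_mat n n" by (simp add: W_def)
  have left: "(B * W) $$ (i, j) = (\<Sum>k<L. w k * (B * A ^\<^sub>m k) $$ (i, j))"
    if B: "B \<in> carrier_mat n n" and ij: "i < n" "j < n" for B i j
  proof -
    have "(B * W) $$ (i, j) = (\<Sum>l<n. \<Sum>k<L. w k * (B $$ (i, l) * (A ^\<^sub>m k) $$ (l, j)))"
      unfolding entry_mult[OF B W ij] using ij by (simp add: W_def sum_distrib_left mult.left_commute)
    also have "\<dots> = (\<Sum>k<L. w k * (B * A ^\<^sub>m k) $$ (i, j))"
      by (subst sum.swap) (simp add: entry_mult[OF B pow_carrier_mat[OF A] ij] sum_distrib_left)
    finally show ?thesis .
  qed
  have right: "(W * B) $$ (i, j) = (\<Sum>k<L. w k * (A ^\<^sub>m k * B) $$ (i, j))"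
    if B: "B \<in> carrier_mat n n" and ij: "i < n" "j < n" for B i j
  proof -
    have "(W * B) $$ (i, j) = (\<Sum>l<n. \<Sum>k<L. w k * ((A ^\<^sub>m k) $$ (i, l) * B $$ (l, j)))"
      unfolding entry_mult[OF W B ij] using ij by (simp add: W_def sum_distrib_right mult.assoc)
    also have "\<dots> = (\<Sum>k<L. w k * (A ^\<^sub>m k * B) $$ (i, j))"
      by (subst sum.swap) (simp add: entry_mult[OF pow_carrier_mat[OF A] B ij] sum_distrib_left)
    finally show ?thesis .
  qed
  have "A ^\<^sub>m m = A ^\<^sub>m (Suc m) * W"
  proof (rule eq_matI)
    fix i j assume "i < dim_row (A ^\<^sub>m (Suc m) * W)" "j < dim_col (A ^\<^sub>m (Suc m) * W)"
    hence ij: "i < n" "j < n" using A W by auto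
    let ?a = "\<lambda>k. (A ^\<^sub>m k) $$ (i, j)"
    have "(\<Sum>k\<le>n * n. c k * ?a k) = (\<Sum>k\<in>{m..n * n}. c k * ?a k)"
      by (rule sum.mono_neutral_right) (use ml in \<open>force+\<close>)
    also have "\<dots> = c m * ?a m + (\<Sum>k\<in>{Suc m..n * n}. c k * ?a k)"
      using m(2) by (rule sum.atLeast_Suc_atMost)
    also have "(\<Sum>k\<in>{Suc m..n * n}. c k * ?a k) = (\<Sum>k<L. c (Suc m + k) * ?a (Suc m + k))"
      by (rule sum.reindex_bij_witness[of _ "\<lambda>k. Suc m + k" "\<lambda>k. k - Suc m"]) (auto simp: L_def)
    finally have "c m * ?a m = - (\<Sum>k<L. c (Suc m + k) * ?a (Suc m + k))"
      using c(2) ij by (simp add: eq_neg_iff_add_eq_0)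
    hence "?a m = - (\<Sum>k<L. c (Suc m + k) * ?a (Suc m + k)) / c m" using m(1) by (simp add: field_simps)
    also have "\<dots> = (\<Sum>k<L. w k * ?a (Suc m + k))"
      by (simp add: w_def sum_negf[symmetric] sum_divide_distrib)
    also have "\<dots> = (A ^\<^sub>m (Suc m) * W) $$ (i, j)"
      unfolding left[OF pow_carrier_mat[OF A] ij] pow_add_mat[OF A] ..
    finally show "?a m = (A ^\<^sub>m (Suc m) * W) $$ (i, j)" .
  qed (use A W in auto)
  moreover have "W * B = B * W" if B: "B \<in> carrier_mat n n" and "A * B = B * A" for B
  proof (rule eq_matI)
    fix i j assume "i < dim_row (B * W)" "j < dim_col (B * W)"
    hence "i < n" "j < n" using B W by auto
    thus "(W * B) $$ (i, j) = (B * W) $$ (i, j)"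
      by (simp add: left[OF B] right[OF B] commute_pow[OF A B \<open>A * B = B * A\<close>])
  qed (use B W in auto)
  ultimately show ?thesis using W by blast
qed

text \<open>Here \<open>A Z\<close> is the projection to the part where \<open>A\<close> is invertible, along the part where
\<open>A\<close> is nilpotent. That \<open>Z\<close> commutes with the centralizer of \<open>A\<close> is what lets it inherit evenness and
compatibility with \<open>x\<close> from \<open>A\<close>.\<close>

lemma fitting:
  assumes A: "(A :: 'k::field mat) \<in> carrier_mat n n"
  obtains m Z where "Z \<in> carrier_mat n n"
    "\<And>B. B \<in> carrier_mat n n \<Longrightarrow> A * B = B * A \<Longrightarrow> Z * B = B * Z"
    "(A * Z) * (A * Z) = A * Z" "A ^\<^sub>m m * (A * Z) = A ^\<^sub>m m"
proof -
  obtain m W where W: "W \<in> carrier_mat n n" "A ^\<^sub>m m = A ^\<^sub>m (Suc m) * W"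
    and cW: "\<And>B. B \<in> carrier_mat n n \<Longrightarrow> A * B = B * A \<Longrightarrow> W * B = B * W"
    using pow_relation[OF A] by blast
  have P: "A ^\<^sub>m k \<in> carrier_mat n n" "W ^\<^sub>m k \<in> carrier_mat n n" for k using A W by auto
  have WA: "W * A ^\<^sub>m k = A ^\<^sub>m k * W" for k
    by (rule cW[OF P(1)]) (rule commute_pow[OF A A refl, symmetric])
  have step: "A ^\<^sub>m m = A ^\<^sub>m (m + j) * W ^\<^sub>m j" for j
  proof (induction j)
    case (Suc j)
    have "A ^\<^sub>m (m + Suc j) * W ^\<^sub>m Suc j = (A ^\<^sub>m (Suc m) * A ^\<^sub>m j) * (W * W ^\<^sub>m j)"
      using pow_add_mat[OF A, of "Suc m" j] pow_add_mat[OF W(1), of 1 j] W(1) by simp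
    also have "\<dots> = A ^\<^sub>m (Suc m) * (A ^\<^sub>m j * W) * W ^\<^sub>m j"
      using P[of j] P(1)[of "Suc m"] W(1) by (simp only: sq_assoc mult_carrier_mat)
    also have "\<dots> = (A ^\<^sub>m (Suc m) * W) * A ^\<^sub>m j * W ^\<^sub>m j"
      unfolding WA[of j, symmetric] using P[of j] P(1)[of "Suc m"] W(1) by (simp only: sq_assoc mult_carrier_mat)
    also have "\<dots> = A ^\<^sub>m (m + j) * W ^\<^sub>m j" unfolding W(2)[symmetric] pow_add_mat[OF A] ..
    finally show ?case using Suc by simp
  qed (use A W in simp)
  let ?M = "Suc m"
  \<comment> \<open>The exponent is raised by one to have a factor \<open>A\<close> to split off, also when \<open>m = 0\<close>.\<close>
  have stepM: "A ^\<^sub>m ?M = A ^\<^sub>m (?M + j) * W ^\<^sub>m j" for j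
  proof -
    have "A ^\<^sub>m (1 + m) = A ^\<^sub>m 1 * (A ^\<^sub>m (m + j) * W ^\<^sub>m j)" unfolding pow_add_mat[OF A, of 1 m] step[of j, symmetric] ..
    also have "\<dots> = A ^\<^sub>m (1 + (m + j)) * W ^\<^sub>m j"
      unfolding pow_add_mat[OF A, of 1 "m + j"] using P[of j] P(1)[of 1] P(1)[of "m + j"] by (simp only: sq_assoc)
    finally show ?thesis by simp
  qed
  define Z where "Z = A ^\<^sub>m m * W ^\<^sub>m ?M"
  have Z: "Z \<in> carrier_mat n n" using P unfolding Z_def by (metis mult_carrier_mat)
  have AZ: "A * Z = A ^\<^sub>m ?M * W ^\<^sub>m ?M"
  proof -
    have "A * A ^\<^sub>m m = A ^\<^sub>m m * A" by (rule commute_pow[OF A A refl, symmetric])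
    hence e: "A ^\<^sub>m ?M = A * A ^\<^sub>m m" by simp
    show ?thesis unfolding Z_def e using A P(1)[of m] P(2)[of ?M] by (simp only: sq_assoc)
  qed
  have cZ: "Z * B = B * Z" if B: "B \<in> carrier_mat n n" "A * B = B * A" for B
  proof -
    have "W ^\<^sub>m ?M * B = B * W ^\<^sub>m ?M" by (rule commute_pow[OF W(1) B(1) cW[OF B]])
    hence "Z * B = A ^\<^sub>m m * B * W ^\<^sub>m ?M"
      unfolding Z_def using B(1) P(1)[of m] P(2)[of ?M] by (simp only: sq_assoc)
    also have "\<dots> = B * Z"
      unfolding Z_def commute_pow[OF A B] using B(1) P(1)[of m] P(2)[of ?M] by (simp only: sq_assoc)
    finally show ?thesis .
  qed
  have fix_: "A ^\<^sub>m ?M * (A * Z) = A ^\<^sub>m ?M"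
  proof -
    have "A ^\<^sub>m ?M * (A * Z) = A ^\<^sub>m (?M + ?M) * W ^\<^sub>m ?M"
      unfolding AZ pow_add_mat[OF A, of ?M ?M] using P(1)[of ?M] P(2)[of ?M] by (simp only: sq_assoc)
    thus ?thesis using stepM[of ?M] by simp
  qed
  have comm: "A ^\<^sub>m ?M * W ^\<^sub>m ?M = W ^\<^sub>m ?M * A ^\<^sub>m ?M"
    by (rule commute_pow[OF W(1) P(1) WA, symmetric])
  have "(A * Z) * (A * Z) = W ^\<^sub>m ?M * (A ^\<^sub>m ?M * (A * Z))"
    unfolding AZ comm using P(1)[of ?M] P(2)[of ?M] by (simp only: sq_assoc mult_carrier_mat)
  also have "\<dots> = A * Z" unfolding fix_ unfolding AZ comm ..
  finally show ?thesis using that[OF Z cZ _ fix_] by blast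
qed

end

section \<open>Even matrices and supertraces\<close>

text \<open>Among the sets of columns that span all columns, one of least size is independent.\<close>

lemma column_basis:
  fixes A :: "'a \<Rightarrow> 'b \<Rightarrow> 'k::field"
  assumes "finite J"
  obtains B \<beta> where "B \<subseteq> J" "\<And>i j. i \<in> I \<Longrightarrow> j \<in> J \<Longrightarrow> A i j = (\<Sum>b\<in>B. A i b * \<beta> b j)"
    "\<And>v. (\<And>i. i \<in> I \<Longrightarrow> (\<Sum>b\<in>B. A i b * v b) = 0) \<Longrightarrow> \<forall>b\<in>B. v b = 0"
proof -
  define spans where "spans B \<longleftrightarrow> B \<subseteq> J \<and> (\<exists>\<beta>. \<forall>i\<in>I. \<forall>j\<in>J. A i j = (\<Sum>b\<in>B. A i b * \<beta> b j))" for B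
  have "spans J"
    unfolding spans_def using assms
    by (intro conjI exI[of _ "\<lambda>b j. if b = j then 1 else 0"]) (auto simp: sum_times_delta)
  then obtain B where B: "spans B" "\<And>B'. spans B' \<Longrightarrow> card B \<le> card B'"
    using ex_has_least_nat[of spans J card] by blast
  obtain \<beta> where BJ: "B \<subseteq> J" and \<beta>: "\<And>i j. i \<in> I \<Longrightarrow> j \<in> J \<Longrightarrow> A i j = (\<Sum>b\<in>B. A i b * \<beta> b j)"
    using B(1) unfolding spans_def by blast
  have fB: "finite B" using BJ assms finite_subset by blast
  have "\<forall>b\<in>B. v b = 0" if v: "\<And>i. i \<in> I \<Longrightarrow> (\<Sum>b\<in>B. A i b * v b) = 0" for v
  proof (rule ccontr)
    assume "\<not> ?thesis"
    then obtain b0 where b0: "b0 \<in> B" "v b0 \<noteq> 0" by blast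
    let ?B = "B - {b0}"
    have col: "A i b0 = (\<Sum>b\<in>?B. A i b * (- v b / v b0))" if "i \<in> I" for i
    proof -
      have "0 = A i b0 * v b0 + (\<Sum>b\<in>?B. A i b * v b)"
        using v[OF that] sum.remove[OF fB b0(1), of "\<lambda>b. A i b * v b"] by simp
      hence "A i b0 = - (\<Sum>b\<in>?B. A i b * v b) / v b0" using b0(2) by (simp add: field_simps eq_neg_iff_add_eq_0)
      thus ?thesis by (simp add: sum_negf[symmetric] sum_divide_distrib)
    qed
    have "spans ?B"
      unfolding spans_def
    proof (intro conjI exI ballI)
      show "?B \<subseteq> J" using BJ by blast
      fix i j assume ij: "i \<in> I" "j \<in> J"
      have "A i j = A i b0 * \<beta> b0 j + (\<Sum>b\<in>?B. A i b * \<beta> b j)"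
        using \<beta>[OF ij] sum.remove[OF fB b0(1), of "\<lambda>b. A i b * \<beta> b j"] by simp
      also have "\<dots> = (\<Sum>b\<in>?B. A i b * (- v b / v b0)) * \<beta> b0 j + (\<Sum>b\<in>?B. A i b * \<beta> b j)"
        using col[OF ij(1)] by simp
      also have "\<dots> = (\<Sum>b\<in>?B. A i b * (\<beta> b j - v b / v b0 * \<beta> b0 j))"
        unfolding sum_distrib_right sum.distrib[symmetric] by (intro sum.cong refl) (simp add: algebra_simps)
      finally show "A i j = (\<Sum>b\<in>?B. A i b * (\<beta> b j - v b / v b0 * \<beta> b0 j))" .
    qed
    hence "card B \<le> card ?B" by (rule B(2))
    thus False using card_Diff1_less[OF fB b0(1)] by linarith
  qed
  thus ?thesis using that[OF BJ \<beta>] by blast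
qed

lemma even_mapsD:
  assumes "T \<in> even_maps V W"
  shows "T \<in> carrier_mat (vdim W) (vdim V)"
    "\<And>i j. i < vdim W \<Longrightarrow> j < vdim V \<Longrightarrow> T $$ (i, j) \<noteq> 0 \<Longrightarrow> vodd W i = vodd V j"
  using assms unfolding even_maps_def by auto

lemma odd_opsD:
  assumes "T \<in> odd_ops V"
  shows "T \<in> carrier_mat (vdim V) (vdim V)"
    "\<And>i j. i < vdim V \<Longrightarrow> j < vdim V \<Longrightarrow> T $$ (i, j) \<noteq> 0 \<Longrightarrow> vodd V i \<noteq> vodd V j"
  using assms unfolding odd_ops_def by auto

lemma nonzero_entry_mult:
  assumes "A \<in> carrier_mat r n" "B \<in> carrier_mat n c" "i < r" "j < c" "(A * B) $$ (i, j) \<noteq> (0 :: 'k::field)"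
  obtains l where "l < n" "A $$ (i, l) \<noteq> 0" "B $$ (l, j) \<noteq> 0"
  using assms(5) unfolding entry_mult[OF assms(1-4)]
  by (auto elim!: sum.not_neutral_contains_not_neutral)

lemma even_maps_mult:
  fixes A :: "'k::field mat"
  assumes A: "A \<in> even_maps D V" and B: "B \<in> even_maps C D"
  shows "A * B \<in> even_maps C V"
  unfolding even_maps_def
proof (intro CollectI conjI allI impI)
  show "A * B \<in> carrier_mat (vdim V) (vdim C)"
    using even_mapsD(1)[OF A] even_mapsD(1)[OF B] by (rule mult_carrier_mat)
  fix i j assume ij: "i < vdim V" "j < vdim C" "(A * B) $$ (i, j) \<noteq> 0"
  obtain l where "l < vdim D" "A $$ (i, l) \<noteq> 0" "B $$ (l, j) \<noteq> 0"
    by (rule nonzero_entry_mult[OF even_mapsD(1)[OF A] even_mapsD(1)[OF B] ij])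
  thus "vodd V i = vodd C j" using even_mapsD(2)[OF A ij(1)] even_mapsD(2)[OF B _ ij(2)] by metis
qed

lemma even_odd_mult:
  fixes A :: "'k::field mat"
  assumes A: "A \<in> even_maps D V" and X: "X \<in> odd_ops D" and B: "B \<in> even_maps V D"
  shows "A * X * B \<in> odd_ops V"
  unfolding odd_ops_def
proof (intro CollectI conjI allI impI)
  note c = even_mapsD(1)[OF A] odd_opsD(1)[OF X] even_mapsD(1)[OF B]
  have AX: "A * X \<in> carrier_mat (vdim V) (vdim D)" using c(1,2) by (rule mult_carrier_mat)
  show "A * X * B \<in> carrier_mat (vdim V) (vdim V)" using AX c(3) by (rule mult_carrier_mat)
  fix i j assume ij: "i < vdim V" "j < vdim V" "(A * X * B) $$ (i, j) \<noteq> 0"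
  obtain l where l: "l < vdim D" "(A * X) $$ (i, l) \<noteq> 0" "B $$ (l, j) \<noteq> 0"
    by (rule nonzero_entry_mult[OF AX c(3) ij])
  obtain k where "k < vdim D" "A $$ (i, k) \<noteq> 0" "X $$ (k, l) \<noteq> 0"
    by (rule nonzero_entry_mult[OF c(1,2) ij(1) l(1,2)])
  thus "vodd V i \<noteq> vodd V j"
    using even_mapsD(2)[OF A ij(1)] odd_opsD(2)[OF X _ l(1)] even_mapsD(2)[OF B l(1) ij(2) l(3)] by metis
qed

lemma one_even: "1\<^sub>m (vdim V) \<in> even_maps V V"
  unfolding even_maps_def by auto

lemma odd_odd_mult:
  fixes A :: "'k::field mat"
  assumes A: "A \<in> odd_ops V" and B: "B \<in> odd_ops V"
  shows "A * B \<in> even_maps V V"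
  unfolding even_maps_def
proof (intro CollectI conjI allI impI)
  show "A * B \<in> carrier_mat (vdim V) (vdim V)"
    using odd_opsD(1)[OF A] odd_opsD(1)[OF B] by (rule mult_carrier_mat)
  fix i j assume ij: "i < vdim V" "j < vdim V" "(A * B) $$ (i, j) \<noteq> 0"
  obtain l where "l < vdim V" "A $$ (i, l) \<noteq> 0" "B $$ (l, j) \<noteq> 0"
    by (rule nonzero_entry_mult[OF odd_opsD(1)[OF A] odd_opsD(1)[OF B] ij])
  thus "vodd V i = vodd V j" using odd_opsD(2)[OF A ij(1)] odd_opsD(2)[OF B _ ij(2)] by metis
qed

lemma supertrace_mult:
  fixes A :: "'k::field mat"
  assumes A: "A \<in> even_maps D V" and B: "B \<in> even_maps V D"
  shows "supertrace V (A * B) = supertrace D (B * A)"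
proof -
  note c = even_mapsD(1)[OF A] even_mapsD(1)[OF B]
  have "supertrace V (A * B) = (\<Sum>i<vdim V. \<Sum>l<vdim D. ksign (vodd V i) * (A $$ (i, l) * B $$ (l, i)))"
    unfolding supertrace_def by (intro sum.cong refl) (simp add: entry_mult[OF c] sum_distrib_left)
  also have "\<dots> = (\<Sum>i<vdim V. \<Sum>l<vdim D. ksign (vodd D l) * (B $$ (l, i) * A $$ (i, l)))"
  proof (intro sum.cong refl)
    fix i l assume "i \<in> {..<vdim V}" "l \<in> {..<vdim D}"
    thus "ksign (vodd V i) * (A $$ (i, l) * B $$ (l, i)) = ksign (vodd D l) * (B $$ (l, i) * A $$ (i, l))"
      using even_mapsD(2)[OF A, of i l] by (cases "A $$ (i, l) = 0") auto
  qed
  also have "\<dots> = (\<Sum>l<vdim D. \<Sum>i<vdim V. ksign (vodd D l) * (B $$ (l, i) * A $$ (i, l)))" by (rule sum.swap)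
  also have "\<dots> = supertrace D (B * A)"
    unfolding supertrace_def by (intro sum.cong refl) (simp add: entry_mult[OF c(2,1)] sum_distrib_left)
  finally show ?thesis .
qed

lemma supertrace_odd_mult:
  fixes A :: "'k::field mat"
  assumes A: "A \<in> odd_ops V" and B: "B \<in> odd_ops V"
  shows "supertrace V (A * B) = - supertrace V (B * A)"
proof -
  note c = odd_opsD(1)[OF A] odd_opsD(1)[OF B]
  have "supertrace V (A * B) = (\<Sum>i<vdim V. \<Sum>l<vdim V. ksign (vodd V i) * (A $$ (i, l) * B $$ (l, i)))"
    unfolding supertrace_def by (intro sum.cong refl) (simp add: entry_mult[OF c] sum_distrib_left)
  also have "\<dots> = (\<Sum>i<vdim V. \<Sum>l<vdim V. - (ksign (vodd V l) * (B $$ (l, i) * A $$ (i, l))))"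
  proof (intro sum.cong refl)
    fix i l assume il: "i \<in> {..<vdim V}" "l \<in> {..<vdim V}"
    show "ksign (vodd V i) * (A $$ (i, l) * B $$ (l, i)) = - (ksign (vodd V l) * (B $$ (l, i) * A $$ (i, l)))"
    proof (cases "A $$ (i, l) = 0")
      case False
      hence "vodd V i \<noteq> vodd V l" using odd_opsD(2)[OF A, of i l] il by auto
      thus ?thesis by (cases "vodd V i"; cases "vodd V l") auto
    qed simp
  qed
  also have "\<dots> = - (\<Sum>l<vdim V. \<Sum>i<vdim V. ksign (vodd V l) * (B $$ (l, i) * A $$ (i, l)))"
    by (subst sum.swap) (simp add: sum_negf)
  also have "\<dots> = - supertrace V (B * A)"
    unfolding supertrace_def by (intro arg_cong[of _ _ uminus] sum.cong refl) (simp add: entry_mult[OF c(2,1)] sum_distrib_left)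
  finally show ?thesis .
qed

lemma supertrace_linear:
  assumes "A \<in> carrier_mat (vdim V) (vdim V)" "B \<in> carrier_mat (vdim V) (vdim V)"
  shows "supertrace V (A + B) = supertrace V A + supertrace V (B :: 'k::field mat)"
    "supertrace V (A - B) = supertrace V A - supertrace V B"
    "supertrace V (c \<cdot>\<^sub>m A) = c * supertrace V A"
  using assms unfolding supertrace_def
  by (simp_all add: algebra_simps sum.distrib sum_subtractf sum_distrib_left)

lemma supertrace_one: "supertrace V (1\<^sub>m (vdim V)) = (of_int (superdim V) :: 'k::field)"
proof -
  have "supertrace V (1\<^sub>m (vdim V)) = (\<Sum>i<vdim V. if vodd V i then - 1 else (1 :: 'k))"
    unfolding supertrace_def by (intro sum.cong refl) (auto simp: ksign_def)
  also have "\<dots> = of_int (superdim V)"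
  proof -
    have "{..<vdim V} \<inter> {x. vodd V x} = {i. i < vdim V \<and> vodd V i}"
      "{..<vdim V} \<inter> - {x. vodd V x} = {i. i < vdim V \<and> \<not> vodd V i}" by auto
    thus ?thesis by (simp add: sum.If_cases superdim_def)
  qed
  finally show ?thesis .
qed

text \<open>The columns of \<open>\<alpha>\<close> are a basis of the image chosen among the columns of \<open>T\<close>, which are
homogeneous; this makes \<open>\<alpha>\<close> even, and gives \<open>\<sigma>\<close>, which selects these columns. The last condition says
that \<open>T\<close> is injective if it has full rank.\<close>

lemma even_rank_factorization:
  fixes T :: "'k::field mat" and V :: "'k mrep"
  assumes T: "T \<in> even_maps V V"
  obtains D :: "'k mrep" and \<alpha> \<beta> \<sigma> where "\<alpha> \<in> even_maps D V" "\<beta> \<in> even_maps V D"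
    "\<sigma> \<in> carrier_mat (vdim V) (vdim D)" "T = \<alpha> * \<beta>" "\<alpha> = T * \<sigma>" "vdim D \<le> vdim V"
    "\<And>S k. S \<in> carrier_mat (vdim D) k \<Longrightarrow> \<alpha> * S = 0\<^sub>m (vdim V) k \<Longrightarrow> S = 0\<^sub>m (vdim D) k"
    "\<And>S k. vdim D = vdim V \<Longrightarrow> S \<in> carrier_mat (vdim V) k \<Longrightarrow> T * S = 0\<^sub>m (vdim V) k \<Longrightarrow> S = 0\<^sub>m (vdim V) k"
proof -
  let ?n = "vdim V" and ?p = "vodd V"
  note Tc = even_mapsD(1)[OF T] and Te = even_mapsD(2)[OF T]
  obtain B \<beta> where B: "B \<subseteq> {..<?n}"
    and \<beta>: "\<And>i j. i \<in> {..<?n} \<Longrightarrow> j \<in> {..<?n} \<Longrightarrow> T $$ (i, j) = (\<Sum>b\<in>B. T $$ (i, b) * \<beta> b j)"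
    and ind: "\<And>v. (\<And>i. i \<in> {..<?n} \<Longrightarrow> (\<Sum>b\<in>B. T $$ (i, b) * v b) = 0) \<Longrightarrow> \<forall>b\<in>B. v b = 0"
    by (rule column_basis[of "{..<?n}" "{..<?n}" "\<lambda>i j. T $$ (i, j)"]) auto
  \<comment> \<open>Components of the wrong parity contribute nothing to \<open>T\<close>, so they can be dropped from \<open>\<beta>\<close>.\<close>
  define \<beta>' where "\<beta>' b j = (if ?p b = ?p j then \<beta> b j else 0)" for b j
  have \<beta>': "T $$ (i, j) = (\<Sum>b\<in>B. T $$ (i, b) * \<beta>' b j)" if ij: "i < ?n" "j < ?n" for i j
  proof (cases "?p i = ?p j")
    case True
    have "(\<Sum>b\<in>B. T $$ (i, b) * \<beta> b j) = (\<Sum>b\<in>B. T $$ (i, b) * \<beta>' b j)"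
    proof (rule sum.cong[OF refl])
      fix b assume "b \<in> B"
      hence "b < ?n" using B by auto
      thus "T $$ (i, b) * \<beta> b j = T $$ (i, b) * \<beta>' b j"
        using Te[OF ij(1), of b] True by (cases "T $$ (i, b) = 0") (auto simp: \<beta>'_def)
    qed
    thus ?thesis using \<beta>[of i j] ij by simp
  next
    case False
    have "(\<Sum>b\<in>B. T $$ (i, b) * \<beta>' b j) = 0"
    proof (intro sum.neutral ballI)
      fix b assume "b \<in> B"
      hence "b < ?n" using B by auto
      thus "T $$ (i, b) * \<beta>' b j = 0"
        using Te[OF ij(1), of b] False by (cases "T $$ (i, b) = 0") (auto simp: \<beta>'_def)
    qed
    thus ?thesis using Te[OF ij] False by auto
  qed
  have fB: "finite B" using B finite_subset by blast
  define b where "b = card B"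
  obtain e where e: "bij_betw e {..<b} B"
    using ex_bij_betw_nat_finite[OF fB] unfolding b_def atLeast0LessThan by blast
  have eB: "e k \<in> B" "e k < ?n" if "k < b" for k using e B that by (auto dest: bij_betwE)
  have sm: "(\<Sum>k<b. F (e k)) = (\<Sum>c\<in>B. F c)" for F :: "_ \<Rightarrow> 'k" by (rule sum.reindex_bij_betw[OF e])
  define D where "D = \<lparr>vdim = b, vodd = (\<lambda>k. ?p (e k)), vop = 0\<^sub>m b b :: 'k mat\<rparr>"
  define \<alpha> where "\<alpha> = mat ?n b (\<lambda>(i, k). T $$ (i, e k))"
  define \<gamma> where "\<gamma> = mat b ?n (\<lambda>(k, j). \<beta>' (e k) j)"
  define \<sigma> where "\<sigma> = mat ?n b (\<lambda>(i, k). if i = e k then 1 else (0 :: 'k))"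
  have Dd: "vdim D = b" by (simp add: D_def)
  have carr: "\<alpha> \<in> carrier_mat ?n b" "\<gamma> \<in> carrier_mat b ?n" "\<sigma> \<in> carrier_mat ?n b"
    by (auto simp: \<alpha>_def \<gamma>_def \<sigma>_def)
  show ?thesis
  proof (rule that[of \<alpha> D \<gamma> \<sigma>])
    show "\<alpha> \<in> even_maps D V" using Te eB by (auto simp: even_maps_def \<alpha>_def D_def)
    show "\<gamma> \<in> even_maps V D" by (auto simp: even_maps_def \<gamma>_def D_def \<beta>'_def)
    show "\<sigma> \<in> carrier_mat ?n (vdim D)" using carr Dd by simp
    show "T = \<alpha> * \<gamma>"
    proof (rule eq_matI)
      fix i j assume "i < dim_row (\<alpha> * \<gamma>)" "j < dim_col (\<alpha> * \<gamma>)"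
      hence ij: "i < ?n" "j < ?n" using carr by auto
      have "(\<alpha> * \<gamma>) $$ (i, j) = (\<Sum>k<b. (\<lambda>c. T $$ (i, c) * \<beta>' c j) (e k))"
        unfolding entry_mult[OF carr(1,2) ij] using ij by (simp add: \<alpha>_def \<gamma>_def)
      thus "T $$ (i, j) = (\<alpha> * \<gamma>) $$ (i, j)" using sm[of "\<lambda>c. T $$ (i, c) * \<beta>' c j"] \<beta>'[OF ij] by simp
    qed (use Tc carr in auto)
    show "\<alpha> = T * \<sigma>"
    proof (rule eq_matI)
      fix i k assume "i < dim_row (T * \<sigma>)" "k < dim_col (T * \<sigma>)"
      hence ik: "i < ?n" "k < b" using carr Tc by auto
      have "(T * \<sigma>) $$ (i, k) = (\<Sum>l<?n. T $$ (i, l) * (if l = e k then 1 else 0))"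
        unfolding entry_mult[OF Tc carr(3) ik] using ik by (simp add: \<sigma>_def)
      also have "\<dots> = T $$ (i, e k)" using eB(2)[OF ik(2)] by (intro sum_times_delta) auto
      finally show "\<alpha> $$ (i, k) = (T * \<sigma>) $$ (i, k)" using ik by (simp add: \<alpha>_def)
    qed (use Tc carr in auto)
    show "vdim D \<le> ?n" unfolding Dd b_def using card_mono[OF _ B] by simp
    fix S :: "'k mat" and k
    {
      assume "S \<in> carrier_mat (vdim D) k" and 0: "\<alpha> * S = 0\<^sub>m ?n k"
      hence S: "S \<in> carrier_mat b k" by (simp add: Dd)
      have inv: "inv_into {..<b} e (e l) = l" if "l < b" for l
        using bij_betw_inv_into_left[OF e] that by simp
      show "S = 0\<^sub>m (vdim D) k"
        unfolding Dd
      proof (rule eq_matI)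
        fix l j assume "l < dim_row (0\<^sub>m b k :: 'k mat)" "j < dim_col (0\<^sub>m b k :: 'k mat)"
        hence lj: "l < b" "j < k" by auto
        have "\<forall>c\<in>B. S $$ (inv_into {..<b} e c, j) = 0"
        proof (rule ind)
          fix i assume i: "i \<in> {..<?n}"
          have "(\<Sum>c\<in>B. T $$ (i, c) * S $$ (inv_into {..<b} e c, j)) =
              (\<Sum>l<b. T $$ (i, e l) * S $$ (l, j))"
            unfolding sm[symmetric] by (intro sum.cong refl) (simp add: inv)
          also have "\<dots> = (\<alpha> * S) $$ (i, j)"
            using i entry_mult[OF carr(1) S _ lj(2), of i] by (simp add: \<alpha>_def)
          finally show "(\<Sum>c\<in>B. T $$ (i, c) * S $$ (inv_into {..<b} e c, j)) = 0" using i lj by (simp add: 0)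
        qed
        thus "S $$ (l, j) = 0\<^sub>m b k $$ (l, j)" using eB(1)[OF lj(1)] inv[OF lj(1)] lj by auto
      qed (use S in auto)
    }
    {
      assume bn: "vdim D = ?n" and S: "S \<in> carrier_mat ?n k" and 0: "T * S = 0\<^sub>m ?n k"
      have Bn: "B = {..<?n}" using B bn by (intro card_subset_eq) (auto simp: Dd b_def)
      show "S = 0\<^sub>m ?n k"
      proof (rule eq_matI)
        fix l j assume "l < dim_row (0\<^sub>m ?n k :: 'k mat)" "j < dim_col (0\<^sub>m ?n k :: 'k mat)"
        hence lj: "l < ?n" "j < k" by auto
        have "\<forall>c\<in>B. S $$ (c, j) = 0"
        proof (rule ind)
          fix i assume i: "i \<in> {..<?n}"
          have "(\<Sum>c\<in>B. T $$ (i, c) * S $$ (c, j)) = (T * S) $$ (i, j)"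
            using i by (simp add: entry_mult[OF Tc S _ lj(2)] Bn)
          thus "(\<Sum>c\<in>B. T $$ (i, c) * S $$ (c, j)) = 0" using i lj by (simp add: 0)
        qed
        thus "S $$ (l, j) = 0\<^sub>m ?n k $$ (l, j)" using lj Bn by auto
      qed (use S in auto)
    }
  qed
qed

text \<open>A nilpotent \<open>T\<close> is not injective unless the space is zero, so it factors as \<open>\<alpha> \<beta>\<close> through
a smaller space. There \<open>\<beta> \<alpha>\<close> is again nilpotent and has the same supertrace.\<close>

lemma supertrace_nilpotent:
  fixes T :: "'k::field mat" and V :: "'k mrep"
  assumes "T \<in> even_maps V V" "T ^\<^sub>m m = 0\<^sub>m (vdim V) (vdim V)"
  shows "supertrace V T = 0"
  using assms
proof (induction "vdim V" arbitrary: V T m rule: less_induct)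
  case less
  let ?n = "vdim V"
  note Tc = even_mapsD(1)[OF less.prems(1)]
  show ?case
  proof (cases "?n = 0")
    case True
    thus ?thesis by (simp add: supertrace_def)
  next
    case False
    obtain D :: "'k mrep" and \<alpha> \<beta> \<sigma> where F: "\<alpha> \<in> even_maps D V" "\<beta> \<in> even_maps V D"
      "T = \<alpha> * \<beta>" "vdim D \<le> ?n"
      "\<And>S k. vdim D = ?n \<Longrightarrow> S \<in> carrier_mat ?n k \<Longrightarrow> T * S = 0\<^sub>m ?n k \<Longrightarrow> S = 0\<^sub>m ?n k"
      by (rule even_rank_factorization[OF less.prems(1)]) blast
    note c = even_mapsD(1)[OF F(1)] even_mapsD(1)[OF F(2)]
    have "vdim D \<noteq> ?n"
    proof
      assume eq: "vdim D = ?n"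
      have nz: "T ^\<^sub>m k \<noteq> 0\<^sub>m ?n ?n" for k
      proof (induction k)
        case 0
        show ?case
        proof
          assume "T ^\<^sub>m 0 = 0\<^sub>m ?n ?n"
          hence "(1\<^sub>m ?n :: 'k mat) $$ (0, 0) = 0\<^sub>m ?n ?n $$ (0, 0)" using Tc by simp
          thus False using False by simp
        qed
      next
        case (Suc k)
        have "T ^\<^sub>m Suc k = T * T ^\<^sub>m k" using commute_pow[OF Tc Tc refl] by simp
        thus ?case using F(5)[OF eq pow_carrier_mat[OF Tc, of k]] Suc by auto
      qed
      thus False using less.prems(2) by blast
    qed
    hence lt: "vdim D < ?n" using F(4) by simp
    have ev: "\<beta> * \<alpha> \<in> even_maps D D" by (rule even_maps_mult[OF F(2,1)])
    have pw: "(\<beta> * \<alpha>) ^\<^sub>m Suc k = \<beta> * T ^\<^sub>m k * \<alpha>" for k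
    proof (induction k)
      case 0
      thus ?case using c Tc by simp
    next
      case (Suc k)
      have Tk: "T ^\<^sub>m k \<in> carrier_mat ?n ?n" using Tc by simp
      have bT: "\<beta> * T ^\<^sub>m k \<in> carrier_mat (vdim D) ?n" using c(2) Tk by (rule mult_carrier_mat)
      have "(\<beta> * \<alpha>) ^\<^sub>m Suc (Suc k) = (\<beta> * T ^\<^sub>m k * \<alpha>) * (\<beta> * \<alpha>)"
        by (subst pow_mat.simps(2)) (simp only: Suc)
      also have "\<dots> = \<beta> * T ^\<^sub>m k * (\<alpha> * (\<beta> * \<alpha>))"
        by (rule assoc_mult_mat[OF bT c(1) mult_carrier_mat[OF c(2,1)]])
      also have "\<alpha> * (\<beta> * \<alpha>) = T * \<alpha>" unfolding F(3) by (rule assoc_mult_mat[OF c c(1), symmetric])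
      also have "\<beta> * T ^\<^sub>m k * (T * \<alpha>) = \<beta> * T ^\<^sub>m k * T * \<alpha>"
        by (rule assoc_mult_mat[OF bT Tc c(1), symmetric])
      also have "\<beta> * T ^\<^sub>m k * T = \<beta> * T ^\<^sub>m Suc k" using assoc_mult_mat[OF c(2) Tk Tc] by simp
      finally show ?case .
    qed
    have "(\<beta> * \<alpha>) ^\<^sub>m Suc m = 0\<^sub>m (vdim D) (vdim D)" unfolding pw less.prems(2) using c by simp
    hence "supertrace D (\<beta> * \<alpha>) = 0" by (rule less.hyps[OF lt ev])
    thus ?thesis unfolding F(3) supertrace_mult[OF F(1,2)] .
  qed
qed

section \<open>Summands in Rep(m)\<close>

lemma mhomD:
  assumes "T \<in> mhom C D"
  shows "T \<in> even_maps C D" "T \<in> carrier_mat (vdim D) (vdim C)" "T * vop C = vop D * T"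
  using assms unfolding mhom_def even_maps_def by auto

lemma Rep_mD: "C \<in> Rep_m \<Longrightarrow> vop C \<in> odd_ops C" "C \<in> Rep_m \<Longrightarrow> vop C \<in> carrier_mat (vdim C) (vdim C)"
  unfolding Rep_m_def odd_ops_def by auto

lemma mhom_mult:
  assumes "A \<in> mhom D E" "B \<in> mhom C D" "C \<in> Rep_m" "D \<in> Rep_m" "E \<in> Rep_m"
  shows "A * B \<in> mhom C E"
  unfolding mhom_def
proof (intro CollectI conjI even_maps_mult[OF mhomD(1)[OF assms(1)] mhomD(1)[OF assms(2)]])
  note c = mhomD(2)[OF assms(1)] mhomD(2)[OF assms(2)]
    and x = Rep_mD(2)[OF assms(3)] Rep_mD(2)[OF assms(4)] Rep_mD(2)[OF assms(5)]
  have "A * B * vop C = A * (B * vop C)" by (rule assoc_mult_mat[OF c x(1)])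
  also have "\<dots> = A * vop D * B" unfolding mhomD(3)[OF assms(2)] by (rule assoc_mult_mat[OF c(1) x(2) c(2), symmetric])
  also have "\<dots> = vop E * (A * B)" unfolding mhomD(3)[OF assms(1)] by (rule assoc_mult_mat[OF x(3) c])
  finally show "A * B * vop C = vop E * (A * B)" .
qed

lemma mhom_one: "C \<in> Rep_m \<Longrightarrow> 1\<^sub>m (vdim C) \<in> mhom C C"
  unfolding mhom_def using one_even Rep_mD(2)[of C] by auto

lemma mhom_zero: "C \<in> Rep_m \<Longrightarrow> D \<in> Rep_m \<Longrightarrow> 0\<^sub>m (vdim D) (vdim C) \<in> mhom C D"
  unfolding mhom_def even_maps_def using Rep_mD(2)[of C] Rep_mD(2)[of D] by auto

lemma mhom_add_minus:
  assumes A: "A \<in> mhom C D" and B: "B \<in> mhom C D" and CD: "C \<in> Rep_m" "D \<in> Rep_m"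
  shows "A + B \<in> mhom C D" "A - B \<in> mhom C D"
proof -
  note c = mhomD(2)[OF A] mhomD(2)[OF B] and x = Rep_mD(2)[OF CD(1)] Rep_mD(2)[OF CD(2)]
  have e: "vodd D i = vodd C j"
    if "A $$ (i, j) \<noteq> 0 \<or> B $$ (i, j) \<noteq> 0" "i < vdim D" "j < vdim C" for i j
    using even_mapsD(2)[OF mhomD(1)[OF A]] even_mapsD(2)[OF mhomD(1)[OF B]] that by blast
  have "(A + B) * vop C = vop D * (A + B)"
    using c x by (simp add: add_mult_distrib_mat[OF c x(1)] mult_add_distrib_mat[OF x(2) c] mhomD(3)[OF A] mhomD(3)[OF B])
  moreover have "vodd D i = vodd C j" if "i < vdim D" "j < vdim C" "(A + B) $$ (i, j) \<noteq> 0" for i j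
    using e[of i j] that c by fastforce
  ultimately show "A + B \<in> mhom C D" unfolding mhom_def even_maps_def using c by auto
  have "(A - B) * vop C = vop D * (A - B)"
    using c x by (simp add: minus_mult_distrib_mat[OF c x(1)] mult_minus_distrib_mat[OF x(2) c] mhomD(3)[OF A] mhomD(3)[OF B])
  moreover have "vodd D i = vodd C j" if "i < vdim D" "j < vdim C" "(A - B) $$ (i, j) \<noteq> 0" for i j
    using e[of i j] that c by fastforce
  ultimately show "A - B \<in> mhom C D" unfolding mhom_def even_maps_def using c by auto
qed

lemma mhom_scalar:
  assumes C: "C \<in> Rep_m"
  shows "c \<cdot>\<^sub>m 1\<^sub>m (vdim C) \<in> mhom C (C :: 'k::field mrep)"
  unfolding mhom_def even_maps_def using Rep_mD(2)[OF C]
  by (auto simp: mult_smult_assoc_mat[of _ "vdim C" "vdim C"] mult_smult_distrib[of _ "vdim C" "vdim C"] split: if_splits)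

lemma minus_eq_zero_mat:
  fixes A :: "'k::field mat"
  assumes "A - B = 0\<^sub>m r s" "A \<in> carrier_mat r s" "B \<in> carrier_mat r s"
  shows "A = B"
proof (rule eq_matI)
  fix i j assume ij: "i < dim_row B" "j < dim_col B"
  have "(A - B) $$ (i, j) = 0\<^sub>m r s $$ (i, j)" unfolding assms(1) ..
  thus "A $$ (i, j) = B $$ (i, j)" using assms(2,3) ij by simp
qed (use assms(2,3) in auto)

text \<open>The image of \<open>\<epsilon>\<close>, with the operator compressed to it.\<close>

lemma split_idempotent:
  fixes C :: "'k::field mrep"
  assumes C: "C \<in> Rep_m" and \<epsilon>: "\<epsilon> \<in> mhom C C" "\<epsilon> * \<epsilon> = \<epsilon>"
  obtains D \<alpha> \<beta> where "D \<in> Rep_m" "\<alpha> \<in> mhom D C" "\<beta> \<in> mhom C D" "\<alpha> * \<beta> = \<epsilon>" "\<beta> * \<alpha> = 1\<^sub>m (vdim D)"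
    "\<epsilon> \<noteq> 1\<^sub>m (vdim C) \<Longrightarrow> vdim D < vdim C"
proof -
  let ?n = "vdim C" and ?X = "vop C"
  obtain D0 :: "'k mrep" and \<alpha> \<beta> \<sigma> where F: "\<alpha> \<in> even_maps D0 C" "\<beta> \<in> even_maps C D0"
    "\<sigma> \<in> carrier_mat ?n (vdim D0)" "\<epsilon> = \<alpha> * \<beta>" "\<alpha> = \<epsilon> * \<sigma>" "vdim D0 \<le> ?n"
    "\<And>S k. S \<in> carrier_mat (vdim D0) k \<Longrightarrow> \<alpha> * S = 0\<^sub>m ?n k \<Longrightarrow> S = 0\<^sub>m (vdim D0) k"
    "\<And>S k. vdim D0 = ?n \<Longrightarrow> S \<in> carrier_mat ?n k \<Longrightarrow> \<epsilon> * S = 0\<^sub>m ?n k \<Longrightarrow> S = 0\<^sub>m ?n k"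
    by (rule even_rank_factorization[OF mhomD(1)[OF \<epsilon>(1)]]) blast
  let ?d = "vdim D0"
  note ca = even_mapsD(1)[OF F(1)] and cb = even_mapsD(1)[OF F(2)] and ce = mhomD(2)[OF \<epsilon>(1)]
    and cx = Rep_mD(2)[OF C]
  have ea: "\<epsilon> * \<alpha> = \<alpha>"
  proof -
    have "\<epsilon> * (\<epsilon> * \<sigma>) = (\<epsilon> * \<epsilon>) * \<sigma>" by (rule assoc_mult_mat[OF ce ce F(3), symmetric])
    thus ?thesis unfolding \<epsilon>(2) F(5)[symmetric] .
  qed
  have ba: "\<beta> * \<alpha> = 1\<^sub>m ?d"
  proof -
    have cba: "\<beta> * \<alpha> \<in> carrier_mat ?d ?d" using cb ca by (rule mult_carrier_mat)
    have "\<alpha> * (\<beta> * \<alpha> - 1\<^sub>m ?d) = \<alpha> * (\<beta> * \<alpha>) - \<alpha> * 1\<^sub>m ?d"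
      by (rule mult_minus_distrib_mat[OF ca cba]) simp
    also have "\<alpha> * (\<beta> * \<alpha>) = \<alpha>"
      using assoc_mult_mat[OF ca cb ca] ea unfolding F(4) by simp
    also have "\<alpha> - \<alpha> * 1\<^sub>m ?d = 0\<^sub>m ?n ?d" using ca by simp
    finally have z: "\<beta> * \<alpha> - 1\<^sub>m ?d = 0\<^sub>m ?d ?d" by (intro F(7)) (use cba in auto)
    show ?thesis
    by (rule minus_eq_zero_mat[OF z cba one_carrier_mat])
  qed
  have be: "\<beta> * \<epsilon> = \<beta>"
    unfolding F(4) using assoc_mult_mat[OF cb ca cb] ba cb by simp
  define D where "D = D0\<lparr>vop := \<beta> * ?X * \<alpha>\<rparr>"
  have D: "vdim D = ?d" "vodd D = vodd D0" "vop D = \<beta> * ?X * \<alpha>" by (simp_all add: D_def)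
  have em: "even_maps D C = even_maps D0 C" "even_maps C D = even_maps C D0" "odd_ops D = odd_ops D0"
    unfolding even_maps_def odd_ops_def D by auto
  have bX: "\<beta> * ?X \<in> carrier_mat ?d ?n" using cb cx by (rule mult_carrier_mat)
  have Xa: "?X * \<alpha> \<in> carrier_mat ?n ?d" using cx ca by (rule mult_carrier_mat)
  have "vop D \<in> odd_ops D" unfolding em D by (rule even_odd_mult[OF F(2) Rep_mD(1)[OF C] F(1)])
  hence DR: "D \<in> Rep_m" by (simp add: Rep_m_def)
  have "\<alpha> * vop D = ?X * \<alpha>"
  proof -
    have "\<alpha> * (\<beta> * ?X * \<alpha>) = \<alpha> * (\<beta> * (?X * \<alpha>))" using assoc_mult_mat[OF cb cx ca] by simp
    also have "\<dots> = \<epsilon> * (?X * \<alpha>)" unfolding F(4) by (rule assoc_mult_mat[OF ca cb Xa, symmetric])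
    also have "\<dots> = (\<epsilon> * ?X) * \<alpha>" by (rule assoc_mult_mat[OF ce cx ca, symmetric])
    also have "\<dots> = ?X * (\<epsilon> * \<alpha>)" unfolding mhomD(3)[OF \<epsilon>(1)] by (rule assoc_mult_mat[OF cx ce ca])
    finally show ?thesis unfolding D ea .
  qed
  hence a: "\<alpha> \<in> mhom D C" unfolding mhom_def em using F(1) by simp
  have "\<beta> * ?X = vop D * \<beta>"
  proof -
    have "\<beta> * ?X * \<alpha> * \<beta> = \<beta> * ?X * \<epsilon>" unfolding F(4) by (rule assoc_mult_mat[OF bX ca cb])
    also have "\<dots> = \<beta> * (?X * \<epsilon>)" by (rule assoc_mult_mat[OF cb cx ce])
    also have "\<dots> = \<beta> * \<epsilon> * ?X" unfolding mhomD(3)[OF \<epsilon>(1), symmetric] by (rule assoc_mult_mat[OF cb ce cx, symmetric])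
    finally show ?thesis unfolding D be by simp
  qed
  hence b: "\<beta> \<in> mhom C D" unfolding mhom_def em using F(2) by simp
  show ?thesis
  proof (rule that[OF DR a b F(4)[symmetric]])
    show "\<beta> * \<alpha> = 1\<^sub>m (vdim D)" by (simp add: D ba)
    assume ne: "\<epsilon> \<noteq> 1\<^sub>m ?n"
    have "?d \<noteq> ?n"
    proof
      assume eq: "?d = ?n"
      have "\<epsilon> * (\<epsilon> - 1\<^sub>m ?n) = \<epsilon> * \<epsilon> - \<epsilon> * 1\<^sub>m ?n" by (rule mult_minus_distrib_mat[OF ce ce]) simp
      also have "\<dots> = 0\<^sub>m ?n ?n" unfolding \<epsilon>(2) using ce by simp
      finally have z0: "\<epsilon> * (\<epsilon> - 1\<^sub>m ?n) = 0\<^sub>m ?n ?n" .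
      have "\<epsilon> - 1\<^sub>m ?n \<in> carrier_mat ?n ?n" by (rule minus_carrier_mat) simp
      hence z: "\<epsilon> - 1\<^sub>m ?n = 0\<^sub>m ?n ?n" by (rule F(8)[OF eq _ z0])
      have "\<epsilon> = 1\<^sub>m ?n" by (rule minus_eq_zero_mat[OF z ce one_carrier_mat])
      thus False using ne by blast
    qed
    thus "vdim D < ?n" using F(6) D by simp
  qed
qed

lemma complement_idempotent:
  assumes C: "C \<in> Rep_m" and \<epsilon>: "\<epsilon> \<in> mhom C C" "\<epsilon> * \<epsilon> = (\<epsilon> :: 'k::field mat)"
  shows "1\<^sub>m (vdim C) - \<epsilon> \<in> mhom C C" "(1\<^sub>m (vdim C) - \<epsilon>) * (1\<^sub>m (vdim C) - \<epsilon>) = 1\<^sub>m (vdim C) - \<epsilon>"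
    "\<epsilon> + (1\<^sub>m (vdim C) - \<epsilon>) = 1\<^sub>m (vdim C)"
proof -
  let ?n = "vdim C" and ?\<nu> = "1\<^sub>m (vdim C) - \<epsilon>"
  note ce = mhomD(2)[OF \<epsilon>(1)]
  show m: "?\<nu> \<in> mhom C C" by (intro mhom_add_minus mhom_one C \<epsilon>)
  note cn = mhomD(2)[OF m]
  have "\<epsilon> * ?\<nu> = \<epsilon> * 1\<^sub>m ?n - \<epsilon> * \<epsilon>" by (rule mult_minus_distrib_mat[OF ce _ ce]) simp
  also have "\<dots> = 0\<^sub>m ?n ?n" unfolding \<epsilon>(2) using ce by simp
  finally have z: "\<epsilon> * ?\<nu> = 0\<^sub>m ?n ?n" .
  have "?\<nu> * ?\<nu> = 1\<^sub>m ?n * ?\<nu> - \<epsilon> * ?\<nu>" by (rule minus_mult_distrib_mat[OF _ ce cn]) simp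
  also have "\<dots> = ?\<nu> - 0\<^sub>m ?n ?n" unfolding z left_mult_one_mat[OF cn] ..
  also have "\<dots> = ?\<nu>" by (rule eq_matI) (use ce in simp_all)
  finally show "?\<nu> * ?\<nu> = ?\<nu>" .
  show "\<epsilon> + ?\<nu> = 1\<^sub>m ?n" using ce by (auto intro!: eq_matI)
qed

lemma msum_simps:
  "vdim (msum D E) = vdim D + vdim E"
  "vodd (msum D E) i = (if i < vdim D then vodd D i else vodd E (i - vdim D))"
  by (simp_all add: msum_def)

lemma msum_entry:
  assumes "D \<in> Rep_m" "E \<in> Rep_m" "i < vdim D + vdim E" "j < vdim D + vdim E"
  shows "vop (msum D E) $$ (i, j) =
    (if i < vdim D then if j < vdim D then vop D $$ (i, j) else 0
     else if j < vdim D then 0 else vop E $$ (i - vdim D, j - vdim D))"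
  using Rep_mD(2)[OF assms(1)] Rep_mD(2)[OF assms(2)] assms(3,4) unfolding msum_def
  by (simp add: less_diff_conv2)

lemma msum_Rep_m:
  assumes "D \<in> Rep_m" "E \<in> Rep_m"
  shows "msum D E \<in> Rep_m"
proof -
  note o = odd_opsD(2)[OF Rep_mD(1)[OF assms(1)]] odd_opsD(2)[OF Rep_mD(1)[OF assms(2)]]
  have "vop (msum D E) \<in> carrier_mat (vdim D + vdim E) (vdim D + vdim E)"
    using Rep_mD(2)[OF assms(1)] Rep_mD(2)[OF assms(2)] unfolding msum_def by auto
  moreover have "vodd (msum D E) i \<noteq> vodd (msum D E) j"
    if "i < vdim D + vdim E" "j < vdim D + vdim E" "vop (msum D E) $$ (i, j) \<noteq> 0" for i j
    using that o[of i j] o(2)[of "i - vdim D" "j - vdim D"]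
    by (auto simp: msum_entry[OF assms] msum_simps less_diff_conv2 split: if_splits)
  ultimately show ?thesis unfolding Rep_m_def odd_ops_def by (simp add: msum_simps)
qed

text \<open>The inclusions and projections of a direct sum. With them, direct sum decompositions are
handled by equations between maps instead of block matrices.\<close>

lemma biproduct:
  fixes D E :: "'k::field mrep"
  assumes D: "D \<in> Rep_m" and E: "E \<in> Rep_m"
  obtains i1 p1 i2 p2 where
    "i1 \<in> mhom D (msum D E)" "p1 \<in> mhom (msum D E) D" "i2 \<in> mhom E (msum D E)" "p2 \<in> mhom (msum D E) E"
    "p1 * i1 = 1\<^sub>m (vdim D)" "p2 * i2 = 1\<^sub>m (vdim E)" "p1 * i2 = 0\<^sub>m (vdim D) (vdim E)"
    "p2 * i1 = 0\<^sub>m (vdim E) (vdim D)" "i1 * p1 + i2 * p2 = 1\<^sub>m (vdim D + vdim E)"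
proof -
  let ?d = "vdim D" and ?e = "vdim E" and ?S = "msum D E"
  let ?X = "vop (msum D E)"
  define i1 where "i1 = mat (?d + ?e) ?d (\<lambda>(i, j). if i = j then 1 else (0 :: 'k))"
  define p1 where "p1 = mat ?d (?d + ?e) (\<lambda>(i, j). if i = j then 1 else (0 :: 'k))"
  define i2 where "i2 = mat (?d + ?e) ?e (\<lambda>(i, j). if i = ?d + j then 1 else (0 :: 'k))"
  define p2 where "p2 = mat ?e (?d + ?e) (\<lambda>(i, j). if ?d + i = j then 1 else (0 :: 'k))"
  have c: "i1 \<in> carrier_mat (?d + ?e) ?d" "p1 \<in> carrier_mat ?d (?d + ?e)"
    "i2 \<in> carrier_mat (?d + ?e) ?e" "p2 \<in> carrier_mat ?e (?d + ?e)"
    by (simp_all add: i1_def p1_def i2_def p2_def)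
  note x = Rep_mD(2)[OF D] Rep_mD(2)[OF E]
  have X: "?X \<in> carrier_mat (?d + ?e) (?d + ?e)"
    using Rep_mD(2)[OF msum_Rep_m[OF D E]] by (simp add: msum_simps)
  have R1: "(A * i1) $$ (i, j) = A $$ (i, j)" if "A \<in> carrier_mat r (?d + ?e)" "i < r" "j < ?d" for A r i j
    using that entry_mult[OF that(1) c(1) that(2,3)] by (simp add: i1_def if_distrib sum.delta cong: if_cong)
  have R2: "(A * i2) $$ (i, j) = A $$ (i, ?d + j)" if "A \<in> carrier_mat r (?d + ?e)" "i < r" "j < ?e" for A r i j
    using that entry_mult[OF that(1) c(3) that(2,3)] by (simp add: i2_def if_distrib sum.delta cong: if_cong)
  have L1: "(p1 * A) $$ (i, j) = A $$ (i, j)" if "A \<in> carrier_mat (?d + ?e) r" "i < ?d" "j < r" for A r i j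
    using that entry_mult[OF c(2) that] by (simp add: p1_def if_distrib[of "\<lambda>z. z * _"] sum.delta' cong: if_cong)
  have L2: "(p2 * A) $$ (i, j) = A $$ (?d + i, j)" if "A \<in> carrier_mat (?d + ?e) r" "i < ?e" "j < r" for A r i j
    using that entry_mult[OF c(4) that] by (simp add: p2_def if_distrib[of "\<lambda>z. z * _"] sum.delta' cong: if_cong)
  have M1: "(i1 * A) $$ (i, j) = (if i < ?d then A $$ (i, j) else 0)" if "A \<in> carrier_mat ?d r" "i < ?d + ?e" "j < r" for A r i j
    using that entry_mult[OF c(1) that] by (simp add: i1_def if_distrib[of "\<lambda>z. z * _"] sum.delta' cong: if_cong)
  have M2: "(i2 * A) $$ (i, j) = (if i < ?d then 0 else A $$ (i - ?d, j))" if A: "A \<in> carrier_mat ?e r" "i < ?d + ?e" "j < r" for A r i j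
  proof (cases "i < ?d")
    case True
    thus ?thesis using that entry_mult[OF c(3) that] by (auto simp: i2_def intro!: sum.neutral)
  next
    case False
    have "i = ?d + l \<longleftrightarrow> l = i - ?d" for l using False by auto
    thus ?thesis using False that entry_mult[OF c(3) that]
      by (simp add: i2_def if_distrib[of "\<lambda>z. z * _"] sum.delta less_diff_conv2 cong: if_cong)
  qed
  have N1: "(A * p1) $$ (i, j) = (if j < ?d then A $$ (i, j) else 0)" if "A \<in> carrier_mat r ?d" "i < r" "j < ?d + ?e" for A r i j
    using that entry_mult[OF that(1) c(2) that(2,3)] by (simp add: p1_def if_distrib sum.delta cong: if_cong)
  have N2: "(A * p2) $$ (i, j) = (if j < ?d then 0 else A $$ (i, j - ?d))" if A: "A \<in> carrier_mat r ?e" "i < r" "j < ?d + ?e" for A r i j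
  proof (cases "j < ?d")
    case True
    thus ?thesis using that entry_mult[OF that(1) c(4) that(2,3)] by (auto simp: p2_def intro!: sum.neutral)
  next
    case False
    have "?d + l = j \<longleftrightarrow> l = j - ?d" for l using False by auto
    thus ?thesis using False that entry_mult[OF that(1) c(4) that(2,3)]
      by (simp add: p2_def if_distrib sum.delta less_diff_conv2 cong: if_cong)
  qed
  have ent: "?X $$ (i, j) = (if i < ?d then if j < ?d then vop D $$ (i, j) else 0
     else if j < ?d then 0 else vop E $$ (i - ?d, j - ?d))" if "i < ?d + ?e" "j < ?d + ?e" for i j
    by (rule msum_entry[OF D E that])
  show ?thesis
  proof (rule that[of i1 p1 i2 p2])
    have "i1 * vop D = ?X * i1"
      by (rule eq_matI) (use c x X in \<open>auto simp: M1[OF x(1)] R1[OF X] ent simp del: index_mult_mat(1)\<close>)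
    thus "i1 \<in> mhom D ?S" using c(1) by (auto simp: mhom_def even_maps_def msum_simps i1_def split: if_splits)
    have "i2 * vop E = ?X * i2"
      by (rule eq_matI) (use c x X in \<open>auto simp: M2[OF x(2)] R2[OF X] ent simp del: index_mult_mat(1)\<close>)
    thus "i2 \<in> mhom E ?S" using c(3) by (auto simp: mhom_def even_maps_def msum_simps i2_def split: if_splits)
    have "p1 * ?X = vop D * p1"
      by (rule eq_matI) (use c x X in \<open>auto simp: N1[OF x(1)] L1[OF X] ent simp del: index_mult_mat(1)\<close>)
    thus "p1 \<in> mhom ?S D" using c(2) by (auto simp: mhom_def even_maps_def msum_simps p1_def split: if_splits)
    have "p2 * ?X = vop E * p2"
      by (rule eq_matI) (use c x X in \<open>auto simp: N2[OF x(2)] L2[OF X] ent simp del: index_mult_mat(1)\<close>)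
    thus "p2 \<in> mhom ?S E" using c(4) by (auto simp: mhom_def even_maps_def msum_simps p2_def split: if_splits)
    show "p1 * i1 = 1\<^sub>m ?d"
      by (rule eq_matI) (use c in \<open>auto simp: L1[OF c(1)] simp del: index_mult_mat(1)\<close>, auto simp: i1_def)
    show "p2 * i2 = 1\<^sub>m ?e"
      by (rule eq_matI) (use c in \<open>auto simp: L2[OF c(3)] simp del: index_mult_mat(1)\<close>, auto simp: i2_def)
    show "p1 * i2 = 0\<^sub>m ?d ?e"
      by (rule eq_matI) (use c in \<open>auto simp: L1[OF c(3)] simp del: index_mult_mat(1)\<close>, auto simp: i2_def)
    show "p2 * i1 = 0\<^sub>m ?e ?d"
      by (rule eq_matI) (use c in \<open>auto simp: L2[OF c(1)] simp del: index_mult_mat(1)\<close>, auto simp: i1_def)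
    show "i1 * p1 + i2 * p2 = 1\<^sub>m (?d + ?e)"
      by (rule eq_matI) (use c in \<open>auto simp: M1[OF c(2)] M2[OF c(4)] simp del: index_mult_mat(1)\<close>, auto simp: p1_def p2_def)
  qed
qed

text \<open>A summand, given by its inclusion and projection. In this form transitivity is evident, and a
complement is found by splitting the complementary idempotent.\<close>

definition retract :: "'k::field mrep \<Rightarrow> 'k mrep \<Rightarrow> bool" where
  "retract D C \<longleftrightarrow> D \<in> Rep_m \<and> (\<exists>\<alpha>\<in>mhom D C. \<exists>\<beta>\<in>mhom C D. \<beta> * \<alpha> = 1\<^sub>m (vdim D))"

lemma add_right_cancel_mat:
  fixes U V :: "'k::field mat"
  assumes "U + V = V" "U \<in> carrier_mat r s" "V \<in> carrier_mat r s"
  shows "U = 0\<^sub>m r s"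
proof (rule eq_matI)
  fix i j assume ij: "i < dim_row (0\<^sub>m r s :: 'k mat)" "j < dim_col (0\<^sub>m r s :: 'k mat)"
  have "(U + V) $$ (i, j) = V $$ (i, j)" using assms(1) by simp
  thus "U $$ (i, j) = 0\<^sub>m r s $$ (i, j)" using assms(2,3) ij by simp
qed (use assms in auto)

lemma complementary_orthogonal:
  fixes a1 :: "'k::field mat"
  assumes m: "a1 \<in> carrier_mat n d" "b1 \<in> carrier_mat d n" "a2 \<in> carrier_mat n e" "b2 \<in> carrier_mat e n"
    and i: "b1 * a1 = 1\<^sub>m d" "b2 * a2 = 1\<^sub>m e" "a1 * b1 + a2 * b2 = 1\<^sub>m n"
  shows "b1 * a2 = 0\<^sub>m d e"
proof -
  have c: "b1 * a2 \<in> carrier_mat d e" and ab: "a1 * b1 \<in> carrier_mat n n" "a2 * b2 \<in> carrier_mat n n"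
    using m by (auto intro: mult_carrier_mat)
  have "b1 * (a1 * b1 + a2 * b2) = b1 * (a1 * b1) + b1 * (a2 * b2)"
    by (rule mult_add_distrib_mat[OF m(2) ab])
  also have "b1 * (a1 * b1) = b1" using assoc_mult_mat[OF m(2,1,2)] i(1) m by simp
  also have "b1 * (a2 * b2) = b1 * a2 * b2" by (rule assoc_mult_mat[OF m(2,3,4), symmetric])
  finally have "b1 * (a1 * b1 + a2 * b2) * a2 = b1 * a2 + b1 * a2 * b2 * a2"
    using add_mult_distrib_mat[OF m(2) mult_carrier_mat[OF c m(4)] m(3)] by simp
  also have "b1 * a2 * b2 * a2 = b1 * a2"
    unfolding assoc_mult_mat[OF c m(4,3)] i(2) by (rule right_mult_one_mat[OF c])
  finally have "b1 * a2 + b1 * a2 = b1 * a2" unfolding i(3) using m by simp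
  thus ?thesis by (rule add_right_cancel_mat[OF _ c c])
qed

lemma miso_msumI:
  fixes C :: "'k::field mrep"
  assumes R: "C \<in> Rep_m" "D \<in> Rep_m" "E \<in> Rep_m"
    and m: "a1 \<in> mhom D C" "b1 \<in> mhom C D" "a2 \<in> mhom E C" "b2 \<in> mhom C E"
    and i: "b1 * a1 = 1\<^sub>m (vdim D)" "b2 * a2 = 1\<^sub>m (vdim E)" "a1 * b1 + a2 * b2 = 1\<^sub>m (vdim C)"
  shows "miso C (msum D E)"
proof -
  let ?n = "vdim C" and ?d = "vdim D" and ?e = "vdim E"
  obtain i1 p1 i2 p2 where B:
    "i1 \<in> mhom D (msum D E)" "p1 \<in> mhom (msum D E) D" "i2 \<in> mhom E (msum D E)" "p2 \<in> mhom (msum D E) E"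
    and Be: "p1 * i1 = 1\<^sub>m ?d" "p2 * i2 = 1\<^sub>m ?e" "p1 * i2 = 0\<^sub>m ?d ?e"
    "p2 * i1 = 0\<^sub>m ?e ?d" "i1 * p1 + i2 * p2 = 1\<^sub>m (?d + ?e)"
    by (rule biproduct[OF R(2,3)]) blast
  have S: "msum D E \<in> Rep_m" by (rule msum_Rep_m[OF R(2,3)])
  note mc = m[THEN mhomD(2)]
  note Bc = B[THEN mhomD(2), unfolded msum_simps]
  have ab: "a1 * b1 \<in> carrier_mat ?n ?n" "a2 * b2 \<in> carrier_mat ?n ?n" using mc by (auto intro: mult_carrier_mat)
  have z: "b1 * a2 = 0\<^sub>m ?d ?e" "b2 * a1 = 0\<^sub>m ?e ?d"
    by (rule complementary_orthogonal[OF mc i],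
        rule complementary_orthogonal[OF mc(3,4,1,2) i(2,1)]) (use i(3) comm_add_mat[OF ab] in simp)
  \<comment> \<open>The mixed terms contain one of the vanishing products.\<close>
  have bil: "(x1 * y1 + x2 * y2) * (u1 * v1 + u2 * v2) =
      x1 * (y1 * u1) * v1 + x2 * (y2 * u2) * v2"
    if c: "x1 \<in> carrier_mat r s1" "y1 \<in> carrier_mat s1 t" "x2 \<in> carrier_mat r s2" "y2 \<in> carrier_mat s2 t"
      "u1 \<in> carrier_mat t s1" "v1 \<in> carrier_mat s1 w" "u2 \<in> carrier_mat t s2" "v2 \<in> carrier_mat s2 w"
      and 0: "y1 * u2 = 0\<^sub>m s1 s2" "y2 * u1 = 0\<^sub>m s2 s1"
    for x1 y1 x2 y2 u1 v1 u2 v2 :: "'k mat" and r s1 s2 t w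
  proof -
    have p: "x1 * y1 \<in> carrier_mat r t" "x2 * y2 \<in> carrier_mat r t"
      "u1 * v1 \<in> carrier_mat t w" "u2 * v2 \<in> carrier_mat t w" using c by (auto intro: mult_carrier_mat)
    have q: "(x * y) * (u * v) = x * (y * u) * v"
      if "x \<in> carrier_mat r s" "y \<in> carrier_mat s t" "u \<in> carrier_mat t s'" "v \<in> carrier_mat s' w"
      for x y u v :: "'k mat" and s s'
    proof -
      have "(x * y) * (u * v) = x * (y * (u * v))" by (rule assoc_mult_mat[OF that(1,2) mult_carrier_mat[OF that(3,4)]])
      also have "y * (u * v) = (y * u) * v" by (rule assoc_mult_mat[OF that(2,3,4), symmetric])
      also have "x * (y * u * v) = x * (y * u) * v"
        by (rule assoc_mult_mat[OF that(1) mult_carrier_mat[OF that(2,3)] that(4), symmetric])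
      finally show ?thesis .
    qed
    have "(x1 * y1 + x2 * y2) * (u1 * v1 + u2 * v2) =
        (x1 * y1) * (u1 * v1 + u2 * v2) + (x2 * y2) * (u1 * v1 + u2 * v2)"
      by (rule add_mult_distrib_mat[OF p(1,2) add_carrier_mat[OF p(4)]])
    also have "(x1 * y1) * (u1 * v1 + u2 * v2) = (x1 * y1) * (u1 * v1) + (x1 * y1) * (u2 * v2)"
      by (rule mult_add_distrib_mat[OF p(1,3,4)])
    also have "(x2 * y2) * (u1 * v1 + u2 * v2) = (x2 * y2) * (u1 * v1) + (x2 * y2) * (u2 * v2)"
      by (rule mult_add_distrib_mat[OF p(2,3,4)])
    also have "(x1 * y1) * (u2 * v2) = 0\<^sub>m r w" unfolding q[OF c(1,2,7,8)] 0(1) using c by simp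
    also have "(x2 * y2) * (u1 * v1) = 0\<^sub>m r w" unfolding q[OF c(3,4,5,6)] 0(2) using c by simp
    also have "(x1 * y1) * (u1 * v1) = x1 * (y1 * u1) * v1" by (rule q[OF c(1,2,5,6)])
    also have "(x2 * y2) * (u2 * v2) = x2 * (y2 * u2) * v2" by (rule q[OF c(3,4,7,8)])
    finally show ?thesis
      using mult_carrier_mat[OF mult_carrier_mat[OF c(1) mult_carrier_mat[OF c(2,5)]] c(6)]
        mult_carrier_mat[OF mult_carrier_mat[OF c(3) mult_carrier_mat[OF c(4,7)]] c(8)] by simp
  qed
  define f where "f = i1 * b1 + i2 * b2"
  define g where "g = a1 * p1 + a2 * p2"
  have "f \<in> mhom C (msum D E)" unfolding f_def by (intro mhom_add_minus mhom_mult[OF _ _ _ R(2)] mhom_mult[OF _ _ _ R(3)] B m R S)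
  moreover have "g \<in> mhom (msum D E) C" unfolding g_def by (intro mhom_add_minus mhom_mult[OF _ _ _ R(2)] mhom_mult[OF _ _ _ R(3)] B m R S)
  moreover have "g * f = 1\<^sub>m ?n"
    unfolding f_def g_def bil[OF mc(1) Bc(2) mc(3) Bc(4) Bc(1) mc(2) Bc(3) mc(4) Be(3,4)] Be
    using mc i(3) by simp
  moreover have "f * g = 1\<^sub>m (?d + ?e)"
    unfolding f_def g_def bil[OF Bc(1) mc(2) Bc(3) mc(4) mc(1) Bc(2) mc(3) Bc(4) z] i
    using Bc Be(5) by simp
  ultimately show ?thesis unfolding miso_def by (auto simp: msum_simps)
qed

lemma miso_msumD:
  fixes C :: "'k::field mrep"
  assumes R: "C \<in> Rep_m" "D \<in> Rep_m" "E \<in> Rep_m" and iso: "miso C (msum D E)"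
  obtains a1 b1 a2 b2 where "a1 \<in> mhom D C" "b1 \<in> mhom C D" "a2 \<in> mhom E C" "b2 \<in> mhom C E"
    "b1 * a1 = 1\<^sub>m (vdim D)" "b2 * a2 = 1\<^sub>m (vdim E)" "a1 * b1 + a2 * b2 = 1\<^sub>m (vdim C)"
proof -
  let ?n = "vdim C" and ?d = "vdim D" and ?e = "vdim E"
  obtain i1 p1 i2 p2 where B:
    "i1 \<in> mhom D (msum D E)" "p1 \<in> mhom (msum D E) D" "i2 \<in> mhom E (msum D E)" "p2 \<in> mhom (msum D E) E"
    and Be: "p1 * i1 = 1\<^sub>m ?d" "p2 * i2 = 1\<^sub>m ?e" "i1 * p1 + i2 * p2 = 1\<^sub>m (?d + ?e)"
    by (rule biproduct[OF R(2,3)]) blast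
  have S: "msum D E \<in> Rep_m" by (rule msum_Rep_m[OF R(2,3)])
  note Bc = B[THEN mhomD(2), unfolded msum_simps]
  obtain f g where fg: "f \<in> mhom C (msum D E)" "g \<in> mhom (msum D E) C"
    "g * f = 1\<^sub>m ?n" "f * g = 1\<^sub>m (?d + ?e)"
    using iso unfolding miso_def msum_simps by blast
  note fc = mhomD(2)[OF fg(1), unfolded msum_simps] and gc = mhomD(2)[OF fg(2), unfolded msum_simps]
  have ret: "(p * f) * (g * i) = p * i"
    if "p \<in> carrier_mat r (?d + ?e)" "i \<in> carrier_mat (?d + ?e) s" for p i r s
  proof -
    have "(p * f) * (g * i) = p * (f * (g * i))" by (rule assoc_mult_mat[OF that(1) fc mult_carrier_mat[OF gc that(2)]])
    also have "f * (g * i) = i" using assoc_mult_mat[OF fc gc that(2)] fg(4) that(2) by simp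
    finally show ?thesis .
  qed
  have out: "(g * i) * (p * f) = g * (i * p) * f"
    if "p \<in> carrier_mat r (?d + ?e)" "i \<in> carrier_mat (?d + ?e) r" for p i r
  proof -
    have "(g * i) * (p * f) = g * (i * (p * f))" by (rule assoc_mult_mat[OF gc that(2) mult_carrier_mat[OF that(1) fc]])
    also have "i * (p * f) = (i * p) * f" by (rule assoc_mult_mat[OF that(2,1) fc, symmetric])
    also have "g * (i * p * f) = g * (i * p) * f"
      by (rule assoc_mult_mat[OF gc mult_carrier_mat[OF that(2,1)] fc, symmetric])
    finally show ?thesis .
  qed
  have c: "i1 * p1 \<in> carrier_mat (?d + ?e) (?d + ?e)" "i2 * p2 \<in> carrier_mat (?d + ?e) (?d + ?e)"
    using Bc by (auto intro: mult_carrier_mat)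
  show ?thesis
  proof (rule that[of "g * i1" "p1 * f" "g * i2" "p2 * f"])
    show "g * i1 \<in> mhom D C" "p1 * f \<in> mhom C D" "g * i2 \<in> mhom E C" "p2 * f \<in> mhom C E"
      by (rule mhom_mult[OF _ _ _ S]; intro fg B R)+
    show "(p1 * f) * (g * i1) = 1\<^sub>m ?d" unfolding ret[OF Bc(2,1)] Be ..
    show "(p2 * f) * (g * i2) = 1\<^sub>m ?e" unfolding ret[OF Bc(4,3)] Be ..
    have "g * i1 * (p1 * f) + g * i2 * (p2 * f) = (g * (i1 * p1) + g * (i2 * p2)) * f"
      unfolding out[OF Bc(2,1)] out[OF Bc(4,3)]
      by (rule add_mult_distrib_mat[OF mult_carrier_mat[OF gc c(1)] mult_carrier_mat[OF gc c(2)] fc, symmetric])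
    also have "g * (i1 * p1) + g * (i2 * p2) = g * (i1 * p1 + i2 * p2)"
      by (rule mult_add_distrib_mat[OF gc c, symmetric])
    also have "\<dots> * f = 1\<^sub>m ?n" unfolding Be using gc fg(3) by simp
    finally show "g * i1 * (p1 * f) + g * i2 * (p2 * f) = 1\<^sub>m ?n" .
  qed
qed

lemma retract_idempotent:
  fixes C :: "'k::field mrep"
  assumes C: "C \<in> Rep_m" and D: "D \<in> Rep_m" and a: "\<alpha> \<in> mhom D C" and b: "\<beta> \<in> mhom C D"
    and ba: "\<beta> * \<alpha> = 1\<^sub>m (vdim D)"
  shows "\<alpha> * \<beta> \<in> mhom C C" "(\<alpha> * \<beta>) * (\<alpha> * \<beta>) = \<alpha> * \<beta>"
    "vdim D \<noteq> 0 \<Longrightarrow> \<alpha> * \<beta> \<noteq> 0\<^sub>m (vdim C) (vdim C)"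
proof -
  note ca = mhomD(2)[OF a] and cb = mhomD(2)[OF b]
  show "\<alpha> * \<beta> \<in> mhom C C" by (rule mhom_mult[OF a b C D C])
  have bab: "\<beta> * (\<alpha> * \<beta>) = \<beta>" using assoc_mult_mat[OF cb ca cb] ba cb by simp
  show "(\<alpha> * \<beta>) * (\<alpha> * \<beta>) = \<alpha> * \<beta>"
    using assoc_mult_mat[OF ca cb mult_carrier_mat[OF ca cb]] bab by simp
  assume nz: "vdim D \<noteq> 0"
  show "\<alpha> * \<beta> \<noteq> 0\<^sub>m (vdim C) (vdim C)"
  proof
    assume "\<alpha> * \<beta> = 0\<^sub>m (vdim C) (vdim C)"
    hence "\<beta> = 0\<^sub>m (vdim D) (vdim C)" using bab cb by simp
    hence "(1\<^sub>m (vdim D) :: 'k mat) = 0\<^sub>m (vdim D) (vdim D)" using ba ca by simp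
    hence "(1\<^sub>m (vdim D) :: 'k mat) $$ (0, 0) = 0\<^sub>m (vdim D) (vdim D) $$ (0, 0)" by simp
    thus False using nz by simp
  qed
qed

lemma retract_msum:
  fixes C :: "'k::field mrep"
  assumes C: "C \<in> Rep_m" and D: "D \<in> Rep_m" and a: "\<alpha> \<in> mhom D C" and b: "\<beta> \<in> mhom C D"
    and ba: "\<beta> * \<alpha> = 1\<^sub>m (vdim D)"
  shows "\<exists>E\<in>Rep_m. miso C (msum D E)"
proof -
  note id = retract_idempotent(1,2)[OF assms] and co = complement_idempotent[OF C retract_idempotent(1,2)[OF assms]]
  obtain E \<alpha>' \<beta>' where E: "E \<in> Rep_m" "\<alpha>' \<in> mhom E C" "\<beta>' \<in> mhom C E"
    "\<alpha>' * \<beta>' = 1\<^sub>m (vdim C) - \<alpha> * \<beta>" "\<beta>' * \<alpha>' = 1\<^sub>m (vdim E)"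
    by (rule split_idempotent[OF C co(1,2)]) blast
  have "miso C (msum D E)"
    by (rule miso_msumI[OF C D E(1) a b E(2,3) ba E(5)]) (unfold E(4), rule co(3))
  thus ?thesis using E(1) by blast
qed

lemma retract_trans:
  fixes C :: "'k::field mrep"
  assumes C: "C \<in> Rep_m" and "retract D' D" "retract D C"
  shows "retract D' C"
proof -
  obtain \<alpha> \<beta> where ab: "D \<in> Rep_m" "\<alpha> \<in> mhom D C" "\<beta> \<in> mhom C D" "\<beta> * \<alpha> = 1\<^sub>m (vdim D)"
    using assms(3) unfolding retract_def by blast
  obtain \<gamma> \<delta> where cd: "D' \<in> Rep_m" "\<gamma> \<in> mhom D' D" "\<delta> \<in> mhom D D'" "\<delta> * \<gamma> = 1\<^sub>m (vdim D')"
    using assms(2) unfolding retract_def by blast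
  note c = mhomD(2)[OF ab(2)] mhomD(2)[OF ab(3)] mhomD(2)[OF cd(2)] mhomD(2)[OF cd(3)]
  have "(\<delta> * \<beta>) * (\<alpha> * \<gamma>) = \<delta> * (\<beta> * (\<alpha> * \<gamma>))" by (rule assoc_mult_mat[OF c(4,2) mult_carrier_mat[OF c(1,3)]])
  also have "\<beta> * (\<alpha> * \<gamma>) = \<gamma>" using assoc_mult_mat[OF c(2,1,3)] ab(4) c by simp
  finally have "(\<delta> * \<beta>) * (\<alpha> * \<gamma>) = 1\<^sub>m (vdim D')" using cd(4) by simp
  moreover have "\<alpha> * \<gamma> \<in> mhom D' C" "\<delta> * \<beta> \<in> mhom C D'"
    by (rule mhom_mult[OF ab(2) cd(2) cd(1) ab(1) C], rule mhom_mult[OF cd(3) ab(3) C ab(1) cd(1)])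
  ultimately show ?thesis using cd(1) unfolding retract_def by blast
qed

lemma mult_inner_zero:
  assumes "A \<in> carrier_mat n 0" "B \<in> carrier_mat 0 m"
  shows "A * B = (0\<^sub>m n m :: 'k::field mat)"
  using assms by (intro eq_matI) (auto simp: scalar_prod_def)

text \<open>An idempotent and its complement split \<open>D\<close> into two summands, one of which is zero.\<close>

lemma indecomposable_idempotent:
  fixes D :: "'k::field mrep"
  assumes D: "D \<in> Rep_m" "indecomposable D" and e: "\<epsilon> \<in> mhom D D" "\<epsilon> * \<epsilon> = \<epsilon>"
  shows "\<epsilon> = 0\<^sub>m (vdim D) (vdim D) \<or> \<epsilon> = 1\<^sub>m (vdim D)"
proof -
  let ?n = "vdim D"
  note co = complement_idempotent[OF D(1) e]
  obtain D1 a1 b1 where 1: "D1 \<in> Rep_m" "a1 \<in> mhom D1 D" "b1 \<in> mhom D D1" "a1 * b1 = \<epsilon>" "b1 * a1 = 1\<^sub>m (vdim D1)"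
    by (rule split_idempotent[OF D(1) e]) blast
  obtain D2 a2 b2 where 2: "D2 \<in> Rep_m" "a2 \<in> mhom D2 D" "b2 \<in> mhom D D2"
    "a2 * b2 = 1\<^sub>m ?n - \<epsilon>" "b2 * a2 = 1\<^sub>m (vdim D2)"
    by (rule split_idempotent[OF D(1) co(1,2)]) blast
  have "miso D (msum D1 D2)"
    by (rule miso_msumI[OF D(1) 1(1) 2(1) 1(2,3) 2(2,3) 1(5) 2(5)]) (unfold 1(4) 2(4), rule co(3))
  hence "vdim D1 = 0 \<or> vdim D2 = 0"
    by (rule D(2)[unfolded indecomposable_def, THEN conjunct2, rule_format, OF 1(1) 2(1)])
  thus ?thesis
  proof
    assume "vdim D1 = 0"
    hence "a1 * b1 = 0\<^sub>m ?n ?n" using mhomD(2)[OF 1(2)] mhomD(2)[OF 1(3)] by (intro mult_inner_zero) auto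
    thus ?thesis using 1(4) by simp
  next
    assume "vdim D2 = 0"
    hence "a2 * b2 = 0\<^sub>m ?n ?n" using mhomD(2)[OF 2(2)] mhomD(2)[OF 2(3)] by (intro mult_inner_zero) auto
    hence "\<epsilon> + 0\<^sub>m ?n ?n = 1\<^sub>m ?n" using co(3) 2(4) by simp
    thus ?thesis using mhomD(2)[OF e(1)] by simp
  qed
qed

section \<open>Negligible objects of Rep(m)\<close>

text \<open>Evenness is commutation with the parity operator, hence passes to everything in the
  double centralizer.\<close>

lemma even_iff_commutes_parity:
  fixes T :: "'k::field_char_0 mat"
  assumes T: "T \<in> carrier_mat (vdim V) (vdim V)"
  defines "\<Gamma> \<equiv> mat (vdim V) (vdim V) (\<lambda>(i, j). if i = j then ksign (vodd V i) else (0 :: 'k))"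
  shows "T \<in> even_maps V V \<longleftrightarrow> T * \<Gamma> = \<Gamma> * T"
proof -
  let ?n = "vdim V"
  have G: "\<Gamma> \<in> carrier_mat ?n ?n" by (simp add: \<Gamma>_def)
  have l: "(T * \<Gamma>) $$ (i, j) = T $$ (i, j) * ksign (vodd V j)" if "i < ?n" "j < ?n" for i j
    using that entry_mult[OF T G that] by (simp add: \<Gamma>_def if_distrib sum.delta cong: if_cong)
  have r: "(\<Gamma> * T) $$ (i, j) = ksign (vodd V i) * T $$ (i, j)" if "i < ?n" "j < ?n" for i j
    using that entry_mult[OF G T that] by (simp add: \<Gamma>_def if_distrib[of "\<lambda>z. z * _"] sum.delta' cong: if_cong)
  have k: "t * ksign b = ksign a * t \<longleftrightarrow> t = 0 \<or> a = b" for t :: 'k and a b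
  proof -
    have "- t = t \<longleftrightarrow> t = 0" "t = - t \<longleftrightarrow> t = 0" by (simp_all add: equal_neg_zero neg_equal_zero)
    thus ?thesis by (cases a; cases b) auto
  qed
  have "T * \<Gamma> = \<Gamma> * T \<longleftrightarrow> (\<forall>i<?n. \<forall>j<?n. (T * \<Gamma>) $$ (i, j) = (\<Gamma> * T) $$ (i, j))"
    using T G by (auto intro!: eq_matI simp del: index_mult_mat(1))
  also have "\<dots> \<longleftrightarrow> (\<forall>i<?n. \<forall>j<?n. T $$ (i, j) = 0 \<or> vodd V i = vodd V j)"
    by (simp add: l r k del: index_mult_mat(1))
  finally show ?thesis using T unfolding even_maps_def by blast
qed

lemma centralizer_mhom:
  fixes C :: "'k::field_char_0 mrep"
  assumes C: "C \<in> Rep_m" and A: "A \<in> mhom C C" and Z: "Z \<in> carrier_mat (vdim C) (vdim C)"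
    and cZ: "\<And>B. B \<in> carrier_mat (vdim C) (vdim C) \<Longrightarrow> A * B = B * A \<Longrightarrow> Z * B = B * Z"
  shows "Z \<in> mhom C C"
proof -
  let ?\<Gamma> = "mat (vdim C) (vdim C) (\<lambda>(i, j). if i = j then ksign (vodd C i) else (0 :: 'k))"
  have "A * ?\<Gamma> = ?\<Gamma> * A" using even_iff_commutes_parity[OF mhomD(2)[OF A]] mhomD(1)[OF A] by blast
  hence "Z * ?\<Gamma> = ?\<Gamma> * Z" by (intro cZ) auto
  hence "Z \<in> even_maps C C" using even_iff_commutes_parity[OF Z] by blast
  thus ?thesis unfolding mhom_def using cZ[OF Rep_mD(2)[OF C] mhomD(3)[OF A]] by blast
qed

text \<open>For an eigenvalue \<open>l\<close> of \<open>u\<close>, the projection to the part where \<open>u - l\<close> is invertible is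
an idempotent endomorphism of \<open>D\<close>, so it is \<open>0\<close> or \<open>1\<close>; it is not \<open>1\<close>, as \<open>u - l\<close> has a kernel. Hence
\<open>u - l\<close> is nilpotent and the supertrace of \<open>u\<close> is \<open>l\<close> times the superdimension.\<close>

lemma indecomposable_supertrace:
  fixes D :: "'k::{alg_closed_field, field_char_0} mrep"
  assumes D: "D \<in> Rep_m" "indecomposable D" "superdim D = 0" and u: "u \<in> mhom D D"
  shows "supertrace D u = 0"
proof -
  let ?n = "vdim D"
  note cu = mhomD(2)[OF u]
  have n: "?n \<noteq> 0" using D(2) unfolding indecomposable_def by blast
  hence "degree (char_poly u) > 0" using degree_monic_char_poly[OF cu] by simp
  then obtain l where "poly (char_poly u) l = 0" using alg_closed_imp_poly_has_root by blast
  then obtain v where v: "v \<in> carrier_vec ?n" "v \<noteq> 0\<^sub>v ?n" "u *\<^sub>v v = l \<cdot>\<^sub>v v"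
    using eigenvalue_root_char_poly[OF cu] cu unfolding eigenvalue_def eigenvector_def by auto
  define A where "A = u - l \<cdot>\<^sub>m 1\<^sub>m ?n"
  have Am: "A \<in> mhom D D" unfolding A_def by (intro mhom_add_minus u mhom_scalar D)
  note cA = mhomD(2)[OF Am]
  have Av: "A *\<^sub>v v = 0\<^sub>v ?n"
  proof -
    have "A *\<^sub>v v = u *\<^sub>v v - (l \<cdot>\<^sub>m 1\<^sub>m ?n) *\<^sub>v v"
      unfolding A_def by (rule minus_mult_distrib_mat_vec[OF cu _ v(1)]) simp
    also have "(l \<cdot>\<^sub>m 1\<^sub>m ?n) *\<^sub>v v = l \<cdot>\<^sub>v v" using v(1) 
      by (intro eq_vecI) (simp_all add: scalar_prod_def if_distrib[of "\<lambda>z. z * _"] if_distrib[of "\<lambda>z. l * z"] cong: if_cong)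
    finally show ?thesis using v by auto
  qed
  obtain m Z where Z: "Z \<in> carrier_mat ?n ?n"
    "\<And>B. B \<in> carrier_mat ?n ?n \<Longrightarrow> A * B = B * A \<Longrightarrow> Z * B = B * Z"
    "(A * Z) * (A * Z) = A * Z" "A ^\<^sub>m m * (A * Z) = A ^\<^sub>m m"
    by (rule fitting[OF cA]) blast
  have Zm: "Z \<in> mhom D D" by (rule centralizer_mhom[OF D(1) Am Z(1,2)])
  have "A * Z = 0\<^sub>m ?n ?n"
  proof (rule ccontr)
    assume "A * Z \<noteq> 0\<^sub>m ?n ?n"
    hence "A * Z = 1\<^sub>m ?n"
      using indecomposable_idempotent[OF D(1,2) mhom_mult[OF Am Zm D(1) D(1) D(1)] Z(3)] by blast
    hence "Z * A = 1\<^sub>m ?n" using Z(2)[OF cA refl] by simp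
    hence "v = Z *\<^sub>v (A *\<^sub>v v)" using assoc_mult_mat_vec[OF Z(1) cA v(1)] v(1) by simp
    moreover have "Z *\<^sub>v 0\<^sub>v ?n = 0\<^sub>v ?n"
      using Z(1) by (intro eq_vecI) (auto simp: scalar_prod_def)
    ultimately have "v = 0\<^sub>v ?n" unfolding Av by simp
    thus False using v(2) by blast
  qed
  hence nil: "A ^\<^sub>m m = 0\<^sub>m ?n ?n" using Z(4) right_mult_zero_mat[OF pow_carrier_mat[OF cA, of m], of ?n] by simp
  have "supertrace D A = 0" by (rule supertrace_nilpotent[OF mhomD(1)[OF Am] nil])
  moreover have "supertrace D A = supertrace D u - l * supertrace D (1\<^sub>m ?n)"
    unfolding A_def using cu by (simp add: supertrace_linear)
  moreover have "supertrace D (1\<^sub>m ?n) = (0 :: 'k)" unfolding supertrace_one D(3) by simp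
  ultimately show ?thesis by simp
qed

text \<open>In the nilpotent case the summand is an indecomposable one of superdimension zero. Otherwise it is the
part where \<open>X\<^sup>2\<close> is invertible. The projection to it is a product \<open>X Y\<close> of odd operators commuting with
all endomorphisms \<open>g\<close>, so the supertraces of \<open>g X Y\<close> and \<open>Y g X = g X Y\<close> are opposite.\<close>

lemma not_neat_negligible_summand:
  fixes C :: "'k::{alg_closed_field, field_char_0} mrep"
  assumes C: "C \<in> Rep_m" and nn: "\<not> acts_neatly C"
  obtains \<epsilon> where "\<epsilon> \<in> mhom C C" "\<epsilon> * \<epsilon> = \<epsilon>" "\<epsilon> \<noteq> 0\<^sub>m (vdim C) (vdim C)"
    "\<And>g. g \<in> mhom C C \<Longrightarrow> supertrace C (g * \<epsilon>) = 0"
proof (cases "nilpotent_op C")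
  case True
  then obtain D E where DE: "D \<in> Rep_m" "E \<in> Rep_m" "miso C (msum D E)" "indecomposable D" "superdim D = 0"
    using nn unfolding acts_neatly_def by blast
  obtain a b where ab: "a \<in> mhom D C" "b \<in> mhom C D" "b * a = 1\<^sub>m (vdim D)"
    by (rule miso_msumD[OF C DE(1,2,3)]) blast
  have d: "vdim D \<noteq> 0" using DE(4) unfolding indecomposable_def by blast
  note r = retract_idempotent[OF C DE(1) ab]
  show ?thesis
  proof (rule that[OF r(1,2) r(3)[OF d]])
    fix g assume g: "g \<in> mhom C C"
    note c = mhomD(2)[OF g] mhomD(2)[OF ab(1)] mhomD(2)[OF ab(2)]
    have ga: "g * a \<in> mhom D C" by (rule mhom_mult[OF g ab(1) DE(1) C C])
    have "supertrace C (g * (a * b)) = supertrace C (g * a * b)" by (simp add: assoc_mult_mat[OF c])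
    also have "\<dots> = supertrace D (b * (g * a))"
      by (rule supertrace_mult[OF mhomD(1)[OF ga] mhomD(1)[OF ab(2)]])
    also have "\<dots> = 0"
      by (rule indecomposable_supertrace[OF DE(1,4,5)]) (rule mhom_mult[OF ab(2) ga DE(1) C DE(1)])
    finally show "supertrace C (g * (a * b)) = 0" .
  qed
next
  case False
  let ?n = "vdim C" and ?X = "vop C"
  note X = Rep_mD(1)[OF C] and cX = Rep_mD(2)[OF C]
  note asq = assoc_mult_mat[of _ ?n ?n _ ?n _ ?n]
  define A where "A = ?X * ?X"
  have cA: "A \<in> carrier_mat ?n ?n" unfolding A_def using cX cX by (rule mult_carrier_mat)
  have "A * ?X = ?X * A" unfolding A_def using cX by (simp only: asq)
  hence Am: "A \<in> mhom C C" unfolding mhom_def using odd_odd_mult[OF X X] A_def by simp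
  obtain m Z where Z: "Z \<in> carrier_mat ?n ?n"
    "\<And>B. B \<in> carrier_mat ?n ?n \<Longrightarrow> A * B = B * A \<Longrightarrow> Z * B = B * Z"
    "(A * Z) * (A * Z) = A * Z" "A ^\<^sub>m m * (A * Z) = A ^\<^sub>m m"
    by (rule fitting[OF cA]) blast
  have Zm: "Z \<in> mhom C C" by (rule centralizer_mhom[OF C Am Z(1,2)])
  define Y where "Y = ?X * Z"
  have Yo: "Y \<in> odd_ops C"
    using even_odd_mult[OF one_even X mhomD(1)[OF Zm]] cX unfolding Y_def by simp
  note cY = odd_opsD(1)[OF Yo]
  have AZ: "A * Z = ?X * Y" unfolding A_def Y_def using cX Z(1) by (simp only: asq)
  have YX: "Y * ?X = ?X * Y"
    unfolding Y_def using cX Z(1) mhomD(3)[OF Zm] by (simp only: asq)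
  show ?thesis
  proof (rule that[of "A * Z"])
    show "A * Z \<in> mhom C C" by (rule mhom_mult[OF Am Zm C C C])
    show "A * Z * (A * Z) = A * Z" by (rule Z(3))
    show "A * Z \<noteq> 0\<^sub>m ?n ?n"
    proof
      assume "A * Z = 0\<^sub>m ?n ?n"
      hence "A ^\<^sub>m m = 0\<^sub>m ?n ?n" using Z(4) right_mult_zero_mat[OF pow_carrier_mat[OF cA, of m], of ?n] by simp
      moreover have "A ^\<^sub>m k = ?X ^\<^sub>m (k + k)" for k
      proof (induction k)
        case (Suc k)
        have "?X ^\<^sub>m (Suc k + Suc k) = ?X ^\<^sub>m (k + k) * ?X * ?X" by simp
        also have "\<dots> = ?X ^\<^sub>m (k + k) * (?X * ?X)"
          by (rule assoc_mult_mat[OF pow_carrier_mat[OF cX] cX cX])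
        finally show ?case using Suc by (simp add: A_def)
      qed (use cX cA in simp)
      ultimately show False using False unfolding nilpotent_op_def by metis
    qed
    fix g assume g: "g \<in> mhom C C"
    note cg = mhomD(2)[OF g]
    have gX: "g * ?X \<in> odd_ops C"
      using even_odd_mult[OF mhomD(1)[OF g] X one_even]
      unfolding right_mult_one_mat[OF mult_carrier_mat[OF cg cX]] .
    have Ag: "A * g = g * A"
    proof -
      have "A * g = ?X * (?X * g)" unfolding A_def using cX cg by (simp only: asq)
      also have "\<dots> = ?X * g * ?X"
        using mhomD(3)[OF g] assoc_mult_mat[OF cX cg cX] by simp
      also have "\<dots> = g * A" unfolding mhomD(3)[OF g, symmetric] A_def using cX cg by (simp only: asq)
      finally show ?thesis .
    qed
    have Yg: "Y * g = g * Y"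
    proof -
      have "Y * g = ?X * (Z * g)" unfolding Y_def using cX Z(1) cg by (simp only: asq)
      also have "\<dots> = ?X * g * Z" unfolding Z(2)[OF cg Ag] using cX Z(1) cg by (simp only: asq)
      also have "\<dots> = g * Y" unfolding mhomD(3)[OF g, symmetric] Y_def using cX Z(1) cg by (simp only: asq)
      finally show ?thesis .
    qed
    have e1: "g * (A * Z) = g * ?X * Y" unfolding AZ using cg cX cY by (simp only: asq)
    have e2: "Y * (g * ?X) = g * ?X * Y"
    proof -
      have "Y * (g * ?X) = Y * g * ?X" using cg cX cY by (simp only: asq)
      also have "\<dots> = g * (Y * ?X)" unfolding Yg using cg cX cY by (simp only: asq)
      also have "\<dots> = g * ?X * Y" unfolding YX using cg cX cY by (simp only: asq)
      finally show ?thesis .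
    qed
    have "supertrace C (g * ?X * Y) = - supertrace C (g * ?X * Y)"
      using supertrace_odd_mult[OF gX Yo] unfolding e2 .
    thus "supertrace C (g * (A * Z)) = 0" unfolding e1 by (simp add: equal_neg_zero)
  qed
qed

text \<open>A nonzero summand \<open>D\<close> of least dimension is indecomposable, and the supertrace of the
projection to it is its superdimension.\<close>

lemma neat_supertrace:
  fixes C :: "'k::field_char_0 mrep"
  assumes C: "C \<in> Rep_m" and neat: "acts_neatly C" and nz: "vdim C \<noteq> 0"
  obtains g where "g \<in> mhom C C" "supertrace C g \<noteq> 0"
proof -
  have "retract C C" unfolding retract_def using C mhom_one[OF C] by (intro conjI bexI) auto
  then obtain D where D: "retract D C" "vdim D \<noteq> 0"
    and min: "\<And>D'. retract D' C \<Longrightarrow> vdim D' \<noteq> 0 \<Longrightarrow> vdim D \<le> vdim D'"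
    using ex_has_least_nat[of "\<lambda>D. retract D C \<and> vdim D \<noteq> 0" C vdim] nz by blast
  obtain a b where ab: "D \<in> Rep_m" "a \<in> mhom D C" "b \<in> mhom C D" "b * a = 1\<^sub>m (vdim D)"
    using D(1) unfolding retract_def by blast
  have "indecomposable D"
    unfolding indecomposable_def
  proof (intro conjI ballI impI D(2))
    fix D1 D2 :: "'k mrep" assume R: "D1 \<in> Rep_m" "D2 \<in> Rep_m" and iso: "miso D (msum D1 D2)"
    show "vdim D1 = 0 \<or> vdim D2 = 0"
    proof (rule ccontr)
      assume "\<not> ?thesis"
      hence n: "vdim D1 \<noteq> 0" "vdim D2 \<noteq> 0" by auto
      obtain a1 b1 a2 b2 where m: "a1 \<in> mhom D1 D" "b1 \<in> mhom D D1" "a2 \<in> mhom D2 D" "b2 \<in> mhom D D2"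
        "b1 * a1 = 1\<^sub>m (vdim D1)" "b2 * a2 = 1\<^sub>m (vdim D2)" "a1 * b1 + a2 * b2 = 1\<^sub>m (vdim D)"
        by (rule miso_msumD[OF ab(1) R iso]) blast
      note r1 = retract_idempotent[OF ab(1) R(1) m(1,2,5)] and r2 = retract_idempotent[OF ab(1) R(2) m(3,4,6)]
      have ne: "a1 * b1 \<noteq> 1\<^sub>m (vdim D)"
      proof
        assume e: "a1 * b1 = 1\<^sub>m (vdim D)"
        have "a2 * b2 + 1\<^sub>m (vdim D) = 1\<^sub>m (vdim D)"
          using m(7) comm_add_mat[OF mhomD(2)[OF r2(1)] one_carrier_mat] unfolding e by simp
        hence "a2 * b2 = 0\<^sub>m (vdim D) (vdim D)"
          by (rule add_right_cancel_mat[OF _ mhomD(2)[OF r2(1)] one_carrier_mat])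
        thus False using r2(3)[OF n(2)] by blast
      qed
      \<comment> \<open>The dimension of \<open>D1\<close> is not known to be smaller than that of \<open>D\<close>, but that of the image of its
        projection is, as the projection is not the identity.\<close>
      obtain D' \<alpha> \<beta> where D': "D' \<in> Rep_m" "\<alpha> \<in> mhom D' D" "\<beta> \<in> mhom D D'" "\<alpha> * \<beta> = a1 * b1"
        "\<beta> * \<alpha> = 1\<^sub>m (vdim D')" "vdim D' < vdim D"
        by (rule split_idempotent[OF ab(1) r1(1,2)]) (use ne in blast)
      have "retract D' C"
        by (rule retract_trans[OF C _ D(1)]) (use D' in \<open>auto simp: retract_def\<close>)
      moreover have "vdim D' \<noteq> 0"
      proof
        assume "vdim D' = 0"
        hence "\<alpha> * \<beta> = 0\<^sub>m (vdim D) (vdim D)"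
          using mhomD(2)[OF D'(2)] mhomD(2)[OF D'(3)] by (intro mult_inner_zero) auto
        thus False using r1(3)[OF n(1)] D'(4) by simp
      qed
      ultimately show False using min[of D'] D'(6) by simp
    qed
  qed
  moreover obtain E where "E \<in> Rep_m" "miso C (msum D E)"
    using retract_msum[OF C ab] by blast
  ultimately have sd: "superdim D \<noteq> 0" using neat ab(1) unfolding acts_neatly_def by blast
  have "supertrace C (a * b) = supertrace D (b * a)"
    by (rule supertrace_mult[OF mhomD(1)[OF ab(2)] mhomD(1)[OF ab(3)]])
  also have "\<dots> = of_int (superdim D)" unfolding ab(4) by (rule supertrace_one)
  also have "\<dots> \<noteq> 0" using sd by simp
  finally show ?thesis using that retract_idempotent(1)[OF C ab] by blast
qed

text \<open>If the object is zero, its identity and zero endomorphisms are identified, so the identity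
is negligible and every supertrace vanishes. Conversely, supertraces on any other object of maps that
factor through it are supertraces on it.\<close>

lemma ss_zero_object_iff:
  fixes C :: "'k::field mrep"
  assumes C: "C \<in> Rep_m"
  shows "ss_zero_object C \<longleftrightarrow> (\<forall>g\<in>mhom C C. supertrace C g = 0)"
proof
  assume z: "ss_zero_object C"
  let ?n = "vdim C"
  let ?R = "{(f, g). f \<in> mhom C C \<and> g \<in> mhom C C \<and> negligible C C (f - g)}"
  have one: "1\<^sub>m ?n \<in> mhom C C" and zero: "0\<^sub>m ?n ?n \<in> mhom C C" by (intro mhom_one mhom_zero C)+
  have "?R `` {1\<^sub>m ?n} \<in> ss_hom C C" "?R `` {0\<^sub>m ?n ?n} \<in> ss_hom C C"
    unfolding ss_hom_def by (intro quotientI one zero)+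
  moreover have "\<exists>!h. h \<in> ss_hom C C" using z C unfolding ss_zero_object_def by blast
  ultimately have eq: "?R `` {1\<^sub>m ?n} = ?R `` {0\<^sub>m ?n ?n}" by blast
  have d0: "0\<^sub>m ?n ?n - 0\<^sub>m ?n ?n = (0\<^sub>m ?n ?n :: 'k mat)" by (rule eq_matI) auto
  have "negligible C C (0\<^sub>m ?n ?n)"
    unfolding negligible_def using zero by (auto dest!: mhomD(2) simp: supertrace_def)
  hence "negligible C C (0\<^sub>m ?n ?n - 0\<^sub>m ?n ?n)" unfolding d0 .
  hence "0\<^sub>m ?n ?n \<in> ?R `` {0\<^sub>m ?n ?n}" using zero by blast
  hence neg: "negligible C C (1\<^sub>m ?n - 0\<^sub>m ?n ?n)" using eq by blast
  have "1\<^sub>m ?n - 0\<^sub>m ?n ?n = (1\<^sub>m ?n :: 'k mat)" by (rule eq_matI) auto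
  with neg have "negligible C C (1\<^sub>m ?n)" by simp
  thus "\<forall>g\<in>mhom C C. supertrace C g = 0"
    unfolding negligible_def using right_mult_one_mat mhomD(2) by metis
next
  assume st: "\<forall>g\<in>mhom C C. supertrace C g = 0"
  have full: "\<exists>!h. h \<in> S // {(f, g). f \<in> S \<and> g \<in> S \<and> N (f - g)}"
    if "f0 \<in> S" "\<And>f g. f \<in> S \<Longrightarrow> g \<in> S \<Longrightarrow> N (f - g)" for S :: "'k mat set" and N f0
  proof -
    have "S // {(f, g). f \<in> S \<and> g \<in> S \<and> N (f - g)} = {S}"
      using that unfolding quotient_def by auto
    thus ?thesis by simp
  qed
  show "ss_zero_object C"
    unfolding ss_zero_object_def ss_hom_def
  proof (intro ballI conjI)
    fix D :: "'k mrep" assume D: "D \<in> Rep_m"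
    have 1: "negligible C D f" if "f \<in> mhom C D" for f
      unfolding negligible_def using that st mhom_mult[OF _ that C D C] by blast
    have 2: "negligible D C f" if f: "f \<in> mhom D C" for f
      unfolding negligible_def
    proof (intro conjI ballI f)
      fix g assume g: "g \<in> mhom C D"
      have "supertrace D (g * f) = supertrace C (f * g)"
        by (rule supertrace_mult[OF mhomD(1)[OF g] mhomD(1)[OF f]])
      thus "supertrace D (g * f) = 0" using st mhom_mult[OF f g C D C] by simp
    qed
    show "\<exists>!h. h \<in> mhom C D // {(f, g). f \<in> mhom C D \<and> g \<in> mhom C D \<and> negligible C D (f - g)}"
      by (rule full[OF mhom_zero[OF C D]]) (intro 1 mhom_add_minus C D)
    show "\<exists>!h. h \<in> mhom D C // {(f, g). f \<in> mhom D C \<and> g \<in> mhom D C \<and> negligible D C (f - g)}"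
      by (rule full[OF mhom_zero[OF D C]]) (intro 2 mhom_add_minus C D)
  qed
qed

section \<open>The support of a projective representation\<close>

lemma mhom_endo:
  assumes C: "C \<in> Rep_m" and g: "g \<in> mhom C C"
  shows "endo {..<vdim C} (vodd C) (\<lambda>i j. vop C $$ (i, j)) (\<lambda>i j. g $$ (i, j))"
  unfolding endo_def even_on_def commutes_def
proof (intro conjI ballI impI)
  note c = mhomD(2)[OF g] and x = Rep_mD(2)[OF C]
  fix i j assume ij: "i \<in> {..<vdim C}" "j \<in> {..<vdim C}"
  show "vodd C i = vodd C j" if "g $$ (i, j) \<noteq> 0"
    using even_mapsD(2)[OF mhomD(1)[OF g], of i j] ij that by simp
  have "(g * vop C) $$ (i, j) = (vop C * g) $$ (i, j)" unfolding mhomD(3)[OF g] ..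
  thus "(\<Sum>l<vdim C. g $$ (i, l) * vop C $$ (l, j)) = (\<Sum>l<vdim C. vop C $$ (i, l) * g $$ (l, j))"
    using ij entry_mult[OF c x, of i j] entry_mult[OF x c, of i j] by simp
qed

lemma endo_mhom:
  fixes C :: "'k::field mrep"
  assumes C: "C \<in> Rep_m" and g: "endo {..<vdim C} (vodd C) (\<lambda>i j. vop C $$ (i, j)) g"
  shows "mat (vdim C) (vdim C) (\<lambda>(i, j). g i j) \<in> mhom C C"
proof -
  let ?n = "vdim C" and ?g = "mat (vdim C) (vdim C) (\<lambda>(i, j). g i j)"
  have c: "?g \<in> carrier_mat ?n ?n" by simp
  note x = Rep_mD(2)[OF C]
  have "?g * vop C = vop C * ?g"
  proof (rule eq_matI)
    fix i j assume "i < dim_row (vop C * ?g)" "j < dim_col (vop C * ?g)"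
    hence ij: "i < ?n" "j < ?n" using x by auto
    have "(\<Sum>l\<in>{..<?n}. g i l * vop C $$ (l, j)) = (\<Sum>l\<in>{..<?n}. vop C $$ (i, l) * g l j)"
      using g ij unfolding endo_def commutes_def by simp
    thus "(?g * vop C) $$ (i, j) = (vop C * ?g) $$ (i, j)"
      unfolding entry_mult[OF c x ij] entry_mult[OF x c ij] using ij by simp
  qed (use x in auto)
  moreover have "?g \<in> even_maps C C"
    using g unfolding endo_def even_on_def even_maps_def by auto
  ultimately show ?thesis unfolding mhom_def by blast
qed

text \<open>The complement of the negligible summand carries all supertraces and, the summand being nonzero,
is of smaller dimension. This is the form in which the summand enters the tensor powers.\<close>

lemma negligible_summand_carries_strace:
  fixes C :: "'k::field mrep"
  assumes C: "C \<in> Rep_m" and \<epsilon>: "\<epsilon> \<in> mhom C C" "\<epsilon> * \<epsilon> = \<epsilon>" "\<epsilon> \<noteq> 0\<^sub>m (vdim C) (vdim C)"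
    and neg: "\<And>g. g \<in> mhom C C \<Longrightarrow> supertrace C (g * \<epsilon>) = 0"
  obtains \<nu> \<alpha> \<beta> b q where "carries_strace {..<vdim C} (vodd C) (\<lambda>i j. vop C $$ (i, j)) \<nu>"
    "\<forall>i<vdim C. \<forall>j<vdim C. \<nu> i j = mcomp {..<b} \<alpha> \<beta> i j"
    "even_on {..<vdim C} (vodd C) {..<b} q \<alpha>" "b < vdim C"
proof -
  let ?n = "vdim C"
  note co = complement_idempotent[OF C \<epsilon>(1,2)]
  let ?\<nu> = "1\<^sub>m ?n - \<epsilon>"
  note cn = mhomD(2)[OF co(1)] and ce = mhomD(2)[OF \<epsilon>(1)]
  have ne: "?\<nu> \<noteq> 1\<^sub>m ?n"
  proof
    assume "?\<nu> = 1\<^sub>m ?n"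
    hence "\<epsilon> + 1\<^sub>m ?n = 1\<^sub>m ?n" using co(3) by simp
    thus False using add_right_cancel_mat[OF _ ce one_carrier_mat] \<epsilon>(3) by blast
  qed
  obtain E \<alpha> \<beta> where E: "E \<in> Rep_m" "\<alpha> \<in> mhom E C" "\<beta> \<in> mhom C E" "\<alpha> * \<beta> = ?\<nu>" "vdim E < ?n"
    by (rule split_idempotent[OF C co(1,2)]) (use ne in blast)
  note ca = mhomD(2)[OF E(2)] and cb = mhomD(2)[OF E(3)]
  show ?thesis
  proof (rule that[of "\<lambda>i j. ?\<nu> $$ (i, j)" "vdim E" "\<lambda>i j. \<alpha> $$ (i, j)" "\<lambda>i j. \<beta> $$ (i, j)" "vodd E"])
    show "carries_strace {..<?n} (vodd C) (\<lambda>i j. vop C $$ (i, j)) (\<lambda>i j. ?\<nu> $$ (i, j))"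
      unfolding carries_strace_def
    proof (intro conjI allI impI mhom_endo[OF C co(1)])
      fix g assume "endo {..<?n} (vodd C) (\<lambda>i j. vop C $$ (i, j)) g"
      define g' where "g' = mat ?n ?n (\<lambda>(i, j). g i j)"
      have g': "g' \<in> mhom C C" unfolding g'_def by (rule endo_mhom[OF C]) fact
      note cg = mhomD(2)[OF g']
      have gi: "g' $$ (i, j) = g i j" if "i < ?n" "j < ?n" for i j using that by (simp add: g'_def)
      have "strace {..<?n} (vodd C) (mcomp {..<?n} g (\<lambda>i j. ?\<nu> $$ (i, j))) = supertrace C (g' * ?\<nu>)"
        unfolding strace_def supertrace_def
      proof (intro sum.cong refl)
        fix i assume "i \<in> {..<?n}"
        hence i: "i < ?n" by simp
        show "ksign (vodd C i) * mcomp {..<?n} g (\<lambda>i j. ?\<nu> $$ (i, j)) i i =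
            ksign (vodd C i) * (g' * ?\<nu>) $$ (i, i)"
          unfolding entry_mult[OF cg cn i i] mcomp_def using i by (simp add: gi)
      qed
      also have "g' * ?\<nu> = g' - g' * \<epsilon>"
        using mult_minus_distrib_mat[OF cg one_carrier_mat ce] cg by simp
      also have "supertrace C (g' - g' * \<epsilon>) = supertrace C g' - supertrace C (g' * \<epsilon>)"
        by (rule supertrace_linear(2)[OF cg mult_carrier_mat[OF cg ce]])
      also have "\<dots> = strace {..<?n} (vodd C) g"
        unfolding neg[OF g'] unfolding diff_0_right supertrace_def strace_def
        by (rule sum.cong[OF refl]) (simp add: gi)
      finally show "strace {..<?n} (vodd C) g = strace {..<?n} (vodd C) (mcomp {..<?n} g (\<lambda>i j. ?\<nu> $$ (i, j)))"
        by simp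
    qed
    show "\<forall>i<?n. \<forall>j<?n. ?\<nu> $$ (i, j) =
        mcomp {..<vdim E} (\<lambda>i j. \<alpha> $$ (i, j)) (\<lambda>i j. \<beta> $$ (i, j)) i j"
      unfolding E(4)[symmetric] mcomp_def by (intro allI impI entry_mult[OF ca cb])
    show "even_on {..<?n} (vodd C) {..<vdim E} (vodd E) (\<lambda>i j. \<alpha> $$ (i, j))"
      using even_mapsD(2)[OF mhomD(1)[OF E(2)]] unfolding even_on_def by simp
    show "vdim E < ?n" by (rule E(5))
  qed
qed

lemma restrict_m_simps:
  "vdim (restrict_m x M) = vdim M" "vodd (restrict_m x M) = vodd M"
  "i < vdim M \<Longrightarrow> j < vdim M \<Longrightarrow> vop (restrict_m x M) $$ (i, j) = odd_action x (vodd M) (vcoef M) i j"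
  by (simp_all add: restrict_m_def odd_action_def)

lemma restrict_m_Rep_m:
  fixes G :: "('i, 'k::field) hopf_super"
  assumes G: "algebraic_supergroup G" and x: "x \<in> lie_odd G" and M: "M \<in> Rep G"
  shows "restrict_m x M \<in> Rep_m"
proof -
  interpret hopf G by (unfold_locales) (rule G)
  have "odd_on {..<vdim M} (vodd M) (odd_action x (vodd M) (vcoef M))"
    by (rule odd_action_odd[OF x]) (use M in \<open>simp add: Rep_comod\<close>)
  hence "vodd M i \<noteq> vodd M j" if "i < vdim M" "j < vdim M" "vop (restrict_m x M) $$ (i, j) \<noteq> 0" for i j
    using that unfolding odd_on_def by (simp add: restrict_m_simps)
  moreover have "vop (restrict_m x M) \<in> carrier_mat (vdim M) (vdim M)" by (simp add: restrict_m_def)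
  ultimately show ?thesis unfolding Rep_m_def odd_ops_def by (simp add: restrict_m_simps)
qed

lemma endo_cong:
  assumes "\<And>i j. i \<in> I \<Longrightarrow> j \<in> I \<Longrightarrow> X i j = Y i j"
  shows "endo I p X g \<longleftrightarrow> endo I p Y g"
  unfolding endo_def commutes_def using assms by (simp cong: sum.cong ball_cong)

lemma not_neat_projective_negligible:
  fixes G :: "('i, 'k :: {alg_closed_field, field_char_0}) hopf_super"
  assumes G: "algebraic_supergroup G" and x: "x \<in> lie_odd G" and M: "M \<in> Rep G"
    and nn: "\<not> acts_neatly (restrict_m x M)" and P: "projective_rep G P"
    and g: "g \<in> mhom (restrict_m x P) (restrict_m x P)"
  shows "supertrace (restrict_m x P) g = 0"
proof -
  let ?C = "restrict_m x M"
  have C: "?C \<in> Rep_m" by (rule restrict_m_Rep_m[OF G x M])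
  obtain \<epsilon> where \<epsilon>: "\<epsilon> \<in> mhom ?C ?C" "\<epsilon> * \<epsilon> = \<epsilon>" "\<epsilon> \<noteq> 0\<^sub>m (vdim ?C) (vdim ?C)"
    "\<And>g. g \<in> mhom ?C ?C \<Longrightarrow> supertrace ?C (g * \<epsilon>) = 0"
    by (rule not_neat_negligible_summand[OF C nn]) blast
  obtain \<nu> \<alpha> \<beta> b q where \<nu>: "carries_strace {..<vdim M} (vodd M) (\<lambda>i j. vop ?C $$ (i, j)) \<nu>"
    "\<forall>i<vdim M. \<forall>j<vdim M. \<nu> i j = mcomp {..<b} \<alpha> \<beta> i j"
    "even_on {..<vdim M} (vodd M) {..<b} q \<alpha>" "b < vdim M"
    by (rule negligible_summand_carries_strace[OF C \<epsilon>, unfolded restrict_m_simps(1,2)])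
  have "carries_strace {..<vdim M} (vodd M) (odd_action x (vodd M) (vcoef M)) \<nu>"
    by (rule carries_strace_cong[OF \<nu>(1)]) (simp_all add: restrict_m_simps)
  moreover have "comod G {..<vdim M} (vodd M) (vcoef M)" using M by (simp add: Rep_comod)
  ultimately obtain W :: "(nat \<Rightarrow> nat \<Rightarrow> nat) set" and p c E where neg: "negligible_endo G x W p c E"
    using exists_negligible_endo[OF G x, of "{..<vdim M}" "vodd M" "vcoef M" \<nu> "{..<b}" \<alpha> \<beta> q] \<nu>(2-4) by auto
  have PR: "P \<in> Rep G" using P unfolding projective_rep_def by blast
  have R: "restrict_m x P \<in> Rep_m" by (rule restrict_m_Rep_m[OF G x PR])
  have "endo {..<vdim P} (vodd P) (\<lambda>i j. vop (restrict_m x P) $$ (i, j)) (\<lambda>i j. g $$ (i, j))"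
    using mhom_endo[OF R g] unfolding restrict_m_simps(1,2) .
  hence "endo {..<vdim P} (vodd P) (odd_action x (vodd P) (vcoef P)) (\<lambda>i j. g $$ (i, j))"
    by (subst endo_cong[of _ _ "\<lambda>i j. vop (restrict_m x P) $$ (i, j)"]) (simp_all add: restrict_m_simps)
  from projective_strace_zero[OF G x P neg this]
  show ?thesis by (simp add: strace_def supertrace_def restrict_m_simps)
qed

theorem proposition6p5p8:
  fixes G :: "('i, 'k :: {alg_closed_field, field_char_0}) hopf_super"
    and P :: "('i, 'k) grep"
  assumes "algebraic_supergroup G"
    and "projective_rep G P"
    and "vdim P \<noteq> 0"
  shows "supp G P = lie_neat G"
proof (intro equalityI subsetI)
  have P: "P \<in> Rep G" using assms(2) unfolding projective_rep_def by blast
  fix x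
  {
    assume "x \<in> supp G P"
    hence x: "x \<in> lie_odd G" and "\<not> ss_zero_object (restrict_m x P)" unfolding supp_def by auto
    then obtain g where "g \<in> mhom (restrict_m x P) (restrict_m x P)" "supertrace (restrict_m x P) g \<noteq> 0"
      using ss_zero_object_iff[OF restrict_m_Rep_m[OF assms(1) x P]] by blast
    hence "\<forall>M\<in>Rep G. acts_neatly (restrict_m x M)"
      using not_neat_projective_negligible[OF assms(1) x _ _ assms(2)] by blast
    thus "x \<in> lie_neat G" using x unfolding lie_neat_def nilpotent_elem_def acts_neatly_def by blast
  }
  {
    assume "x \<in> lie_neat G"
    hence x: "x \<in> lie_odd G" and n: "acts_neatly (restrict_m x P)" unfolding lie_neat_def using P by auto
    have R: "restrict_m x P \<in> Rep_m" by (rule restrict_m_Rep_m[OF assms(1) x P])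
    obtain g where "g \<in> mhom (restrict_m x P) (restrict_m x P)" "supertrace (restrict_m x P) g \<noteq> 0"
      by (rule neat_supertrace[OF R n]) (use assms(3) in \<open>simp_all add: restrict_m_simps\<close>)
    thus "x \<in> supp G P" using x ss_zero_object_iff[OF R] unfolding supp_def by blast
  }
qed

end
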